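(* Let $(\overline N,g_{\overline N})$ be a tree-level q-map space associated with a projective special real manifold $(\mathcal H,g_{\mathcal H})$ with $\dim\mathcal H=n-1\ge0$. Then there is a $(3n+6)$-dimensional connected Lie group $G$ of isometries of $(\overline N,g_{\overline N})$ containing the isometries of the $L$-action and of the S-duality action. The Lie algebra $\mathfrak g$ of $G$ is (as a Lie algebra of vector fields on $\overline N$) spanned by $D,X_e=P_0,X_f,X_h,V_a,P_a,X^i,Z$ and has the structure $$\mathfrak g=\mathbb RD\ltimes\big(\mathfrak{sl}_2(\mathbb R)^{\mathrm{op}}\ltimes(\mathbb R^n\ltimes\mathfrak h)\big),$$ where $\mathfrak{sl}_2(\mathbb R)^{\mathrm{op}}=\mathrm{span}\{X_e,X_f,X_h\}$, $\mathbb R^n=\mathrm{span}\{V_a\}$, $\mathfrak h=\mathrm{span}\{Z,P_a,X^i\}$ ($a=1,\dots,n$, $i=0,\dots,n$), and the non-trivial brackets are $[P_i,X^j]=-2\delta_i^jZ$, $[X^i,D]=\frac12X^i$, $[P_i,D]=\frac12P_i$, $[Z,D]=Z$; $[X_e,X_f]=-X_h$, $[X_h,X_e]=-2X_e$, $[X_h,X_f]=2X_f$; $[P_0,V_a]=P_a$, $[V_a,P_b]=k_{abc}X^c$, $[V_a,X^b]=\delta_a^bX^0$, $[X_h,V_a]=V_a$, $[X_f,P_a]=V_a$, $[D,X_f]=\frac12X_f$, $[Z,X_f]=\frac12X^0$, $[P_a,X_h]=P_a$, $[X_h,X^0]=X^0$, $[Z,X_h]=Z$.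
   Context: Conventions: indices $a,b,c,\dots$ run from $1$ to $n$, indices $i,j,k,\dots$ from $0$ to $n$; repeated indices are summed. PSR manifold: let $h(t)=\frac16 k_{abc}t^at^bt^c$ ($k_{abc}\in\mathbb R$ symmetric) be a homogeneous cubic polynomial on $\mathbb R^n$. A projective special real (PSR) manifold is a hypersurface $\mathcal H\subset\{t\in\mathbb R^n\mid h(t)=1\}$ such that $g_{\mathcal H}=-\partial^2h|_{T\mathcal H\times T\mathcal H}$ is a Riemannian metric. Tree-level q-map space: put $U=\mathbb R_{>0}\cdot\mathcal H\subset\mathbb R^n$, $\overline M=\mathbb R^n+iU\subset\mathbb C^n$ with coordinates $z^a=b^a+it^a$, $z^0:=1$, $K(t)=8h(t)$, $\mathcal K=-\log K$, and $g_{\overline M}=\frac{\partial^2\mathcal K}{\partial z^a\partial\overline z^b}dz^ad\overline z^b=-\frac14\frac{\partial^2\log h}{\partial t^a\partial t^b}(db^adb^b+dt^adt^b)$. Let $\mathfrak F(X)=-h(X^1,\dots,X^n)/X^0$, $\tau_{ij}=\frac{\partial^2\mathfrak F}{\partial X^i\partial X^j}$ evaluated at $X=(1,z)$, $N_{ij}=-2\,\mathrm{Im}(\tau_{ij})$, $(N^{ij})=(N_{ij})^{-1}$, $W_i=d\widetilde\zeta_i-\tau_{ij}d\zeta^j$; then $K=N_{ij}z^i\overline z^j$. The tree-level q-map space is $\overline N=\overline M\times\mathbb R_{>0}\times\mathbb R^{2n+2}\times\mathbb R$ with global ("type IIA") coordinates $(z^a,\rho,\widetilde\zeta_i,\zeta^i,\sigma)$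 and metric $$g_{\overline N}=g_{\overline M}+\frac{d\rho^2}{4\rho^2}-\frac1{4\rho}\Big(N^{ij}-\frac2Kz^i\overline z^j\Big)W_i\overline W_j+\frac1{64\rho^2}\big(d\sigma+\widetilde\zeta_id\zeta^i-\zeta^id\widetilde\zeta_i\big)^2 .$$ $L$-action: $L=L_1\ltimes L_2$ (dimension $3n+5$) is the connected group acting by isometries generated by the following transformations. $L_2=\mathrm{Iwa}(\mathrm{SU}(1,n+2))$ consists of $(r,\widetilde\eta_i,\eta^i,\kappa)\in\mathbb R_{>0}\times\mathbb R^{2n+3}$ acting by $z^a\mapsto z^a$, $\rho\mapsto r\rho$, $\widetilde\zeta_i\mapsto\widetilde\eta_i+\sqrt r\widetilde\zeta_i$, $\zeta^i\mapsto\eta^i+\sqrt r\zeta^i$, $\sigma\mapsto\kappa+r\sigma+\sqrt r(\eta^i\widetilde\zeta_i-\widetilde\eta_i\zeta^i)$. $L_1=\mathbb R_{>0}\ltimes\mathbb R^n$ acts by $\lambda\in\mathbb R_{>0}$: $(z^a,\rho,\zeta^0,\zeta^a,\widetilde\zeta_0,\widetilde\zeta_a,\sigma)\mapsto(\lambda z^a,\rho,\lambda^{-3/2}\zeta^0,\lambda^{-1/2}\zeta^a,\lambda^{3/2}\widetilde\zeta_0,\lambda^{1/2}\widetilde\zeta_a,\sigma)$, and by $v\in\mathbb R^n$: $z^a\mapsto z^a+v^a$, $\zeta^a\mapsto\zeta^a+\zeta^0v^a$, $\widetilde\zeta_0\mapsto\widetilde\zeta_0+\frac16k_{abc}v^av^bv^c\zeta^0+\frac12k_{abc}v^av^b\zeta^c-\widetilde\zeta_av^a$,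 $\widetilde\zeta_a\mapsto\widetilde\zeta_a-\frac12\zeta^0k_{abc}v^bv^c-k_{abc}v^b\zeta^c$, with $\rho,\zeta^0,\sigma$ fixed. Infinitesimal generators: $D=\rho\partial_\rho+\frac12\widetilde\zeta_i\partial_{\widetilde\zeta_i}+\frac12\zeta^i\partial_{\zeta^i}+\sigma\partial_\sigma$, $P_i=\partial_{\zeta^i}+\widetilde\zeta_i\partial_\sigma$, $X^i=\partial_{\widetilde\zeta_i}-\zeta^i\partial_\sigma$, $Z=\partial_\sigma$, $V_a=\partial_{b^a}+\zeta^0\partial_{\zeta^a}-\widetilde\zeta_a\partial_{\widetilde\zeta_0}-k_{abc}\zeta^c\partial_{\widetilde\zeta_b}$, $D_1=b^a\partial_{b^a}+t^a\partial_{t^a}-\frac32\zeta^0\partial_{\zeta^0}-\frac12\zeta^a\partial_{\zeta^a}+\frac12\widetilde\zeta_a\partial_{\widetilde\zeta_a}+\frac32\widetilde\zeta_0\partial_{\widetilde\zeta_0}$. S-duality: "type IIB" global coordinates $(b^a+it^a,\tau_1+i\tau_2,c^a,c_a,c_0,\psi)$ on $\overline N$ (with $b^a+it^a\in\overline M$, $\tau_2>0$, the others real) are defined by $\rho=\frac{\tau_2^2}{2}h(t)$, $z^a=b^a+it^a$, $\zeta^0=\tau_1$, $\zeta^a=-(c^a-\tau_1b^a)$, $\widetilde\zeta_a=c_a+\frac{k_{abc}}2b^b(c^c-\tau_1b^c)$, $\widetilde\zeta_0=c_0-\frac{k_{abc}}6b^ab^b(c^c-\tau_1b^c)$, $\sigma=-2(\psi+\frac12\tau_1c_0)+c_a(c^a-\tau_1b^a)-\frac{k_{abc}}6b^ac^b(c^c-\tau_1b^c)$.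 The S-duality action of $\begin{pmatrix}a&b\\ c&d\end{pmatrix}\in\mathrm{SL}(2,\mathbb R)$ is, with $\tau=\tau_1+i\tau_2$, $$\tau\mapsto\frac{a\tau+b}{c\tau+d},\quad t^a\mapsto|c\tau+d|t^a,\quad c_a\mapsto c_a,\quad\begin{pmatrix}c^a\\ b^a\end{pmatrix}\mapsto\begin{pmatrix}a&b\\ c&d\end{pmatrix}\begin{pmatrix}c^a\\ b^a\end{pmatrix},\quad\begin{pmatrix}c_0\\ \psi\end{pmatrix}\mapsto\begin{pmatrix}d&-c\\ -b&a\end{pmatrix}\begin{pmatrix}c_0\\ \psi\end{pmatrix}.$$ $X_e,X_f,X_h$ are the fundamental vector fields $p\mapsto\frac{d}{ds}|_{s=0}\exp(sx)\cdot p$ of this action for $x=e=\begin{pmatrix}0&1\\ 0&0\end{pmatrix},\ f=\begin{pmatrix}0&0\\ 1&0\end{pmatrix},\ h=\begin{pmatrix}1&0\\ 0&-1\end{pmatrix}$; one has $X_e=P_0$ and $X_h=D-D_1$. *)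

theory Defs
  imports
    "HOL-Analysis.Analysis"
    "HOL-Library.Function_Algebras"
    "HOL-Algebra.Bij"
    "HOL-Algebra.Generated_Groups"
begin

section \<open>Smooth maps and manifolds\<close>

text \<open>The set \<open>S\<close> is meant to be open: all derivatives are taken in the ambient space.\<close>

primrec Ck_on :: "nat \<Rightarrow> ('a::real_normed_vector \<Rightarrow> 'b::real_normed_vector) \<Rightarrow> 'a set \<Rightarrow> bool" where
  "Ck_on 0 = (\<lambda>f S. continuous_on S f)"
| "Ck_on (Suc m) = (\<lambda>f S. (\<forall>x\<in>S. f differentiable (at x)) \<and>
     (\<forall>v. Ck_on m (\<lambda>x. frechet_derivative f (at x) v) S))"

definition smooth_on :: "'a::real_normed_vector set \<Rightarrow> ('a \<Rightarrow> 'b::real_normed_vector) \<Rightarrow> bool" where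
  "smooth_on S f \<longleftrightarrow> (\<forall>m. Ck_on m f S)"

text \<open>A chart is a pair of its domain and its coordinate map; the coordinate map is irrelevant
  outside the domain.\<close>

type_synonym ('a, 'e) atlas = "('a set \<times> ('a \<Rightarrow> 'e)) set"

definition smooth_manifold :: "'a topology \<Rightarrow> ('a, 'e::euclidean_space) atlas \<Rightarrow> bool" where
  "smooth_manifold T A \<longleftrightarrow>
     Hausdorff_space T \<and> second_countable T \<and> \<Union>(fst ` A) = topspace T \<and>
     (\<forall>(U, \<phi>)\<in>A. openin T U \<and> open (\<phi> ` U) \<and>
        homeomorphic_map (subtopology T U) (top_of_set (\<phi> ` U)) \<phi>) \<and>
     (\<forall>(U, \<phi>)\<in>A. \<forall>(V, \<psi>)\<in>A. smooth_on (\<phi> ` (U \<inter> V)) (\<psi> \<circ> inv_into U \<phi>))"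

definition smooth_map ::
  "'a topology \<Rightarrow> ('a, 'e::euclidean_space) atlas \<Rightarrow>
   'b topology \<Rightarrow> ('b, 'f::euclidean_space) atlas \<Rightarrow> ('a \<Rightarrow> 'b) \<Rightarrow> bool" where
  "smooth_map T A T' A' f \<longleftrightarrow> continuous_map T T' f \<and>
     (\<forall>(U, \<phi>)\<in>A. \<forall>(V, \<psi>)\<in>A'. smooth_on (\<phi> ` {x\<in>U. f x \<in> V}) (\<psi> \<circ> f \<circ> inv_into U \<phi>))"

definition prod_atlas :: "('a, 'e) atlas \<Rightarrow> ('b, 'f) atlas \<Rightarrow> ('a \<times> 'b, 'e \<times> 'f) atlas" where
  "prod_atlas A B = {(U \<times> V, map_prod \<phi> \<psi>) | U \<phi> V \<psi>. (U, \<phi>) \<in> A \<and> (V, \<psi>) \<in> B}"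

text \<open>The dimension of the Lie group is that of the space \<open>'e\<close> in which its charts take values.\<close>

definition lie_group ::
  "('a, 'm) monoid_scheme \<Rightarrow> 'a topology \<Rightarrow> ('a, 'e::euclidean_space) atlas \<Rightarrow> bool" where
  "lie_group Gr T A \<longleftrightarrow> group Gr \<and> topspace T = carrier Gr \<and> smooth_manifold T A \<and>
     smooth_map (prod_topology T T) (prod_atlas A A) T A (\<lambda>(x, y). x \<otimes>\<^bsub>Gr\<^esub> y) \<and>
     smooth_map T A T A (\<lambda>x. inv\<^bsub>Gr\<^esub> x)"

text \<open>A group of transformations of an open set \<open>N\<close>, with a Lie group structure for which the
  tautological action on \<open>N\<close> is smooth.\<close>

definition lie_transformation_group ::
  "'p::euclidean_space set \<Rightarrow> ('p \<Rightarrow> 'p) set \<Rightarrow> ('p \<Rightarrow> 'p) topology \<Rightarrow>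
   ('p \<Rightarrow> 'p, 'e::euclidean_space) atlas \<Rightarrow> bool" where
  "lie_transformation_group N G T A \<longleftrightarrow>
     subgroup G (BijGroup N) \<and> lie_group (BijGroup N\<lparr>carrier := G\<rparr>) T A \<and>
     smooth_map (prod_topology T (top_of_set N)) (prod_atlas A {(N, id)})
       (top_of_set N) {(N, id)} (\<lambda>(\<phi>, p). \<phi> p)"

text \<open>A (pseudo-)Riemannian metric on an open set \<open>N\<close> is given as a function \<open>g\<close> of a point and two
  tangent vectors.\<close>

definition isometries ::
  "'p::euclidean_space set \<Rightarrow> ('p \<Rightarrow> 'p \<Rightarrow> 'p \<Rightarrow> real) \<Rightarrow> ('p \<Rightarrow> 'p) set" where
  "isometries N g = {\<phi> \<in> Bij N. smooth_on N \<phi> \<and> smooth_on N (inv_into N \<phi>) \<and>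
     (\<forall>p\<in>N. \<forall>u v. g (\<phi> p) (frechet_derivative \<phi> (at p) u) (frechet_derivative \<phi> (at p) v) = g p u v)}"


section \<open>Lie algebras of vector fields\<close>

instantiation "fun" :: (type, real_vector) real_vector
begin

definition scaleR_fun :: "real \<Rightarrow> ('a \<Rightarrow> 'b) \<Rightarrow> 'a \<Rightarrow> 'b" where
  "scaleR_fun c f = (\<lambda>x. c *\<^sub>R f x)"

instance
  by standard (simp_all add: scaleR_fun_def fun_eq_iff scaleR_add_right scaleR_add_left)

end

text \<open>A vector field on an open set \<open>N\<close> is represented by a function that vanishes outside \<open>N\<close>, so
  that equality of functions is equality of vector fields on \<open>N\<close>.\<close>

definition vf_on :: "'a set \<Rightarrow> ('a \<Rightarrow> 'b::zero) \<Rightarrow> 'a \<Rightarrow> 'b" where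
  "vf_on N X = (\<lambda>p. if p \<in> N then X p else 0)"

definition lie_bracket ::
  "'p::real_normed_vector set \<Rightarrow> ('p \<Rightarrow> 'p) \<Rightarrow> ('p \<Rightarrow> 'p) \<Rightarrow> 'p \<Rightarrow> 'p" where
  "lie_bracket N X Y =
     vf_on N (\<lambda>p. frechet_derivative Y (at p) (X p) - frechet_derivative X (at p) (Y p))"

text \<open>The Lie algebra of a Lie transformation group: the images of the tangent vectors \<open>\<gamma>'(0)\<close> at the
  identity under the differentials of the orbit maps \<open>\<phi> \<mapsto> \<phi> p\<close>.\<close>

definition lie_algebra_vf ::
  "'p::euclidean_space set \<Rightarrow> ('p \<Rightarrow> 'p) topology \<Rightarrow> ('p \<Rightarrow> 'p, 'e::euclidean_space) atlas \<Rightarrow>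
   ('p \<Rightarrow> 'p) set" where
  "lie_algebra_vf N T A =
     {vf_on N (\<lambda>p. vector_derivative (\<lambda>s. \<gamma> s p) (at 0)) | \<gamma>.
        smooth_map euclideanreal {(UNIV, id)} T A \<gamma> \<and> \<gamma> 0 = \<one>\<^bsub>BijGroup N\<^esub>}"

definition lie_subalgebra :: "'p::real_normed_vector set \<Rightarrow> ('p \<Rightarrow> 'p) set \<Rightarrow> bool" where
  "lie_subalgebra N \<aa> \<longleftrightarrow> subspace \<aa> \<and> (\<forall>X\<in>\<aa>. \<forall>Y\<in>\<aa>. lie_bracket N X Y \<in> \<aa>)"

text \<open>\<open>\<cc>\<close> is the internal semidirect sum of the subalgebra \<open>\<aa>\<close> and the ideal \<open>\<bb>\<close>.\<close>

definition semidirect_sum ::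
  "'p::real_normed_vector set \<Rightarrow> ('p \<Rightarrow> 'p) set \<Rightarrow> ('p \<Rightarrow> 'p) set \<Rightarrow> ('p \<Rightarrow> 'p) set \<Rightarrow> bool" where
  "semidirect_sum N \<cc> \<aa> \<bb> \<longleftrightarrow>
     lie_subalgebra N \<aa> \<and> lie_subalgebra N \<bb> \<and>
     \<cc> = {X + Y | X Y. X \<in> \<aa> \<and> Y \<in> \<bb>} \<and> \<aa> \<inter> \<bb> = {0} \<and>
     (\<forall>X\<in>\<cc>. \<forall>Y\<in>\<bb>. lie_bracket N X Y \<in> \<bb>)"

definition sl2 :: "(real^2^2) set" where
  "sl2 = {x. trace x = 0}"

text \<open>The bracket of the opposite Lie algebra is \<open>(x, y) \<mapsto> yx - xy\<close>.\<close>

definition isomorphic_sl2_op :: "'p::real_normed_vector set \<Rightarrow> ('p \<Rightarrow> 'p) set \<Rightarrow> bool" where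
  "isomorphic_sl2_op N \<aa> \<longleftrightarrow>
     (\<exists>F. linear F \<and> bij_betw F sl2 \<aa> \<and>
       (\<forall>x\<in>sl2. \<forall>y\<in>sl2. lie_bracket N (F x) (F y) = F (y ** x - x ** y)))"


section \<open>Projective special real manifolds\<close>

definition partial :: "'i::finite \<Rightarrow> (('a::real_normed_field)^'i \<Rightarrow> 'a) \<Rightarrow> 'a^'i \<Rightarrow> 'a" where
  "partial i f x = deriv (\<lambda>s. f (\<chi> j. if j = i then s else x $ j)) (x $ i)"

text \<open>The cubic form is also evaluated at complex arguments.\<close>

definition cubic :: "('n::finite \<Rightarrow> 'n \<Rightarrow> 'n \<Rightarrow> real) \<Rightarrow> ('a::real_normed_field)^'n \<Rightarrow> 'a" where
  "cubic k t = (\<Sum>a\<in>UNIV. \<Sum>b\<in>UNIV. \<Sum>c\<in>UNIV. of_real (k a b c) * t $ a * t $ b * t $ c) / 6"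

definition smooth_hypersurface :: "'a::euclidean_space set \<Rightarrow> bool" where
  "smooth_hypersurface S \<longleftrightarrow>
     (\<forall>p\<in>S. \<exists>W (f :: 'a \<Rightarrow> real). open W \<and> p \<in> W \<and> smooth_on W f \<and>
        (\<forall>x\<in>W. frechet_derivative f (at x) \<noteq> (\<lambda>v. 0)) \<and> S \<inter> W = {x\<in>W. f x = 0})"

definition tangent_space :: "'a::euclidean_space set \<Rightarrow> 'a \<Rightarrow> 'a set" where
  "tangent_space S p =
     {v. \<exists>e \<gamma>. (0::real) < e \<and> smooth_on {-e<..<e} \<gamma> \<and> \<gamma> ` {-e<..<e} \<subseteq> S \<and>
           \<gamma> 0 = p \<and> (\<gamma> has_vector_derivative v) (at 0)}"

definition psr_manifold :: "('n::finite \<Rightarrow> 'n \<Rightarrow> 'n \<Rightarrow> real) \<Rightarrow> (real^'n) set \<Rightarrow> bool" where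
  "psr_manifold k H \<longleftrightarrow>
     H \<noteq> {} \<and> smooth_hypersurface H \<and> H \<subseteq> {t. cubic k t = 1} \<and>
     (\<forall>p\<in>H. \<forall>v\<in>tangent_space H p. v \<noteq> 0 \<longrightarrow>
        - (\<Sum>a\<in>UNIV. \<Sum>b\<in>UNIV. partial a (partial b (cubic k)) p * v $ a * v $ b) > 0)"


section \<open>The tree-level q-map space\<close>

text \<open>Points, and tangent vectors, in type IIA coordinates \<open>(z, \<rho>, \<zeta>~, \<zeta>, \<sigma>)\<close>. The index set
  \<open>{1..n}\<close> is the finite type \<open>'n\<close>, and \<open>{0..n}\<close> is \<open>'n option\<close>, with \<open>None\<close> as the index \<open>0\<close>.\<close>

type_synonym 'n iia =
  "(complex^'n) \<times> real \<times> (real^('n option)) \<times> (real^('n option)) \<times> real"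

definition re_vec :: "complex^'n \<Rightarrow> real^'n" where
  "re_vec z = (\<chi> a. Re (z $ a))"

definition im_vec :: "complex^'n \<Rightarrow> real^'n" where
  "im_vec z = (\<chi> a. Im (z $ a))"

definition cone_over :: "'a::real_vector set \<Rightarrow> 'a set" where
  "cone_over H = {s *\<^sub>R x | s x. 0 < s \<and> x \<in> H}"

definition qmap_space :: "(real^'n) set \<Rightarrow> 'n::finite iia set" where
  "qmap_space H = {(z, \<rho>, \<zeta>t, \<zeta>, \<sigma>). im_vec z \<in> cone_over H \<and> 0 < \<rho>}"

definition homog :: "complex^'n \<Rightarrow> complex^('n::finite option)" where
  "homog z = (\<chi> i. case i of None \<Rightarrow> 1 | Some a \<Rightarrow> z $ a)"

definition prepotential :: "('n::finite \<Rightarrow> 'n \<Rightarrow> 'n \<Rightarrow> real) \<Rightarrow> complex^('n option) \<Rightarrow> complex" where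
  "prepotential k X = - cubic k (\<chi> a. X $ Some a) / X $ None"

definition tau :: "('n::finite \<Rightarrow> 'n \<Rightarrow> 'n \<Rightarrow> real) \<Rightarrow> complex^'n \<Rightarrow> complex^('n option)^('n option)" where
  "tau k z = (\<chi> i j. partial i (partial j (prepotential k)) (homog z))"

definition N_mat :: "('n::finite \<Rightarrow> 'n \<Rightarrow> 'n \<Rightarrow> real) \<Rightarrow> complex^'n \<Rightarrow> real^('n option)^('n option)" where
  "N_mat k z = (\<chi> i j. - 2 * Im (tau k z $ i $ j))"

definition W_form ::
  "('n::finite \<Rightarrow> 'n \<Rightarrow> 'n \<Rightarrow> real) \<Rightarrow> complex^'n \<Rightarrow> 'n option \<Rightarrow> 'n iia \<Rightarrow> complex" where
  "W_form k z i = (\<lambda>(dz, d\<rho>, d\<zeta>t, d\<zeta>, d\<sigma>).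
     of_real (d\<zeta>t $ i) - (\<Sum>j\<in>UNIV. tau k z $ i $ j * of_real (d\<zeta> $ j)))"

definition base_metric ::
  "('n::finite \<Rightarrow> 'n \<Rightarrow> 'n \<Rightarrow> real) \<Rightarrow> complex^'n \<Rightarrow> complex^'n \<Rightarrow> complex^'n \<Rightarrow> real" where
  "base_metric k z u v =
     - (1/4) * (\<Sum>a\<in>UNIV. \<Sum>b\<in>UNIV. partial a (partial b (\<lambda>t. ln (cubic k t))) (im_vec z) *
         (Re (u $ a) * Re (v $ b) + Im (u $ a) * Im (v $ b)))"

definition contact_form :: "'n::finite iia \<Rightarrow> 'n iia \<Rightarrow> real" where
  "contact_form = (\<lambda>(z, \<rho>, \<zeta>t, \<zeta>, \<sigma>) (dz, d\<rho>, d\<zeta>t, d\<zeta>, d\<sigma>).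
     d\<sigma> + (\<Sum>i\<in>UNIV. \<zeta>t $ i * d\<zeta> $ i - \<zeta> $ i * d\<zeta>t $ i))"

text \<open>Products of one-forms are symmetric products. As \<open>N\<^sup>i\<^sup>j - 2/K z\<^sup>i cnj(z\<^sup>j)\<close> is Hermitian, polarizing
  the quadratic form in \<open>W\<close> amounts to taking the real part of the sesquilinear form.\<close>

definition qmap_metric ::
  "('n::finite \<Rightarrow> 'n \<Rightarrow> 'n \<Rightarrow> real) \<Rightarrow> 'n iia \<Rightarrow> 'n iia \<Rightarrow> 'n iia \<Rightarrow> real" where
  "qmap_metric k p u v = (case p of (z, \<rho>, \<zeta>t, \<zeta>, \<sigma>) \<Rightarrow>
     let Ninv = matrix_inv (N_mat k z); K = 8 * cubic k (im_vec z); zh = homog z in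
     base_metric k z (fst u) (fst v)
     + fst (snd u) * fst (snd v) / (4 * \<rho>\<^sup>2)
     - 1 / (4 * \<rho>) * Re (\<Sum>i\<in>UNIV. \<Sum>j\<in>UNIV.
         (of_real (Ninv $ i $ j) - of_real (2 / K) * zh $ i * cnj (zh $ j)) *
         W_form k z i u * cnj (W_form k z j v))
     + 1 / (64 * \<rho>\<^sup>2) * contact_form p u * contact_form p v)"


section \<open>The L-action\<close>

definition L2_transf ::
  "real \<Rightarrow> real^('n option) \<Rightarrow> real^('n option) \<Rightarrow> real \<Rightarrow> 'n::finite iia \<Rightarrow> 'n iia" where
  "L2_transf r \<eta>t \<eta> \<kappa> = (\<lambda>(z, \<rho>, \<zeta>t, \<zeta>, \<sigma>).
     (z, r * \<rho>, \<eta>t + sqrt r *\<^sub>R \<zeta>t, \<eta> + sqrt r *\<^sub>R \<zeta>,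
      \<kappa> + r * \<sigma> + sqrt r * (\<Sum>i\<in>UNIV. \<eta> $ i * \<zeta>t $ i - \<eta>t $ i * \<zeta> $ i)))"

definition L1_dilation :: "real \<Rightarrow> 'n::finite iia \<Rightarrow> 'n iia" where
  "L1_dilation l = (\<lambda>(z, \<rho>, \<zeta>t, \<zeta>, \<sigma>).
     (l *\<^sub>R z, \<rho>,
      \<chi> i. case i of None \<Rightarrow> l powr (3/2) * \<zeta>t $ None | Some a \<Rightarrow> l powr (1/2) * \<zeta>t $ Some a,
      \<chi> i. case i of None \<Rightarrow> l powr (-3/2) * \<zeta> $ None | Some a \<Rightarrow> l powr (-1/2) * \<zeta> $ Some a,
      \<sigma>))"

definition L1_translation ::
  "('n::finite \<Rightarrow> 'n \<Rightarrow> 'n \<Rightarrow> real) \<Rightarrow> real^'n \<Rightarrow> 'n iia \<Rightarrow> 'n iia" where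
  "L1_translation k v = (\<lambda>(z, \<rho>, \<zeta>t, \<zeta>, \<sigma>).
     (\<chi> a. z $ a + of_real (v $ a), \<rho>,
      \<chi> i. case i of
          None \<Rightarrow> \<zeta>t $ None
            + 1/6 * (\<Sum>a\<in>UNIV. \<Sum>b\<in>UNIV. \<Sum>c\<in>UNIV. k a b c * v $ a * v $ b * v $ c) * \<zeta> $ None
            + 1/2 * (\<Sum>a\<in>UNIV. \<Sum>b\<in>UNIV. \<Sum>c\<in>UNIV. k a b c * v $ a * v $ b * \<zeta> $ Some c)
            - (\<Sum>a\<in>UNIV. \<zeta>t $ Some a * v $ a)
        | Some a \<Rightarrow> \<zeta>t $ Some a
            - 1/2 * \<zeta> $ None * (\<Sum>b\<in>UNIV. \<Sum>c\<in>UNIV. k a b c * v $ b * v $ c)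
            - (\<Sum>b\<in>UNIV. \<Sum>c\<in>UNIV. k a b c * v $ b * \<zeta> $ Some c),
      \<chi> i. case i of None \<Rightarrow> \<zeta> $ None | Some a \<Rightarrow> \<zeta> $ Some a + \<zeta> $ None * v $ a,
      \<sigma>))"

definition L_action :: "('n::finite \<Rightarrow> 'n \<Rightarrow> 'n \<Rightarrow> real) \<Rightarrow> (real^'n) set \<Rightarrow> ('n iia \<Rightarrow> 'n iia) set" where
  "L_action k H = (let N = qmap_space H in
     generate (BijGroup N)
       ({restrict (L2_transf r \<eta>t \<eta> \<kappa>) N | r \<eta>t \<eta> \<kappa>. 0 < r} \<union>
        {restrict (L1_dilation l) N | l. 0 < l} \<union>
        {restrict (L1_translation k v) N | v. True}))"


section \<open>S-duality\<close>

text \<open>Type IIB coordinates \<open>(b\<^sup>a + i t\<^sup>a, \<tau>\<^sub>1 + i \<tau>\<^sub>2, c\<^sup>a, c\<^sub>a, c\<^sub>0, \<psi>)\<close>; the variables for \<open>c\<^sup>a\<close> and \<open>c\<^sub>a\<close> are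
  \<open>cu\<close> and \<open>cl\<close>.\<close>

type_synonym 'n iib =
  "(complex^'n) \<times> complex \<times> (real^'n) \<times> (real^'n) \<times> real \<times> real"

definition iib_domain :: "(real^'n) set \<Rightarrow> 'n::finite iib set" where
  "iib_domain H = {(z, \<tau>, cu, cl, c0, \<psi>). im_vec z \<in> cone_over H \<and> 0 < Im \<tau>}"

definition iia_of_iib :: "('n::finite \<Rightarrow> 'n \<Rightarrow> 'n \<Rightarrow> real) \<Rightarrow> 'n iib \<Rightarrow> 'n iia" where
  "iia_of_iib k = (\<lambda>(z, \<tau>, cu, cl, c0, \<psi>).
     let b = re_vec z; t = im_vec z; y = cu - Re \<tau> *\<^sub>R b in
     (z, (Im \<tau>)\<^sup>2 / 2 * cubic k t,
      \<chi> i. case i of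
          None \<Rightarrow> c0 - 1/6 * (\<Sum>a\<in>UNIV. \<Sum>b'\<in>UNIV. \<Sum>c\<in>UNIV. k a b' c * b $ a * b $ b' * y $ c)
        | Some a \<Rightarrow> cl $ a + 1/2 * (\<Sum>b'\<in>UNIV. \<Sum>c\<in>UNIV. k a b' c * b $ b' * y $ c),
      \<chi> i. case i of None \<Rightarrow> Re \<tau> | Some a \<Rightarrow> - y $ a,
      - 2 * (\<psi> + 1/2 * Re \<tau> * c0) + (\<Sum>a\<in>UNIV. cl $ a * y $ a)
        - 1/6 * (\<Sum>a\<in>UNIV. \<Sum>b'\<in>UNIV. \<Sum>c\<in>UNIV. k a b' c * b $ a * cu $ b' * y $ c)))"

definition SL2 :: "(real^2^2) set" where
  "SL2 = {M. det M = 1}"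

definition S_duality_iib :: "real^2^2 \<Rightarrow> 'n::finite iib \<Rightarrow> 'n iib" where
  "S_duality_iib M = (\<lambda>(z, \<tau>, cu, cl, c0, \<psi>).
     let a = M $ 1 $ 1; b = M $ 1 $ 2; c = M $ 2 $ 1; d = M $ 2 $ 2 in
     (\<chi> i. Complex (c * cu $ i + d * Re (z $ i)) (cmod (of_real c * \<tau> + of_real d) * Im (z $ i)),
      (of_real a * \<tau> + of_real b) / (of_real c * \<tau> + of_real d),
      \<chi> i. a * cu $ i + b * Re (z $ i),
      cl,
      d * c0 - c * \<psi>,
      - b * c0 + a * \<psi>))"

definition S_duality ::
  "('n::finite \<Rightarrow> 'n \<Rightarrow> 'n \<Rightarrow> real) \<Rightarrow> (real^'n) set \<Rightarrow> real^2^2 \<Rightarrow> 'n iia \<Rightarrow> 'n iia" where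
  "S_duality k H M = restrict
     (\<lambda>p. iia_of_iib k (S_duality_iib M (inv_into (iib_domain H) (iia_of_iib k) p))) (qmap_space H)"

text \<open>The class function \<open>exp\<close> is not available here, since \<open>real^2^2\<close> is not an instance of a
  Banach algebra with matrix multiplication as its product.\<close>

definition mat_exp :: "real^'m::finite^'m \<Rightarrow> real^'m^'m" where
  "mat_exp x = (\<Sum>m. (1 / fact m) *\<^sub>R (((**) x ^^ m) (mat 1)))"

definition fundamental_field ::
  "('n::finite \<Rightarrow> 'n \<Rightarrow> 'n \<Rightarrow> real) \<Rightarrow> (real^'n) set \<Rightarrow> real^2^2 \<Rightarrow> 'n iia \<Rightarrow> 'n iia" where
  "fundamental_field k H x = vf_on (qmap_space H)
     (\<lambda>p. vector_derivative (\<lambda>s. S_duality k H (mat_exp (s *\<^sub>R x)) p) (at 0))"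

definition sl2_e :: "real^2^2" where
  "sl2_e = vector [vector [0, 1], vector [0, 0]]"

definition sl2_f :: "real^2^2" where
  "sl2_f = vector [vector [0, 0], vector [1, 0]]"

definition sl2_h :: "real^2^2" where
  "sl2_h = vector [vector [1, 0], vector [0, -1]]"


section \<open>Infinitesimal generators\<close>

definition D_field :: "'n::finite iia set \<Rightarrow> 'n iia \<Rightarrow> 'n iia" where
  "D_field N = vf_on N (\<lambda>(z, \<rho>, \<zeta>t, \<zeta>, \<sigma>). (0, \<rho>, (1/2) *\<^sub>R \<zeta>t, (1/2) *\<^sub>R \<zeta>, \<sigma>))"

definition P_field :: "'n::finite iia set \<Rightarrow> 'n option \<Rightarrow> 'n iia \<Rightarrow> 'n iia" where
  "P_field N i = vf_on N (\<lambda>(z, \<rho>, \<zeta>t, \<zeta>, \<sigma>). (0, 0, 0, axis i 1, \<zeta>t $ i))"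

definition X_field :: "'n::finite iia set \<Rightarrow> 'n option \<Rightarrow> 'n iia \<Rightarrow> 'n iia" where
  "X_field N i = vf_on N (\<lambda>(z, \<rho>, \<zeta>t, \<zeta>, \<sigma>). (0, 0, axis i 1, 0, - \<zeta> $ i))"

definition Z_field :: "'n::finite iia set \<Rightarrow> 'n iia \<Rightarrow> 'n iia" where
  "Z_field N = vf_on N (\<lambda>p. (0, 0, 0, 0, 1))"

definition V_field ::
  "('n::finite \<Rightarrow> 'n \<Rightarrow> 'n \<Rightarrow> real) \<Rightarrow> 'n iia set \<Rightarrow> 'n \<Rightarrow> 'n iia \<Rightarrow> 'n iia" where
  "V_field k N a = vf_on N (\<lambda>(z, \<rho>, \<zeta>t, \<zeta>, \<sigma>).
     (axis a 1, 0,
      \<chi> i. case i of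
          None \<Rightarrow> - \<zeta>t $ Some a
        | Some b \<Rightarrow> - (\<Sum>c\<in>UNIV. k a b c * \<zeta> $ Some c),
      axis (Some a) (\<zeta> $ None), 0))"

end

theory Submission
  imports Defs
begin

text \<open>In type IIB coordinates, and with \<open>\<omega> = -c\<^sub>0\<close>, the q-map space is the product of the
  domain of all \<open>(t, \<tau>)\<close> with a nilpotent Lie group of points \<open>(c, b, c\<^sub>a, \<psi>, \<omega>)\<close>. The group is the semidirect product
  of \<open>GL\<^sup>+(2)\<close>, acting by S-duality together with the scaling \<open>D\<close>, and of this nilpotent group, acting by left
  translations; it is an open subset of a vector space of dimension \<open>3n + 6\<close>, so that one chart suffices, and its
  fundamental vector fields are the given generators. The upper triangular elements form the \<open>L\<close>-action, whose
  transformations are affine in type IIA coordinates, and these act transitively on the fibres over \<open>t\<close>. By the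
  decomposition of \<open>GL\<^sup>+(2)\<close> into upper triangular matrices and rotations it therefore remains to see that the
  rotations preserve the metric at their fixed points \<open>\<tau> = \<i>\<close>, \<open>(c, b, c\<^sub>a, \<psi>, \<omega>) = 0\<close>.\<close>

section \<open>Smooth maps\<close>

declare Ck_on.simps(2) [simp del]

lemma Ck_on_Suc_has_derivative:
  "Ck_on (Suc m) f S \<Longrightarrow> x \<in> S \<Longrightarrow> (f has_derivative frechet_derivative f (at x)) (at x)"
  by (simp add: Ck_on.simps frechet_derivative_works[symmetric])

lemma Ck_on_Suc_derivative: "Ck_on (Suc m) f S \<Longrightarrow> Ck_on m (\<lambda>x. frechet_derivative f (at x) v) S"
  by (simp add: Ck_on.simps)

lemma Ck_on_cong:
  assumes "open S" "\<And>x. x \<in> S \<Longrightarrow> f x = g x"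
  shows "Ck_on m f S = Ck_on m (g :: 'a::real_normed_vector \<Rightarrow> 'b::real_normed_vector) S"
  using assms(2)
proof (induction m arbitrary: f g)
  case 0
  then show ?case by (auto intro: continuous_on_cong)
next
  case (Suc m)
  have *: "Ck_on (Suc m) g S"
    if fg: "\<And>x. x \<in> S \<Longrightarrow> f x = g x" and f: "Ck_on (Suc m) f S" for f g :: "'a \<Rightarrow> 'b"
  proof -
    have d: "(g has_derivative frechet_derivative f (at x)) (at x)" if x: "x \<in> S" for x
      using has_derivative_transform_within_open[OF Ck_on_Suc_has_derivative[OF f x] assms(1) x] fg by blast
    have "Ck_on m (\<lambda>x. frechet_derivative g (at x) v) S" for v
      using Suc.IH[of "\<lambda>x. frechet_derivative f (at x) v" "\<lambda>x. frechet_derivative g (at x) v"]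
        frechet_derivative_at[OF d] Ck_on_Suc_derivative[OF f, of v] by simp
    then show ?thesis using d by (auto simp: differentiable_def Ck_on.simps)
  qed
  show ?case
    using *[of f g] *[of g f] Suc.prems by metis
qed

lemma Ck_on_Suc_intro:
  assumes "open S" "\<And>x. x \<in> S \<Longrightarrow> (f has_derivative f' x) (at x)"
    "\<And>v. Ck_on m (\<lambda>x. f' x v) S"
  shows "Ck_on (Suc m) (f :: 'a::real_normed_vector \<Rightarrow> 'b::real_normed_vector) S"
proof -
  have "Ck_on m (\<lambda>x. frechet_derivative f (at x) v) S" for v
    using assms(3)[of v] Ck_on_cong[OF assms(1), of "\<lambda>x. frechet_derivative f (at x) v" "\<lambda>x. f' x v"]
      frechet_derivative_at[OF assms(2)] by metis
  then show ?thesis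
    using assms(2) by (auto simp: differentiable_def Ck_on.simps)
qed

lemma Ck_on_Suc_imp: "Ck_on (Suc m) f S \<Longrightarrow> Ck_on m f S"
proof (induction m arbitrary: f)
  case 0
  then show ?case
    by (auto simp: Ck_on.simps continuous_on_eq_continuous_within intro: differentiable_imp_continuous_within differentiable_at_withinI)
next
  case (Suc m)
  then show ?case by (simp add: Ck_on.simps(2)[of "Suc m"] Ck_on.simps(2)[of m])
qed

lemma Ck_on_subset: "Ck_on m f S \<Longrightarrow> T \<subseteq> S \<Longrightarrow> Ck_on m f T"
  by (induction m arbitrary: f) (auto simp: Ck_on.simps intro: continuous_on_subset)

lemma Ck_on_bilinear:
  assumes "bounded_bilinear pr" "open S" "Ck_on m f S" "Ck_on m g S"
  shows "Ck_on m (\<lambda>x. pr (f x) (g x)) S"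
  using assms(3,4)
proof (induction m arbitrary: f g)
  case 0
  then show ?case using bounded_bilinear.continuous_on[OF assms(1)] by auto
next
  case (Suc m)
  let ?f' = "\<lambda>x. frechet_derivative f (at x)" and ?g' = "\<lambda>x. frechet_derivative g (at x)"
  show ?case
  proof (rule Ck_on_Suc_intro[OF assms(2)])
    fix x assume x: "x \<in> S"
    show "((\<lambda>x. pr (f x) (g x)) has_derivative (\<lambda>v. pr (f x) (?g' x v) + pr (?f' x v) (g x))) (at x)"
      by (rule bounded_bilinear.FDERIV[OF assms(1)]) (use Suc.prems x in \<open>auto intro: Ck_on_Suc_has_derivative\<close>)
  next
    fix v
    have add: "Ck_on k (\<lambda>x. a x + b x) S" if "Ck_on k a S" "Ck_on k b S" for k a b
      using that
    proof (induction k arbitrary: a b)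
      case 0
      then show ?case by (auto intro: continuous_on_add)
    next
      case (Suc k)
      show ?case
        by (rule Ck_on_Suc_intro[OF assms(2), where f' = "\<lambda>x v. frechet_derivative a (at x) v + frechet_derivative b (at x) v"])
          (use Suc in \<open>auto intro!: has_derivative_add Ck_on_Suc_has_derivative Ck_on_Suc_derivative\<close>)
    qed
    show "Ck_on m (\<lambda>x. pr (f x) (?g' x v) + pr (?f' x v) (g x)) S"
      using Suc.prems Ck_on_Suc_imp[OF Suc.prems(1)] Ck_on_Suc_imp[OF Suc.prems(2)]
      by (intro add Suc.IH) (auto intro: Ck_on_Suc_derivative)
  qed
qed

lemma Ck_on_const: "Ck_on m (\<lambda>x. c) S"
  by (induction m arbitrary: c) (auto simp: Ck_on.simps)

lemma Ck_on_linear: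
  assumes "bounded_linear L" "open S" "Ck_on m f S"
  shows "Ck_on m (\<lambda>x. L (f x)) S"
  using assms(3)
proof (induction m arbitrary: f)
  case 0
  then show ?case using bounded_linear.continuous_on[OF assms(1)] by auto
next
  case (Suc m)
  show ?case
    by (rule Ck_on_Suc_intro[OF assms(2), where f' = "\<lambda>x v. L (frechet_derivative f (at x) v)"])
      (use Suc in \<open>auto intro!: bounded_linear.has_derivative[OF assms(1)] Ck_on_Suc_has_derivative Ck_on_Suc_derivative\<close>)
qed

lemma Ck_on_id: "open S \<Longrightarrow> Ck_on m (\<lambda>x. x) S"
  by (cases m) (auto intro!: Ck_on_Suc_intro has_derivative_ident Ck_on_const)

lemma Ck_on_Pair:
  assumes "open S" "Ck_on m f S" "Ck_on m g S"
  shows "Ck_on m (\<lambda>x. (f x, g x)) S"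
  using assms(2,3)
proof (induction m arbitrary: f g)
  case 0
  then show ?case by (auto intro: continuous_on_Pair)
next
  case (Suc m)
  show ?case
    by (rule Ck_on_Suc_intro[OF assms(1), where f' = "\<lambda>x v. (frechet_derivative f (at x) v, frechet_derivative g (at x) v)"])
      (use Suc in \<open>auto intro!: has_derivative_Pair Ck_on_Suc_has_derivative Ck_on_Suc_derivative\<close>)
qed

lemma Ck_on_add:
  assumes "open S" "Ck_on m f S" "Ck_on m g S"
  shows "Ck_on m (\<lambda>x. f x + g x) S"
proof -
  have "bounded_linear (\<lambda>p::'b \<times> 'b. fst p + snd p)"
    by (intro bounded_linear_add bounded_linear_fst bounded_linear_snd)
  from Ck_on_linear[OF this assms(1) Ck_on_Pair[OF assms]] show ?thesis by simp
qed

lemma Ck_on_sum: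
  assumes "open S" "\<And>i. i \<in> I \<Longrightarrow> Ck_on m (f i) S"
  shows "Ck_on m (\<lambda>x. \<Sum>i\<in>I. f i x) S"
  using assms(2) by (induction I rule: infinite_finite_induct)
    (auto intro: Ck_on_const Ck_on_add[OF assms(1)])

lemma Ck_on_compose:
  fixes f :: "'a::real_normed_vector \<Rightarrow> 'b::euclidean_space"
  assumes "open S" "open T" "Ck_on m f S" "Ck_on m g T" "f ` S \<subseteq> T"
  shows "Ck_on m (\<lambda>x. g (f x)) S"
  using assms(3,4)
proof (induction m arbitrary: g)
  case 0
  then show ?case using assms(5) by (auto intro: continuous_on_compose2)
next
  case (Suc m)
  let ?f' = "\<lambda>x. frechet_derivative f (at x)" and ?g' = "\<lambda>x. frechet_derivative g (at x)"
  have m: "Ck_on m f S" using Ck_on_Suc_imp[OF Suc.prems(1)] .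
  show ?case
  proof (rule Ck_on_Suc_intro[OF assms(1)])
    fix x assume x: "x \<in> S"
    have g: "(g has_derivative ?g' (f x)) (at (f x))"
      using Ck_on_Suc_has_derivative[OF Suc.prems(2)] x assms(5) by blast
    then have l: "linear (?g' (f x))" by (rule has_derivative_linear)
    have D: "((\<lambda>x. g (f x)) has_derivative (\<lambda>v. ?g' (f x) (?f' x v))) (at x)"
      using has_derivative_compose[OF Ck_on_Suc_has_derivative[OF Suc.prems(1) x] g] .
    have rep: "?g' (f x) w = (\<Sum>i\<in>Basis. (w \<bullet> i) *\<^sub>R ?g' (f x) i)" for w
      by (subst euclidean_representation[symmetric, of w])
        (simp only: linear_sum[OF l] linear_scale[OF l])
    have eq: "(\<lambda>v. ?g' (f x) (?f' x v)) = (\<lambda>v. \<Sum>i\<in>Basis. (?f' x v \<bullet> i) *\<^sub>R ?g' (f x) i)"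
      by (rule ext) (rule rep)
    show "((\<lambda>x. g (f x)) has_derivative (\<lambda>v. \<Sum>i\<in>Basis. (?f' x v \<bullet> i) *\<^sub>R ?g' (f x) i)) (at x)"
      using D unfolding eq .
  next
    fix v
    show "Ck_on m (\<lambda>x. \<Sum>i\<in>Basis. (?f' x v \<bullet> i) *\<^sub>R ?g' (f x) i) S"
    proof (intro Ck_on_sum assms(1) Ck_on_bilinear[OF bounded_bilinear_scaleR])
      fix i :: 'b
      show "Ck_on m (\<lambda>x. ?f' x v \<bullet> i) S"
        using Suc.prems(1) by (intro Ck_on_linear[OF bounded_linear_inner_left assms(1)]) (rule Ck_on_Suc_derivative)
      show "Ck_on m (\<lambda>x. ?g' (f x) i) S"
        using Suc.IH[OF m, of "\<lambda>y. ?g' y i"] Ck_on_Suc_derivative[OF Suc.prems(2)] by auto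
    qed
  qed
qed

lemma Ck_on_powr_id: "Ck_on m (\<lambda>x::real. x powr r) {0<..}"
proof (induction m arbitrary: r)
  case 0
  then show ?case by (auto intro!: continuous_intros)
next
  case (Suc m)
  show ?case
  proof (rule Ck_on_Suc_intro)
    fix x :: real assume "x \<in> {0<..}"
    then show "((\<lambda>x. x powr r) has_derivative (\<lambda>v. v * (r * x powr (r - 1)))) (at x)"
      using has_real_derivative_powr[of x r] by (simp add: has_field_derivative_def mult_commute_abs)
  next
    fix v :: real
    show "Ck_on m (\<lambda>x. v * (r * x powr (r - 1))) {0<..}"
      by (intro Ck_on_bilinear[OF bounded_bilinear_mult] Suc.IH Ck_on_const) auto
  qed simp
qed

named_theorems smooth_intros

lemma smooth_on_const [smooth_intros]: "smooth_on S (\<lambda>x. c)"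
  by (simp add: smooth_on_def Ck_on_const)

lemma smooth_on_id [smooth_intros]: "open S \<Longrightarrow> smooth_on S (\<lambda>x. x)"
  by (simp add: smooth_on_def Ck_on_id)

lemma smooth_on_linear: "bounded_linear L \<Longrightarrow> open S \<Longrightarrow> smooth_on S f \<Longrightarrow> smooth_on S (\<lambda>x. L (f x))"
  by (simp add: smooth_on_def Ck_on_linear)

lemma smooth_on_bilinear:
  "bounded_bilinear pr \<Longrightarrow> open S \<Longrightarrow> smooth_on S f \<Longrightarrow> smooth_on S g \<Longrightarrow> smooth_on S (\<lambda>x. pr (f x) (g x))"
  by (simp add: smooth_on_def Ck_on_bilinear)

lemma smooth_on_Pair [smooth_intros]:
  "open S \<Longrightarrow> smooth_on S f \<Longrightarrow> smooth_on S g \<Longrightarrow> smooth_on S (\<lambda>x. (f x, g x))"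
  by (simp add: smooth_on_def Ck_on_Pair)

lemma smooth_on_add [smooth_intros]:
  "open S \<Longrightarrow> smooth_on S f \<Longrightarrow> smooth_on S g \<Longrightarrow> smooth_on S (\<lambda>x. f x + g x)"
  by (simp add: smooth_on_def Ck_on_add)

lemma smooth_on_sum [smooth_intros]:
  "open S \<Longrightarrow> (\<And>i. i \<in> I \<Longrightarrow> smooth_on S (f i)) \<Longrightarrow> smooth_on S (\<lambda>x. \<Sum>i\<in>I. f i x)"
  by (simp add: smooth_on_def Ck_on_sum)

lemma smooth_on_compose:
  fixes f :: "'a::real_normed_vector \<Rightarrow> 'b::euclidean_space"
  shows "open S \<Longrightarrow> open T \<Longrightarrow> smooth_on S f \<Longrightarrow> smooth_on T g \<Longrightarrow> f ` S \<subseteq> T \<Longrightarrow> smooth_on S (\<lambda>x. g (f x))"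
  using Ck_on_compose unfolding smooth_on_def by blast

lemma smooth_on_cong:
  "open S \<Longrightarrow> (\<And>x. x \<in> S \<Longrightarrow> f x = g x) \<Longrightarrow> smooth_on S f = smooth_on S g"
  unfolding smooth_on_def using Ck_on_cong[of S f g] by blast

lemma smooth_on_imp_continuous_on: "smooth_on S f \<Longrightarrow> continuous_on S f"
  unfolding smooth_on_def by (metis Ck_on.simps(1))

lemma smooth_on_imp_has_derivative:
  "smooth_on S f \<Longrightarrow> x \<in> S \<Longrightarrow> (f has_derivative frechet_derivative f (at x)) (at x)"
  unfolding smooth_on_def by (metis Ck_on_Suc_has_derivative)

lemmas smooth_on_simple_linear [smooth_intros] =
  smooth_on_linear[OF bounded_linear_fst] smooth_on_linear[OF bounded_linear_snd]
  smooth_on_linear[OF bounded_linear_minus[OF bounded_linear_ident]]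
  smooth_on_linear[OF bounded_linear_Re] smooth_on_linear[OF bounded_linear_Im]
  smooth_on_linear[OF bounded_linear_of_real] smooth_on_linear[OF bounded_linear_vec_nth]

lemmas smooth_on_simple_bilinear [smooth_intros] =
  smooth_on_bilinear[OF bounded_bilinear_mult] smooth_on_bilinear[OF bounded_bilinear_scaleR]
  smooth_on_bilinear[OF bounded_bilinear_inner]

lemma smooth_on_diff [smooth_intros]:
  "open S \<Longrightarrow> smooth_on S f \<Longrightarrow> smooth_on S g \<Longrightarrow> smooth_on S (\<lambda>x. f x - g x)"
  using smooth_on_add[of S f "\<lambda>x. - g x"] smooth_on_simple_linear(3)[of S g] by simp

lemma smooth_on_power [smooth_intros]:
  fixes f :: "'a::real_normed_vector \<Rightarrow> real"
  shows "open S \<Longrightarrow> smooth_on S f \<Longrightarrow> smooth_on S (\<lambda>x. f x ^ n)"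
  by (induction n) (auto intro!: smooth_intros)

lemma smooth_on_powr [smooth_intros]:
  fixes f :: "'a::real_normed_vector \<Rightarrow> real"
  shows
  "open S \<Longrightarrow> smooth_on S f \<Longrightarrow> (\<And>x. x \<in> S \<Longrightarrow> 0 < f x) \<Longrightarrow> smooth_on S (\<lambda>x. f x powr r)"
  by (rule smooth_on_compose[where T = "{0<..}" and g = "\<lambda>x::real. x powr r"])
    (auto simp: smooth_on_def Ck_on_powr_id)

lemma smooth_on_sqrt [smooth_intros]:
  assumes "open S" "smooth_on S f" "\<And>x. x \<in> S \<Longrightarrow> 0 < f x"
  shows "smooth_on S (\<lambda>x. sqrt (f x))"
proof -
  have "smooth_on S (\<lambda>x. f x powr (1/2))"
    using assms by (rule smooth_on_powr)
  moreover have "f x powr (1/2) = sqrt (f x)" if "x \<in> S" for x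
    using assms(3)[OF that] by (simp add: powr_half_sqrt)
  ultimately show ?thesis
    using smooth_on_cong[OF assms(1), of "\<lambda>x. f x powr (1/2)" "\<lambda>x. sqrt (f x)"] by blast
qed

lemma smooth_on_divide [smooth_intros]:
  fixes f g :: "'a::real_normed_vector \<Rightarrow> real"
  assumes "open S" "smooth_on S f" "smooth_on S g" "\<And>x. x \<in> S \<Longrightarrow> 0 < g x"
  shows "smooth_on S (\<lambda>x. f x / g x)"
proof -
  have "smooth_on S (\<lambda>x. f x * g x powr (- 1))"
    using assms by (intro smooth_intros) auto
  moreover have "f x * g x powr (- 1) = f x / g x" if "x \<in> S" for x
    using assms(4)[OF that] by (simp add: powr_minus_divide)
  ultimately show ?thesis
    using smooth_on_cong[OF assms(1), of "\<lambda>x. f x * g x powr (- 1)" "\<lambda>x. f x / g x"] by blast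
qed

section \<open>Lie transformation groups with a global chart\<close>

lemma smooth_on_chart:
  assumes "inj_on c U" "open (c ` U)" "smooth_on (c ` U) F" "\<And>x. x \<in> U \<Longrightarrow> h x = F (c x)"
  shows "smooth_on (c ` U) (h \<circ> inv_into U c)"
proof -
  have "(h \<circ> inv_into U c) y = F y" if "y \<in> c ` U" for y
    using that assms(1,4) by auto
  then show ?thesis
    using assms(2,3) smooth_on_cong by metis
qed

lemma second_countable_euclidean: "second_countable (euclidean :: 'a::second_countable_topology topology)"
proof -
  obtain B :: "'a set set" where B: "countable B" "topological_basis B"
    using ex_countable_basis by blast
  show ?thesis
    unfolding second_countable_def
  proof (intro exI conjI allI impI ballI)
    show "openin euclidean V" if "V \<in> B" for V
      using B(2) that topological_basis_open by auto
    show "\<exists>V\<in>B. x \<in> V \<and> V \<subseteq> U" if "openin euclidean U \<and> x \<in> U" for U x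
      using topological_basisE[OF B(2), of U x] that by (metis open_openin)
  qed (use B in auto)
qed

lemma continuous_map_Pair_euclidean:
  "continuous_map X euclidean f \<Longrightarrow> continuous_map X euclidean g \<Longrightarrow>
    continuous_map X euclidean (\<lambda>x. (f x, g x))"
  unfolding prod_topology_euclidean[symmetric] by (simp del: prod_topology_euclidean add: continuous_map_pairwise o_def)

locale smooth_action =
  fixes Om :: "'p::euclidean_space set" and N :: "'q::euclidean_space set"
    and mu :: "'p \<Rightarrow> 'p \<Rightarrow> 'p" and iv :: "'p \<Rightarrow> 'p" and e :: 'p and act :: "'p \<Rightarrow> 'q \<Rightarrow> 'q"
  assumes open_Om: "open Om" and open_N: "open N" and e_in: "e \<in> Om"
    and mu_in: "g \<in> Om \<Longrightarrow> h \<in> Om \<Longrightarrow> mu g h \<in> Om"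
    and iv_in: "g \<in> Om \<Longrightarrow> iv g \<in> Om"
    and act_in: "g \<in> Om \<Longrightarrow> p \<in> N \<Longrightarrow> act g p \<in> N"
    and act_mu: "g \<in> Om \<Longrightarrow> h \<in> Om \<Longrightarrow> p \<in> N \<Longrightarrow> act (mu g h) p = act g (act h p)"
    and act_e: "p \<in> N \<Longrightarrow> act e p = p"
    and mu_iv: "g \<in> Om \<Longrightarrow> mu (iv g) g = e" "g \<in> Om \<Longrightarrow> mu g (iv g) = e"
    and faithful: "g \<in> Om \<Longrightarrow> h \<in> Om \<Longrightarrow> (\<And>p. p \<in> N \<Longrightarrow> act g p = act h p) \<Longrightarrow> g = h"
    and smooth_mu: "smooth_on (Om \<times> Om) (\<lambda>(g, h). mu g h)"
    and smooth_iv: "smooth_on Om iv"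
    and smooth_act: "smooth_on (Om \<times> N) (\<lambda>(g, p). act g p)"
begin

definition "tr g = restrict (act g) N"

definition "G = tr ` Om"

definition "co = inv_into Om tr"

definition "T = pullback_topology G co euclidean"

lemma inj_tr: "inj_on tr Om"
proof (rule inj_onI)
  fix g h assume "g \<in> Om" "h \<in> Om" "tr g = tr h"
  then show "g = h"
    by (intro faithful) (auto simp: tr_def restrict_def fun_eq_iff split: if_splits)
qed

lemma co_tr [simp]: "g \<in> Om \<Longrightarrow> co (tr g) = g"
  by (simp add: co_def inj_tr)

lemma co_in: "\<phi> \<in> G \<Longrightarrow> co \<phi> \<in> Om"
  by (auto simp: G_def)

lemma tr_in: "g \<in> Om \<Longrightarrow> tr g \<in> G"
  by (auto simp: G_def)

lemma tr_co [simp]: "\<phi> \<in> G \<Longrightarrow> tr (co \<phi>) = \<phi>"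
  by (auto simp: G_def)

lemma G_apply: "\<phi> \<in> G \<Longrightarrow> p \<in> N \<Longrightarrow> \<phi> p = act (co \<phi>) p"
  by (metis tr_co tr_def restrict_apply')

lemma co_image: "co ` G = Om"
  using co_in tr_in co_tr by (metis image_eqI subsetI subset_antisym image_subset_iff)

lemma inj_co: "inj_on co G"
  by (metis inj_onI tr_co)

lemma act_iv: "g \<in> Om \<Longrightarrow> p \<in> N \<Longrightarrow> act (iv g) (act g p) = p" "g \<in> Om \<Longrightarrow> p \<in> N \<Longrightarrow> act g (act (iv g) p) = p"
  by (metis act_e act_mu iv_in mu_iv)+

lemma bij_act: "g \<in> Om \<Longrightarrow> bij_betw (act g) N N"
  by (rule bij_betw_byWitness[where f' = "act (iv g)"]) (auto simp: act_iv act_in iv_in)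

lemma tr_Bij: "g \<in> Om \<Longrightarrow> tr g \<in> Bij N"
  using bij_act[of g] by (auto simp: Bij_def tr_def cong: bij_betw_cong)

lemma tr_one: "tr e = \<one>\<^bsub>BijGroup N\<^esub>"
  by (auto simp: tr_def BijGroup_def restrict_def act_e)

lemma tr_mu: "g \<in> Om \<Longrightarrow> h \<in> Om \<Longrightarrow> tr (mu g h) = tr g \<otimes>\<^bsub>BijGroup N\<^esub> tr h"
  using tr_Bij by (auto simp: BijGroup_def tr_def compose_def restrict_def act_mu act_in fun_eq_iff)

lemma tr_inv: "g \<in> Om \<Longrightarrow> tr (iv g) = inv\<^bsub>BijGroup N\<^esub> tr g"
proof -
  assume g: "g \<in> Om"
  interpret B: group "BijGroup N" by (rule group_BijGroup)
  have c: "carrier (BijGroup N) = Bij N" by (simp add: BijGroup_def)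
  have "tr (iv g) \<otimes>\<^bsub>BijGroup N\<^esub> tr g = \<one>\<^bsub>BijGroup N\<^esub>"
    using g by (simp add: tr_mu[symmetric] iv_in mu_iv tr_one)
  then show ?thesis
    using B.inv_equality[of "tr (iv g)" "tr g"] g by (simp add: c tr_Bij iv_in)
qed

lemma subgroup_G: "subgroup G (BijGroup N)"
proof (rule group.subgroupI[OF group_BijGroup])
  show "G \<subseteq> carrier (BijGroup N)"
    using tr_Bij by (auto simp: G_def BijGroup_def)
  show "G \<noteq> {}" using e_in by (auto simp: G_def)
  show "inv\<^bsub>BijGroup N\<^esub> a \<in> G" if "a \<in> G" for a
    using that by (auto simp: G_def tr_inv[symmetric] iv_in)
  show "a \<otimes>\<^bsub>BijGroup N\<^esub> b \<in> G" if "a \<in> G" "b \<in> G" for a b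
    using that by (auto simp: G_def tr_mu[symmetric] mu_in)
qed

lemma co_mult: "\<phi> \<in> G \<Longrightarrow> \<psi> \<in> G \<Longrightarrow> co (\<phi> \<otimes>\<^bsub>BijGroup N\<^esub> \<psi>) = mu (co \<phi>) (co \<psi>)"
  by (metis co_in co_tr mu_in tr_co tr_mu)

lemma co_inv: "\<phi> \<in> G \<Longrightarrow> co (inv\<^bsub>BijGroup N\<^esub> \<phi>) = iv (co \<phi>)"
  by (metis co_in co_tr iv_in tr_co tr_inv)

lemma topspace_T [simp]: "topspace T = G"
  by (simp add: T_def topspace_pullback_topology)

lemma continuous_co: "continuous_map T euclidean co"
  using continuous_map_pullback[of euclidean euclidean id G co] by (simp add: T_def)

lemma continuous_into_T: "continuous_map X T f"
  if "continuous_map X euclidean (co \<circ> f)" "f ` topspace X \<subseteq> G"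
  unfolding T_def using that by (intro continuous_map_pullback') auto

lemma homeo_co: "homeomorphic_maps T (top_of_set Om) co tr"
  unfolding homeomorphic_maps_def
proof (intro conjI)
  show "continuous_map T (top_of_set Om) co"
    using continuous_co by (auto simp: continuous_map_in_subtopology co_in)
  show "continuous_map (top_of_set Om) T tr"
  proof (rule continuous_into_T)
    have "continuous_map (top_of_set Om) euclidean id" by (simp add: continuous_on_id)
    then show "continuous_map (top_of_set Om) euclidean (co \<circ> tr)"
      by (rule continuous_map_eq) auto
  qed (auto simp: tr_in)
qed auto

lemma homeomorphic_T: "T homeomorphic_space top_of_set Om"
  using homeo_co homeomorphic_space_def by blast

lemma connected_T: "connected Om \<Longrightarrow> connected_space T"
  using homeomorphic_connected_space[OF homeomorphic_T] by (simp add: connected_space_subtopology)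

lemma smooth_orbit: "p \<in> N \<Longrightarrow> smooth_on Om (\<lambda>g. act g p)"
  using smooth_on_compose[OF open_Om open_Times[OF open_Om open_N] _ smooth_act, of "\<lambda>g. (g, p)"]
  by (simp add: smooth_intros open_Om image_subset_iff)

definition "fund \<xi> = vf_on N (\<lambda>p. frechet_derivative (\<lambda>g. act g p) (at e) \<xi>)"

lemma orbit_derivative:
  "p \<in> N \<Longrightarrow> ((\<lambda>g. act g p) has_derivative frechet_derivative (\<lambda>g. act g p) (at e)) (at e)"
  by (rule smooth_on_imp_has_derivative[OF smooth_orbit e_in])

lemma act_curve:
  assumes "(c has_vector_derivative \<xi>) (at 0)" "c 0 = e" "p \<in> N"
  shows "((\<lambda>s. act (c s) p) has_vector_derivative fund \<xi> p) (at 0)"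
proof -
  let ?D = "frechet_derivative (\<lambda>g. act g p) (at e)"
  have D: "((\<lambda>g. act g p) has_derivative ?D) (at (c 0))"
    using orbit_derivative[OF assms(3)] assms(2) by simp
  have "((\<lambda>s. act (c s) p) has_derivative (\<lambda>s. ?D (s *\<^sub>R \<xi>))) (at 0)"
    using has_derivative_compose[OF assms(1)[unfolded has_vector_derivative_def] D] .
  then show ?thesis
    using assms(3) linear_scale[OF has_derivative_linear[OF D]]
    by (simp add: has_vector_derivative_def fund_def vf_on_def)
qed

lemma act_curve_eq:
  assumes "(c has_vector_derivative \<xi>) (at 0)" "c 0 = e"
  shows "vf_on N (\<lambda>p. vector_derivative (\<lambda>s. act (c s) p) (at 0)) = fund \<xi>"
  using vector_derivative_at[OF act_curve[OF assms]] by (auto simp: vf_on_def fund_def fun_eq_iff)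

lemma linear_fund: "linear fund"
proof -
  have l: "linear (frechet_derivative (\<lambda>g. act g p) (at e))" if "p \<in> N" for p
    using has_derivative_linear[OF orbit_derivative[OF that]] .
  show ?thesis
    by (rule linearI)
      (auto simp: fund_def vf_on_def fun_eq_iff scaleR_fun_def linear_add[OF l] linear_scale[OF l])
qed

lemma curve_in_Om:
  obtains c where "smooth_on UNIV c" "range c \<subseteq> Om" "c 0 = e" "(c has_vector_derivative \<xi>) (at 0)"
proof -
  obtain d where d: "d > 0" "ball e d \<subseteq> Om"
    using open_Om e_in open_contains_ball by blast
  define m where "m = (norm \<xi> / d)\<^sup>2"
  define f :: "real \<Rightarrow> real" where "f s = s / (1 + m * s\<^sup>2)" for s
  define c where "c s = e + f s *\<^sub>R \<xi>" for s
  have pos: "0 < 1 + m * s\<^sup>2" for s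
    unfolding m_def by (intro add_pos_nonneg) auto
  have f: "smooth_on UNIV f"
    unfolding f_def by (intro smooth_intros pos) auto
  show ?thesis
  proof
    show "smooth_on UNIV c"
      unfolding c_def by (intro smooth_intros f) auto
    show "c 0 = e" by (simp add: c_def f_def)
    have "(f has_real_derivative 1) (at 0)"
      unfolding f_def by (auto intro!: derivative_eq_intros)
    then show "(c has_vector_derivative \<xi>) (at 0)"
      unfolding c_def
      by (auto intro!: derivative_eq_intros simp: has_real_derivative_iff_has_vector_derivative)
    show "range c \<subseteq> Om"
    proof clarify
      fix s
      have "norm (f s *\<^sub>R \<xi>) < d"
      proof -
        have "2 * (norm \<xi> / d) * \<bar>s\<bar> \<le> 1 + m * s\<^sup>2"
          using zero_le_power2[of "norm \<xi> / d * \<bar>s\<bar> - 1"]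
          unfolding m_def power2_diff power_mult_distrib by simp
        moreover have "(norm \<xi> / d) * \<bar>s\<bar> \<ge> 0" using d by simp
        ultimately have "(norm \<xi> / d) * \<bar>s\<bar> < 1 + m * s\<^sup>2" using pos[of s] by linarith
        then have "\<bar>s\<bar> * norm \<xi> < d * (1 + m * s\<^sup>2)" using d by (simp add: field_simps)
        then show ?thesis
          using pos[of s] by (simp add: f_def field_simps)
      qed
      then show "c s \<in> Om" using d by (auto simp: c_def dist_norm)
    qed
  qed
qed

end

locale lie_action = smooth_action Om N mu iv e act
  for Om :: "'p::euclidean_space set" and N :: "'q::euclidean_space set" and mu iv e act +
  fixes L :: "'p \<Rightarrow> 'e::euclidean_space" and L' :: "'e \<Rightarrow> 'p"
  assumes linear_L: "linear L" "linear L'" and L'_L [simp]: "L' (L x) = x" and L_L' [simp]: "L (L' y) = y"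
begin

definition "ch = L \<circ> co"

definition "A = {(G, ch)}"

lemma L_lin: "bounded_linear L" "bounded_linear L'"
  using linear_L linear_conv_bounded_linear by blast+

lemma ch_image: "ch ` G = L ` Om"
  unfolding ch_def image_comp[symmetric] co_image ..

lemma inj_ch: "inj_on ch G"
  unfolding ch_def by (rule comp_inj_on[OF inj_co]) (metis L'_L inj_onI)

lemma open_L: "open (L ` Om)"
proof -
  have "L ` Om = L' -` Om" by (auto simp: image_iff) (metis L_L')
  then show ?thesis
    using open_vimage[OF open_Om, of L'] linear_continuous_on[OF L_lin(2)] by auto
qed

lemma ch_simp: "\<phi> \<in> G \<Longrightarrow> L' (ch \<phi>) = co \<phi>"
  by (simp add: ch_def)

lemma homeomorphic_ch: "homeomorphic_map T (top_of_set (ch ` G)) ch"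
proof -
  have "homeomorphic_maps (top_of_set Om) (top_of_set (L ` Om)) L L'"
    unfolding homeomorphic_maps_def
    by (auto simp: continuous_map_in_subtopology linear_continuous_on L_lin)
  then have "homeomorphic_map (top_of_set Om) (top_of_set (L ` Om)) L"
    by (auto simp: homeomorphic_map_maps)
  moreover have "homeomorphic_map T (top_of_set Om) co"
    using homeo_co by (auto simp: homeomorphic_map_maps)
  ultimately show ?thesis
    unfolding ch_image unfolding ch_def by (rule homeomorphic_map_compose[rotated])
qed

lemma smooth_manifold_T: "smooth_manifold T A"
  unfolding smooth_manifold_def
proof (intro conjI)
  have "Hausdorff_space (top_of_set Om)" by (simp add: Hausdorff_space_subtopology)
  then show "Hausdorff_space T" using homeomorphic_Hausdorff_space[OF homeomorphic_T] by simp
  have "second_countable (top_of_set Om)"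
    by (simp add: second_countable_subtopology second_countable_euclidean)
  then show "second_countable T" using homeomorphic_space_second_countability[OF homeomorphic_T] by simp
  have "smooth_on (ch ` G) (ch \<circ> inv_into G ch)"
    by (rule smooth_on_chart[where F = "\<lambda>x. x"])
      (auto simp: inj_ch ch_image open_L intro: smooth_intros)
  then show "\<forall>(U, \<phi>)\<in>A. \<forall>(V, \<psi>)\<in>A. smooth_on (\<phi> ` (U \<inter> V)) (\<psi> \<circ> inv_into U \<phi>)"
    by (simp add: A_def)
  have "subtopology T G = T" by (metis subtopology_topspace topspace_T)
  then show "\<forall>(U, \<phi>)\<in>A. openin T U \<and> open (\<phi> ` U) \<and> homeomorphic_map (subtopology T U) (top_of_set (\<phi> ` U)) \<phi>"
    using openin_topspace[of T] by (simp add: A_def homeomorphic_ch[unfolded ch_image] ch_image open_L del: openin_topspace)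
qed (simp add: A_def)

lemma smooth_map_into_T:
  assumes "continuous_map X euclidean (co \<circ> f)" "\<And>x. x \<in> topspace X \<Longrightarrow> f x \<in> G"
    and "\<And>U \<phi>. (U, \<phi>) \<in> B \<Longrightarrow> U \<subseteq> topspace X \<and> inj_on \<phi> U \<and> open (\<phi> ` U) \<and>
      (\<exists>F. smooth_on (\<phi> ` U) F \<and> (\<forall>x\<in>U. co (f x) = F (\<phi> x)))"
  shows "smooth_map X B T A f"
  unfolding smooth_map_def
proof (intro conjI)
  show "continuous_map X T f"
    by (rule continuous_into_T[OF assms(1)]) (use assms(2) in auto)
  show "\<forall>(U, \<phi>)\<in>B. \<forall>(V, \<psi>)\<in>A. smooth_on (\<phi> ` {x \<in> U. f x \<in> V}) (\<psi> \<circ> f \<circ> inv_into U \<phi>)"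
  proof clarify
    fix U \<phi> V \<psi> assume U: "(U, \<phi>) \<in> B" and V: "(V, \<psi>) \<in> A"
    have V: "V = G" "\<psi> = ch" using V by (auto simp: A_def)
    obtain F where F: "U \<subseteq> topspace X" "inj_on \<phi> U" "open (\<phi> ` U)"
      "smooth_on (\<phi> ` U) F" "\<And>x. x\<in>U \<Longrightarrow> co (f x) = F (\<phi> x)"
      using assms(3)[OF U] by blast
    have *: "{x \<in> U. f x \<in> G} = U" using F(1) assms(2) by auto
    show "smooth_on (\<phi> ` {x \<in> U. f x \<in> V}) (\<psi> \<circ> f \<circ> inv_into U \<phi>)"
      unfolding V *
      by (rule smooth_on_chart[where F = "\<lambda>x. L (F x)"])
        (use F in \<open>auto simp: ch_def intro: smooth_on_linear[OF L_lin(1)]\<close>)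
  qed
qed

lemma smooth_mult: "smooth_map (prod_topology T T) (prod_atlas A A) T A (\<lambda>(x, y). x \<otimes>\<^bsub>BijGroup N\<^esub> y)"
proof (rule smooth_map_into_T)
  have c: "continuous_map (prod_topology T T) (top_of_set (Om \<times> Om)) (\<lambda>p. (co (fst p), co (snd p)))"
    using continuous_map_compose[OF continuous_map_fst continuous_co, of T]
      continuous_map_compose[OF continuous_map_snd continuous_co, of T]
    by (auto simp: continuous_map_in_subtopology co_in o_def intro!: continuous_map_Pair_euclidean)
  have "continuous_map (top_of_set (Om \<times> Om)) euclidean (\<lambda>(g, h). mu g h)"
    using smooth_on_imp_continuous_on[OF smooth_mu] by simp
  from continuous_map_compose[OF c this]
  show "continuous_map (prod_topology T T) euclidean (co \<circ> (\<lambda>(x, y). x \<otimes>\<^bsub>BijGroup N\<^esub> y))"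
    by (rule continuous_map_eq) (auto simp: co_mult)
  show "(case x of (x, y) \<Rightarrow> x \<otimes>\<^bsub>BijGroup N\<^esub> y) \<in> G" if "x \<in> topspace (prod_topology T T)" for x
    using that subgroup.m_closed[OF subgroup_G] by auto
  fix U :: "(('q \<Rightarrow> 'q) \<times> ('q \<Rightarrow> 'q)) set" and \<phi> assume "(U, \<phi>) \<in> prod_atlas A A"
  then have U: "U = G \<times> G" "\<phi> = map_prod ch ch" by (auto simp: prod_atlas_def A_def)
  have im: "\<phi> ` U = L ` Om \<times> L ` Om" unfolding U map_prod_image ch_image ..
  have "inj_on \<phi> U" unfolding U by (intro map_prod_inj_on inj_ch)
  moreover have "open (\<phi> ` U)" unfolding im by (intro open_Times open_L)
  moreover have "smooth_on (\<phi> ` U) (\<lambda>p. (\<lambda>(g, h). mu g h) (L' (fst p), L' (snd p)))"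
    unfolding im
    by (rule smooth_on_compose[OF _ _ _ smooth_mu])
      (auto intro!: open_Times open_L open_Om smooth_intros smooth_on_linear[OF L_lin(2)])
  ultimately show "U \<subseteq> topspace (prod_topology T T) \<and> inj_on \<phi> U \<and> open (\<phi> ` U) \<and>
      (\<exists>F. smooth_on (\<phi> ` U) F \<and> (\<forall>x\<in>U. co (case x of (x, y) \<Rightarrow> x \<otimes>\<^bsub>BijGroup N\<^esub> y) = F (\<phi> x)))"
    by (auto simp: U co_mult ch_simp intro!: exI[of _ "\<lambda>p. (\<lambda>(g, h). mu g h) (L' (fst p), L' (snd p))"])
qed

lemma smooth_inverse: "smooth_map T A T A (\<lambda>x. inv\<^bsub>BijGroup N\<^esub> x)"
proof (rule smooth_map_into_T)
  have c: "continuous_map T (top_of_set Om) co"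
    using homeo_co by (simp add: homeomorphic_maps_def)
  have "continuous_map (top_of_set Om) euclidean iv"
    using smooth_on_imp_continuous_on[OF smooth_iv] by simp
  from continuous_map_compose[OF c this]
  show "continuous_map T euclidean (co \<circ> (\<lambda>x. inv\<^bsub>BijGroup N\<^esub> x))"
    by (rule continuous_map_eq) (auto simp: co_inv)
  show "inv\<^bsub>BijGroup N\<^esub> x \<in> G" if "x \<in> topspace T" for x
    using that subgroup.m_inv_closed[OF subgroup_G] by auto
  fix U \<phi> assume "(U, \<phi>) \<in> A"
  then have U: "U = G" "\<phi> = ch" by (auto simp: A_def)
  have "smooth_on (L ` Om) (\<lambda>x. iv (L' x))"
    by (rule smooth_on_compose[OF open_L open_Om _ smooth_iv])
      (auto intro!: open_L smooth_intros smooth_on_linear[OF L_lin(2)])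
  then show "U \<subseteq> topspace T \<and> inj_on \<phi> U \<and> open (\<phi> ` U) \<and>
      (\<exists>F. smooth_on (\<phi> ` U) F \<and> (\<forall>x\<in>U. co (inv\<^bsub>BijGroup N\<^esub> x) = F (\<phi> x)))"
    using inj_ch open_L
    by (auto simp: U ch_image co_inv ch_simp intro!: exI[of _ "\<lambda>x. iv (L' x)"])
qed

lemma smooth_evaluation:
  "smooth_map (prod_topology T (top_of_set N)) (prod_atlas A {(N, id)}) (top_of_set N) {(N, id)} (\<lambda>(\<phi>, p). \<phi> p)"
  unfolding smooth_map_def
proof (intro conjI)
  have "continuous_map (prod_topology T (top_of_set N)) euclidean (snd :: ('q \<Rightarrow> 'q) \<times> 'q \<Rightarrow> 'q)"
    by (metis continuous_map_into_fulltopology continuous_map_snd)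
  then have c: "continuous_map (prod_topology T (top_of_set N)) (top_of_set (Om \<times> N)) (\<lambda>p. (co (fst p), snd p))"
    using continuous_map_compose[OF continuous_map_fst continuous_co, of "top_of_set N"]
    by (auto simp: continuous_map_in_subtopology co_in o_def intro!: continuous_map_Pair_euclidean)
  have "continuous_map (top_of_set (Om \<times> N)) (top_of_set N) (\<lambda>(g, p). act g p)"
    using smooth_on_imp_continuous_on[OF smooth_act] by (auto simp: continuous_map_in_subtopology act_in)
  from continuous_map_compose[OF c this]
  show "continuous_map (prod_topology T (top_of_set N)) (top_of_set N) (\<lambda>(\<phi>, p). \<phi> p)"
    by (rule continuous_map_eq) (auto simp: G_apply)
  let ?F = "\<lambda>p. (\<lambda>(g, p). act g p) (L' (fst p), snd p)"
  have im: "map_prod ch id ` (G \<times> N) = L ` Om \<times> N" unfolding map_prod_image ch_image by simp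
  have s: "smooth_on (map_prod ch id ` (G \<times> N)) ?F"
    unfolding im
    by (rule smooth_on_compose[OF _ _ _ smooth_act])
      (auto intro!: open_Times open_L open_Om open_N smooth_intros smooth_on_linear[OF L_lin(2)])
  have "smooth_on (map_prod ch id ` (G \<times> N)) ((id \<circ> (\<lambda>(\<phi>, p). \<phi> p)) \<circ> inv_into (G \<times> N) (map_prod ch id))"
  proof (rule smooth_on_chart[OF _ _ s])
    show "inj_on (map_prod ch id) (G \<times> N)" by (intro map_prod_inj_on inj_ch) simp
    show "open (map_prod ch id ` (G \<times> N))" unfolding im by (intro open_Times open_L open_N)
  qed (auto simp: G_apply ch_simp)
  moreover have "{x \<in> G \<times> N. (case x of (\<phi>, p) \<Rightarrow> \<phi> p) \<in> N} = G \<times> N"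
    by (auto simp: G_apply act_in co_in)
  ultimately show "\<forall>(U, \<phi>)\<in>prod_atlas A {(N, id)}. \<forall>(V, \<psi>)\<in>{(N, id)}.
       smooth_on (\<phi> ` {x \<in> U. (case x of (\<phi>, p) \<Rightarrow> \<phi> p) \<in> V}) (\<psi> \<circ> (\<lambda>(\<phi>, p). \<phi> p) \<circ> inv_into U \<phi>)"
    by (auto simp: prod_atlas_def A_def)
qed

lemma lie_transformation_group_G: "lie_transformation_group N G T A"
proof -
  interpret S: subgroup G "BijGroup N" by (rule subgroup_G)
  have "smooth_map T A T A (\<lambda>x. inv\<^bsub>BijGroup N\<lparr>carrier := G\<rparr>\<^esub> x)"
  proof -
    have eq: "inv\<^bsub>BijGroup N\<lparr>carrier := G\<rparr>\<^esub> x = inv\<^bsub>BijGroup N\<^esub> x" if "x \<in> G" for x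
      using group.m_inv_consistent[OF group_BijGroup subgroup_G that] .
    have "continuous_map T T (\<lambda>x. inv\<^bsub>BijGroup N\<lparr>carrier := G\<rparr>\<^esub> x)"
      using smooth_inverse by (auto simp: smooth_map_def eq elim!: continuous_map_eq)
    moreover have "smooth_on (ch ` G) (ch \<circ> (\<lambda>x. inv\<^bsub>BijGroup N\<lparr>carrier := G\<rparr>\<^esub> x) \<circ> inv_into G ch)"
    proof -
      have "{x \<in> G. inv\<^bsub>BijGroup N\<^esub> x \<in> G} = G" by auto
      then have "smooth_on (ch ` G) (ch \<circ> (\<lambda>x. inv\<^bsub>BijGroup N\<^esub> x) \<circ> inv_into G ch)"
        using smooth_inverse by (auto simp: smooth_map_def A_def)
      then show ?thesis
        by (subst (asm) smooth_on_cong[where g = "ch \<circ> (\<lambda>x. inv\<^bsub>BijGroup N\<lparr>carrier := G\<rparr>\<^esub> x) \<circ> inv_into G ch"])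
          (auto simp: ch_image open_L eq inv_into_into)
    qed
    moreover have "{x \<in> G. inv\<^bsub>BijGroup N\<lparr>carrier := G\<rparr>\<^esub> x \<in> G} = G"
      by (auto simp: eq)
    ultimately show ?thesis by (simp add: smooth_map_def A_def)
  qed
  moreover have "group (BijGroup N\<lparr>carrier := G\<rparr>)"
    by (rule S.subgroup_is_group[OF group_BijGroup])
  ultimately show ?thesis
    unfolding lie_transformation_group_def lie_group_def
    using subgroup_G smooth_manifold_T smooth_mult smooth_evaluation by simp
qed

lemma lie_algebra_vf_eq: "lie_algebra_vf N T A = range fund"
proof (intro equalityI subsetI)
  fix X assume "X \<in> lie_algebra_vf N T A"
  then obtain \<gamma> where X: "X = vf_on N (\<lambda>p. vector_derivative (\<lambda>s. \<gamma> s p) (at 0))"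
    and \<gamma>: "smooth_map euclideanreal {(UNIV, id)} T A \<gamma>" and \<gamma>0: "\<gamma> 0 = \<one>\<^bsub>BijGroup N\<^esub>"
    by (auto simp: lie_algebra_vf_def)
  have G: "\<gamma> s \<in> G" for s
    using \<gamma> by (auto simp: smooth_map_def continuous_map_def)
  define c where "c s = co (\<gamma> s)" for s
  have "inv_into UNIV (id :: real \<Rightarrow> real) = id" by (simp add: inv_id)
  then have "smooth_on UNIV (ch \<circ> \<gamma>)"
    using \<gamma> G by (simp add: smooth_map_def A_def)
  then have "smooth_on UNIV (\<lambda>s. L' ((ch \<circ> \<gamma>) s))"
    by (rule smooth_on_linear[OF L_lin(2) open_UNIV])
  then have "smooth_on UNIV c"
    by (simp add: c_def[abs_def] ch_simp G)
  then have c: "(c has_derivative frechet_derivative c (at 0)) (at 0)"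
    by (rule smooth_on_imp_has_derivative) simp
  have "frechet_derivative c (at 0) = (\<lambda>s. s *\<^sub>R frechet_derivative c (at 0) 1)"
  proof
    show "frechet_derivative c (at 0) s = s *\<^sub>R frechet_derivative c (at 0) 1" for s
      using linear_scale[OF has_derivative_linear[OF c], of s 1] unfolding real_scaleR_def mult_1_right .
  qed
  then have c': "(c has_vector_derivative frechet_derivative c (at 0) 1) (at 0)"
    using c by (simp add: has_vector_derivative_def)
  have "c 0 = e" by (metis \<gamma>0 c_def co_tr e_in tr_one)
  have "vf_on N (\<lambda>p. vector_derivative (\<lambda>s. act (c s) p) (at 0)) = X"
    unfolding X c_def using G G_apply by (auto simp: vf_on_def fun_eq_iff)
  then show "X \<in> range fund"
    using act_curve_eq[OF c' \<open>c 0 = e\<close>] by auto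
next
  fix X assume "X \<in> range fund"
  then obtain \<xi> where X: "X = fund \<xi>" by auto
  obtain c where c: "smooth_on UNIV c" "range c \<subseteq> Om" "c 0 = e" "(c has_vector_derivative \<xi>) (at 0)"
    using curve_in_Om .
  define \<gamma> where "\<gamma> s = tr (c s)" for s
  have Om: "c s \<in> Om" for s using c(2) by auto
  have "smooth_map euclideanreal {(UNIV, id)} T A \<gamma>"
  proof (rule smooth_map_into_T)
    show "continuous_map euclideanreal euclidean (co \<circ> \<gamma>)"
      using smooth_on_imp_continuous_on[OF c(1)] Om by (simp add: o_def \<gamma>_def)
  qed (use Om c(1) in \<open>auto simp: \<gamma>_def tr_in intro!: exI[of _ c]\<close>)
  moreover have "\<gamma> 0 = \<one>\<^bsub>BijGroup N\<^esub>" by (simp add: \<gamma>_def c(3) tr_one)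
  moreover have "X = vf_on N (\<lambda>p. vector_derivative (\<lambda>s. \<gamma> s p) (at 0))"
    unfolding X act_curve_eq[OF c(4,3), symmetric] by (auto simp: vf_on_def fun_eq_iff \<gamma>_def tr_def)
  ultimately show "X \<in> lie_algebra_vf N T A"
    by (auto simp: lie_algebra_vf_def)
qed

end

section \<open>The polarized cubic form\<close>

definition K2 :: "('n::finite \<Rightarrow> 'n \<Rightarrow> 'n \<Rightarrow> real) \<Rightarrow> real^'n \<Rightarrow> real^'n \<Rightarrow> real^'n" where
  "K2 k x y = (\<chi> a. \<Sum>b\<in>UNIV. \<Sum>c\<in>UNIV. k a b c * x $ b * y $ c)"

definition K3 :: "('n::finite \<Rightarrow> 'n \<Rightarrow> 'n \<Rightarrow> real) \<Rightarrow> real^'n \<Rightarrow> real^'n \<Rightarrow> real^'n \<Rightarrow> real" where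
  "K3 k x y w = x \<bullet> K2 k y w"

lemma K3_sum: "K3 k x y w = (\<Sum>a\<in>UNIV. \<Sum>b\<in>UNIV. \<Sum>c\<in>UNIV. k a b c * x $ a * y $ b * w $ c)"
  by (simp add: K3_def K2_def inner_vec_def sum_distrib_left mult_ac)

lemma bounded_bilinear_K2: "bounded_bilinear (K2 k)"
  unfolding bilinear_conv_bounded_bilinear[symmetric] bilinear_def
  by (auto intro!: linearI simp: K2_def vec_eq_iff algebra_simps sum.distrib sum_distrib_left)

lemmas K2_simps =
  bounded_bilinear.add_left[OF bounded_bilinear_K2] bounded_bilinear.add_right[OF bounded_bilinear_K2]
  bounded_bilinear.diff_left[OF bounded_bilinear_K2] bounded_bilinear.diff_right[OF bounded_bilinear_K2]
  bounded_bilinear.minus_left[OF bounded_bilinear_K2] bounded_bilinear.minus_right[OF bounded_bilinear_K2]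
  bounded_bilinear.scaleR_left[OF bounded_bilinear_K2] bounded_bilinear.scaleR_right[OF bounded_bilinear_K2]
  bounded_bilinear.zero_left[OF bounded_bilinear_K2] bounded_bilinear.zero_right[OF bounded_bilinear_K2]

lemma K3_simps:
  "K3 k (x + x') y w = K3 k x y w + K3 k x' y w" "K3 k x (y + y') w = K3 k x y w + K3 k x y' w"
  "K3 k x y (w + w') = K3 k x y w + K3 k x y w'"
  "K3 k (x - x') y w = K3 k x y w - K3 k x' y w" "K3 k x (y - y') w = K3 k x y w - K3 k x y' w"
  "K3 k x y (w - w') = K3 k x y w - K3 k x y w'"
  "K3 k (- x) y w = - K3 k x y w" "K3 k x (- y) w = - K3 k x y w" "K3 k x y (- w) = - K3 k x y w"
  "K3 k (s *\<^sub>R x) y w = s * K3 k x y w" "K3 k x (s *\<^sub>R y) w = s * K3 k x y w"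
  "K3 k x y (s *\<^sub>R w) = s * K3 k x y w"
  "K3 k 0 y w = 0" "K3 k x 0 w = 0" "K3 k x y 0 = 0"
  by (simp_all add: K3_def K2_simps inner_simps)

locale sym_cubic =
  fixes k :: "'n::finite \<Rightarrow> 'n \<Rightarrow> 'n \<Rightarrow> real"
  assumes sym1: "k a b c = k b a c" and sym2: "k a b c = k a c b"
begin

lemma K2_commute: "K2 k x y = K2 k y x"
proof -
  have "(\<Sum>b\<in>UNIV. \<Sum>c\<in>UNIV. k a b c * x $ b * y $ c) = (\<Sum>b\<in>UNIV. \<Sum>c\<in>UNIV. k a b c * y $ b * x $ c)" for a
    by (subst sum.swap) (simp add: sym2[of a] mult_ac)
  then show ?thesis by (simp add: K2_def)
qed

lemma K3_commute: "K3 k x y w = K3 k y x w" "K3 k x y w = K3 k x w y"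
proof -
  show "K3 k x y w = K3 k y x w"
    unfolding K3_sum by (subst sum.swap) (simp add: sym1 mult_ac)
  show "K3 k x y w = K3 k x w y"
    by (simp add: K3_def K2_commute)
qed

lemma inner_K2: "x \<bullet> K2 k y w = K3 k x y w" "K2 k y w \<bullet> x = K3 k x y w"
  by (simp_all add: K3_def inner_commute)

lemmas K_simps = K3_simps K2_simps inner_K2 inner_simps

end

lemma cubic_real: "cubic k t = K3 k t t t / 6" for t :: "real^'n::finite"
  by (simp add: cubic_def K3_sum)


section \<open>The group\<close>

text \<open>An element \<open>(c, b, l, \<psi>, \<omega>)\<close> collects the type IIB coordinates \<open>c\<^sup>a, b\<^sup>a, c\<^sub>a, \<psi>\<close> and \<open>\<omega> = -c\<^sub>0\<close>; with
  this sign both \<open>(c, b)\<close> and \<open>(\<psi>, \<omega>)\<close> are doublets of \<open>SL(2)\<close>. The nilpotent group acts on itself by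
  left translations, and \<open>GL\<^sup>+(2)\<close> acts on it by automorphisms; its centre provides the scaling \<open>D\<close>.\<close>

type_synonym 'n nil = "(real^'n) \<times> (real^'n) \<times> (real^'n) \<times> real \<times> real"
type_synonym gl = "real \<times> real \<times> real \<times> real"

definition nil_mul :: "('n::finite \<Rightarrow> 'n \<Rightarrow> 'n \<Rightarrow> real) \<Rightarrow> 'n nil \<Rightarrow> 'n nil \<Rightarrow> 'n nil" where
  "nil_mul k = (\<lambda>(\<gamma>, \<beta>, \<alpha>, \<theta>, \<theta>') (c, b, l, \<psi>, \<omega>).
     (\<gamma> + c, \<beta> + b, \<alpha> + l + (1/2) *\<^sub>R (K2 k \<beta> c - K2 k \<gamma> b),
      \<theta> + \<psi> + \<gamma> \<bullet> l + (K2 k \<beta> c - K2 k \<gamma> b) \<bullet> (c + 2 *\<^sub>R \<gamma>) / 6,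
      \<theta>' + \<omega> + \<beta> \<bullet> l + (K2 k \<beta> c - K2 k \<gamma> b) \<bullet> (b + 2 *\<^sub>R \<beta>) / 6))"

definition nil_inv :: "'n::finite nil \<Rightarrow> 'n nil" where
  "nil_inv = (\<lambda>(c, b, l, \<psi>, \<omega>). (- c, - b, - l, c \<bullet> l - \<psi>, b \<bullet> l - \<omega>))"

definition gl_det :: "gl \<Rightarrow> real" where
  "gl_det = (\<lambda>(a, b, c, d). a * d - b * c)"

definition gl_mul :: "gl \<Rightarrow> gl \<Rightarrow> gl" where
  "gl_mul = (\<lambda>(a, b, c, d) (a', b', c', d').
     (a * a' + b * c', a * b' + b * d', c * a' + d * c', c * b' + d * d'))"

definition gl_inv :: "gl \<Rightarrow> gl" where
  "gl_inv = (\<lambda>(a, b, c, d). let D = a * d - b * c in (d / D, - b / D, - c / D, a / D))"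

definition gl_nil :: "gl \<Rightarrow> 'n::finite nil \<Rightarrow> 'n nil" where
  "gl_nil = (\<lambda>(a, b', c', d) (c, b, l, \<psi>, \<omega>).
     (a *\<^sub>R c + b' *\<^sub>R b, c' *\<^sub>R c + d *\<^sub>R b, (a * d - b' * c') *\<^sub>R l,
      (a * d - b' * c') * (a * \<psi> + b' * \<omega>), (a * d - b' * c') * (c' * \<psi> + d * \<omega>)))"

definition mob :: "gl \<Rightarrow> (real^'n) \<times> complex \<Rightarrow> (real^'n::finite) \<times> complex" where
  "mob = (\<lambda>(a, b, c, d) (t, \<tau>). (cmod (of_real c * \<tau> + of_real d) *\<^sub>R t,
     (of_real a * \<tau> + of_real b) / (of_real c * \<tau> + of_real d)))"

definition gp_mul :: "('n::finite \<Rightarrow> 'n \<Rightarrow> 'n \<Rightarrow> real) \<Rightarrow> gl \<times> 'n nil \<Rightarrow> gl \<times> 'n nil \<Rightarrow> gl \<times> 'n nil" where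
  "gp_mul k = (\<lambda>(A, n) (A', n'). (gl_mul A A', nil_mul k n (gl_nil A n')))"

definition gp_inv :: "gl \<times> 'n::finite nil \<Rightarrow> gl \<times> 'n nil" where
  "gp_inv = (\<lambda>(A, n). (gl_inv A, gl_nil (gl_inv A) (nil_inv n)))"

definition gp_dom :: "(gl \<times> 'n::finite nil) set" where
  "gp_dom = {A. 0 < gl_det A} \<times> UNIV"

definition actC :: "('n::finite \<Rightarrow> 'n \<Rightarrow> 'n \<Rightarrow> real) \<Rightarrow> gl \<times> 'n nil \<Rightarrow>
    ((real^'n) \<times> complex) \<times> 'n nil \<Rightarrow> ((real^'n) \<times> complex) \<times> 'n nil" where
  "actC k = (\<lambda>(A, n) (x, m). (mob A x, nil_mul k n (gl_nil A m)))"

abbreviation gl_one :: gl where "gl_one \<equiv> (1, 0, 0, 1)"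

lemma gl_mul_simps:
  "gl_det (gl_mul A B) = gl_det A * gl_det B"
  "0 < gl_det A \<Longrightarrow> 0 < gl_det (gl_inv A)"
  "0 < gl_det A \<Longrightarrow> gl_mul (gl_inv A) A = gl_one"
  "0 < gl_det A \<Longrightarrow> gl_mul A (gl_inv A) = gl_one"
proof -
  show "gl_det (gl_mul A B) = gl_det A * gl_det B"
    by (auto simp: gl_det_def gl_mul_def algebra_simps split: prod.splits)
  obtain a b c d where A: "A = (a, b, c, d)" by (cases A)
  assume "0 < gl_det A"
  then have D: "a * d - b * c > 0" by (simp add: A gl_det_def)
  define D where "D = a * d - b * c"
  have "gl_det (gl_inv A) = 1 / D"
    using D by (simp add: A gl_det_def gl_inv_def D_def[symmetric] divide_simps) (simp add: D_def algebra_simps)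
  then show "0 < gl_det (gl_inv A)" using D by (simp add: D_def)
  show "gl_mul (gl_inv A) A = gl_one" "gl_mul A (gl_inv A) = gl_one"
    using D by (auto simp: A gl_mul_def gl_inv_def D_def[symmetric] divide_simps) (auto simp: D_def algebra_simps)
qed

lemma gl_iwasawa:
  assumes "0 < gl_det A"
  obtains x y w C S where "A = gl_mul (x, y, 0, w) (C, - S, S, C)" "0 < x" "0 < w" "C\<^sup>2 + S\<^sup>2 = 1"
proof -
  obtain a b c d where A: "A = (a, b, c, d)" and det: "0 < a * d - b * c"
    using assms by (cases A) (auto simp: gl_det_def)
  define w where "w = sqrt (c\<^sup>2 + d\<^sup>2)"
  have "c \<noteq> 0 \<or> d \<noteq> 0" using det by auto
  then have "c\<^sup>2 + d\<^sup>2 > 0" by (simp add: sum_power2_gt_zero_iff)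
  then have w: "w > 0" "w\<^sup>2 = c\<^sup>2 + d\<^sup>2" by (simp_all add: w_def)
  define C where "C = d / w"
  define S where "S = c / w"
  have CS: "C\<^sup>2 + S\<^sup>2 = 1"
  proof -
    have "C\<^sup>2 + S\<^sup>2 = (c\<^sup>2 + d\<^sup>2) / w\<^sup>2" by (simp add: C_def S_def power_divide add_divide_distrib)
    then show ?thesis unfolding w(2)[symmetric] using w(1) by simp
  qed
  have cd: "c = w * S" "d = w * C" using w by (simp_all add: C_def S_def)
  have "(a * C - b * S) * w = a * d - b * c" using w(1) by (simp add: C_def S_def field_simps)
  then have pos: "0 < a * C - b * S" using det w(1) by (metis zero_less_mult_pos2)
  have "(a * C - b * S) * C + (a * S + b * C) * S = a * (C\<^sup>2 + S\<^sup>2)"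
    "(a * S + b * C) * C - (a * C - b * S) * S = b * (C\<^sup>2 + S\<^sup>2)"
    by (simp_all add: power2_eq_square algebra_simps)
  then have "A = gl_mul (a * C - b * S, a * S + b * C, 0, w) (C, - S, S, C)"
    by (simp add: A gl_mul_def CS cd)
  then show ?thesis using pos w(1) CS by (rule that)
qed

lemma gl_nil_one [simp]: "gl_nil gl_one m = m"
  by (auto simp: gl_nil_def split: prod.splits)

lemma gl_nil_mul: "gl_nil (gl_mul A B) m = gl_nil A (gl_nil B m)"
  by (auto simp: gl_nil_def gl_mul_def algebra_simps split: prod.splits)

lemma gl_nil_zero [simp]: "gl_nil A 0 = 0"
  by (auto simp: gl_nil_def zero_prod_def split: prod.splits)

lemma nil_zero [simp]: "nil_mul k 0 m = m" "nil_mul k m 0 = m"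
  by (auto simp: nil_mul_def zero_prod_def K2_simps split: prod.splits)

lemma mob_one [simp]: "mob gl_one x = x"
  by (auto simp: mob_def split: prod.splits)

lemma mob_denominator:
  assumes "0 < gl_det (a, b, c, d)" "0 < Im \<tau>"
  shows "of_real c * \<tau> + of_real d \<noteq> 0"
proof
  assume "of_real c * \<tau> + of_real d = 0"
  then have "c * Im \<tau> = 0" "c * Re \<tau> + d = 0" by (auto simp: complex_eq_iff)
  then have "c = 0" "d = 0" using assms(2) by auto
  then show False using assms(1) by (simp add: gl_det_def)
qed

lemma Im_mob:
  "Im (snd (mob (a, b, c, d) (t, \<tau>))) = gl_det (a, b, c, d) * Im \<tau> / (cmod (of_real c * \<tau> + of_real d))\<^sup>2"
  by (simp add: mob_def gl_det_def Im_divide cmod_power2 algebra_simps)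

lemma Im_mob_pos:
  assumes "0 < gl_det A" "0 < Im \<tau>"
  shows "0 < Im (snd (mob A (t, \<tau>)))"
proof -
  obtain a b c d where A: "A = (a, b, c, d)" by (cases A)
  show ?thesis
    using assms mob_denominator[of a b c d \<tau>] unfolding A Im_mob by simp
qed

lemma mob_mul:
  assumes "0 < gl_det A" "0 < gl_det B" "0 < Im \<tau>"
  shows "mob (gl_mul A B) (t, \<tau>) = mob A (mob B (t, \<tau>))"
proof -
  obtain a b c d where A: "A = (a, b, c, d)" by (cases A)
  obtain a' b' c' d' where B: "B = (a', b', c', d')" by (cases B)
  define w where "w = of_real c' * \<tau> + of_real d'"
  define v where "v = of_real a' * \<tau> + of_real b'"
  have w: "w \<noteq> 0" using mob_denominator[of a' b' c' d' \<tau>] assms by (simp add: B w_def)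
  have 1: "of_real (c * a' + d * c') * \<tau> + of_real (c * b' + d * d') = of_real c * v + of_real d * w"
    "of_real (a * a' + b * c') * \<tau> + of_real (a * b' + b * d') = of_real a * v + of_real b * w"
    by (simp_all add: v_def w_def algebra_simps)
  have 2: "of_real c * (v / w) + of_real d = (of_real c * v + of_real d * w) / w"
    "of_real a * (v / w) + of_real b = (of_real a * v + of_real b * w) / w"
    using w by (simp_all add: field_simps)
  show ?thesis
    using w unfolding A B gl_mul_def mob_def prod.case w_def[symmetric] v_def[symmetric] 1 2
    by (simp add: norm_divide)
qed

context sym_cubic
begin

lemma nil_mul_assoc: "nil_mul k (nil_mul k x y) z = nil_mul k x (nil_mul k y z)"
  by (cases x; cases y; cases z)
    (simp add: nil_mul_def K_simps scaleR_add_right scaleR_diff_right algebra_simps add_divide_distrib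
      diff_divide_distrib K3_commute)

lemma nil_inv: "nil_mul k (nil_inv x) x = 0" "nil_mul k x (nil_inv x) = 0"
  by (cases x; simp add: nil_mul_def nil_inv_def K_simps K3_commute zero_prod_def K2_commute)+

lemma gl_nil_hom: "gl_nil A (nil_mul k x y) = nil_mul k (gl_nil A x) (gl_nil A y)"
  by (cases A; cases x; cases y)
    (simp add: nil_mul_def gl_nil_def K_simps scaleR_add_right scaleR_diff_right algebra_simps
      add_divide_distrib diff_divide_distrib K3_commute K2_commute)

lemma gp_mul_in: "g \<in> gp_dom \<Longrightarrow> h \<in> gp_dom \<Longrightarrow> gp_mul k g h \<in> gp_dom"
  by (auto simp: gp_dom_def gp_mul_def gl_mul_simps)

lemma gp_inv_in: "g \<in> gp_dom \<Longrightarrow> gp_inv g \<in> gp_dom"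
  by (auto simp: gp_dom_def gp_inv_def gl_mul_simps)

lemma gp_mul_inv:
  "g \<in> gp_dom \<Longrightarrow> gp_mul k (gp_inv g) g = (gl_one, 0)" "g \<in> gp_dom \<Longrightarrow> gp_mul k g (gp_inv g) = (gl_one, 0)"
proof -
  assume "g \<in> gp_dom"
  then obtain A n where g: "g = (A, n)" "0 < gl_det A" by (auto simp: gp_dom_def)
  have 1: "gl_nil A (gl_nil (gl_inv A) m) = m" for m :: "'n nil"
    using g by (simp add: gl_nil_mul[symmetric] gl_mul_simps)
  show "gp_mul k (gp_inv g) g = (gl_one, 0)" "gp_mul k g (gp_inv g) = (gl_one, 0)"
    using g by (simp_all add: gp_mul_def gp_inv_def gl_mul_simps gl_nil_hom[symmetric] nil_inv 1)
qed

lemma actC_mul: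
  assumes "g \<in> gp_dom" "h \<in> gp_dom" "0 < Im \<tau>"
  shows "actC k (gp_mul k g h) ((t, \<tau>), m) = actC k g (actC k h ((t, \<tau>), m))"
  using assms
  by (auto simp: gp_dom_def actC_def gp_mul_def mob_mul gl_nil_mul gl_nil_hom nil_mul_assoc)

end

section \<open>Coordinates\<close>

definition cvec :: "real^'n \<Rightarrow> real^'n \<Rightarrow> complex^'n::finite" where
  "cvec b t = (\<chi> a. Complex (b $ a) (t $ a))"

definition opt :: "real \<Rightarrow> real^'n \<Rightarrow> real^('n::finite option)" where
  "opt x v = (\<chi> i. case i of None \<Rightarrow> x | Some a \<Rightarrow> v $ a)"

definition tail :: "real^('n option) \<Rightarrow> real^'n::finite" where
  "tail \<zeta> = (\<chi> a. \<zeta> $ Some a)"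

lemma cvec_simps [simp]: "re_vec (cvec b t) = b" "im_vec (cvec b t) = t"
  "cvec (re_vec z) (im_vec z) = z"
  by (auto simp: cvec_def re_vec_def im_vec_def vec_eq_iff)

lemma opt_simps [simp]: "opt x v $ None = x" "tail (opt x v) = v" "opt (\<zeta> $ None) (tail \<zeta>) = \<zeta>"
  "opt x v $ Some a = v $ a" "tail \<zeta> $ a = \<zeta> $ Some a"
  by (auto simp: opt_def tail_def vec_eq_iff split: option.splits)

lemma opt_cong: "\<zeta> = opt x v \<longleftrightarrow> \<zeta> $ None = x \<and> tail \<zeta> = v"
  by auto

lemma linear_coordinates:
  "bounded_linear (\<lambda>p. cvec (fst p) (snd p))" "bounded_linear (\<lambda>p. opt (fst p) (snd p))"
  "bounded_linear tail" "bounded_linear re_vec" "bounded_linear im_vec"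
  unfolding linear_conv_bounded_linear[symmetric]
  by (auto intro!: linearI simp: cvec_def opt_def tail_def re_vec_def im_vec_def vec_eq_iff
      complex_eq_iff split: option.splits)

lemma re_im_vec_simps:
  "re_vec (z + w) = re_vec z + re_vec w" "im_vec (z + w) = im_vec z + im_vec w"
  "re_vec (s *\<^sub>R z) = s *\<^sub>R re_vec z" "im_vec (s *\<^sub>R z) = s *\<^sub>R im_vec z"
  "re_vec 0 = 0" "im_vec 0 = 0"
  by (auto simp: re_vec_def im_vec_def vec_eq_iff)

lemma tail_simps: "tail (x + y) = tail x + tail y" "tail (s *\<^sub>R x) = s *\<^sub>R tail x" "tail 0 = 0"
  "tail (- x) = - tail x" "tail (x - y) = tail x - tail y"
  by (auto simp: tail_def vec_eq_iff)

type_synonym 'n tb = "((real^'n) \<times> complex) \<times> 'n nil"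

definition to_iia :: "('n::finite \<Rightarrow> 'n \<Rightarrow> 'n \<Rightarrow> real) \<Rightarrow> 'n tb \<Rightarrow> 'n iia" where
  "to_iia k = (\<lambda>((t, \<tau>), (c, b, l, \<psi>, \<omega>)). let y = c - Re \<tau> *\<^sub>R b in
     (cvec b t, (Im \<tau>)\<^sup>2 / 2 * (K3 k t t t / 6),
      opt (- \<omega> - K3 k b b y / 6) (l + (1/2) *\<^sub>R K2 k b y),
      opt (Re \<tau>) (- y),
      - 2 * \<psi> + Re \<tau> * \<omega> + l \<bullet> y - K3 k b c y / 6))"

definition of_iia :: "('n::finite \<Rightarrow> 'n \<Rightarrow> 'n \<Rightarrow> real) \<Rightarrow> 'n iia \<Rightarrow> 'n tb" where
  "of_iia k = (\<lambda>(z, \<rho>, \<zeta>t, \<zeta>, \<sigma>). let b = re_vec z; t = im_vec z; x = \<zeta> $ None; y = tail \<zeta>;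
       l = tail \<zeta>t + (1/2) *\<^sub>R K2 k b y; \<omega> = - (\<zeta>t $ None) + K3 k b b y / 6; c = x *\<^sub>R b - y in
     ((t, Complex x (sqrt (2 * \<rho> / (K3 k t t t / 6)))),
      (c, b, l, (x * \<omega> - l \<bullet> y + K3 k b c y / 6 - \<sigma>) / 2, \<omega>)))"

lemma smooth_on_K2 [smooth_intros]:
  "open S \<Longrightarrow> smooth_on S f \<Longrightarrow> smooth_on S g \<Longrightarrow> smooth_on S (\<lambda>x. K2 k (f x) (g x))"
  by (rule smooth_on_bilinear[OF bounded_bilinear_K2])

lemma smooth_on_K3 [smooth_intros]:
  "open S \<Longrightarrow> smooth_on S f \<Longrightarrow> smooth_on S g \<Longrightarrow> smooth_on S h \<Longrightarrow> smooth_on S (\<lambda>x. K3 k (f x) (g x) (h x))"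
  unfolding K3_def by (intro smooth_intros)

lemma smooth_on_cvec [smooth_intros]:
  "open S \<Longrightarrow> smooth_on S f \<Longrightarrow> smooth_on S g \<Longrightarrow> smooth_on S (\<lambda>x. cvec (f x) (g x))"
  using smooth_on_linear[OF linear_coordinates(1), of S "\<lambda>x. (f x, g x)"] by (simp add: smooth_on_Pair)

lemma smooth_on_opt [smooth_intros]:
  "open S \<Longrightarrow> smooth_on S f \<Longrightarrow> smooth_on S g \<Longrightarrow> smooth_on S (\<lambda>x. opt (f x) (g x))"
  using smooth_on_linear[OF linear_coordinates(2), of S "\<lambda>x. (f x, g x)"] by (simp add: smooth_on_Pair)

lemmas smooth_on_coordinates [smooth_intros] =
  smooth_on_linear[OF linear_coordinates(3)] smooth_on_linear[OF linear_coordinates(4)]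
  smooth_on_linear[OF linear_coordinates(5)] smooth_on_linear[OF bounded_linear_cnj]

lemma smooth_on_Complex [smooth_intros]:
  assumes "open S" "smooth_on S f" "smooth_on S g"
  shows "smooth_on S (\<lambda>x. Complex (f x) (g x))"
proof -
  have "smooth_on S (\<lambda>x. f x *\<^sub>R 1 + g x *\<^sub>R \<i>)" using assms by (intro smooth_intros)
  then show ?thesis by (simp add: Complex_eq scaleR_conv_of_real mult.commute)
qed

lemma smooth_on_cmod [smooth_intros]:
  assumes "open S" "smooth_on S f" "\<And>x. x \<in> S \<Longrightarrow> f x \<noteq> 0"
  shows "smooth_on S (\<lambda>x. cmod (f x))"
  unfolding cmod_def using assms
  by (intro smooth_intros) (auto simp: complex_eq_iff sum_power2_gt_zero_iff)

lemma smooth_on_divide_complex: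
  fixes f g :: "'a::real_normed_vector \<Rightarrow> complex"
  assumes "open S" "smooth_on S f" "smooth_on S g" "\<And>x. x \<in> S \<Longrightarrow> g x \<noteq> 0"
  shows "smooth_on S (\<lambda>x. f x / g x)"
proof -
  have "f x / g x = (1 / (cmod (g x))\<^sup>2) *\<^sub>R (f x * cnj (g x))" for x
    using complex_div_cnj[of "f x" "g x"] by (simp add: scaleR_conv_of_real)
  then show ?thesis
    using assms by (simp only:) (intro smooth_intros; simp)
qed

definition gen_iia :: "(real^'n) set \<Rightarrow> 'n::finite iia set" where
  "gen_iia U = {(z, \<rho>, \<zeta>t, \<zeta>, \<sigma>). im_vec z \<in> U \<and> 0 < \<rho>}"

definition gen_tb :: "(real^'n) set \<Rightarrow> 'n::finite tb set" where
  "gen_tb U = {((t, \<tau>), m). t \<in> U \<and> 0 < Im \<tau>}"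

definition actA :: "('n::finite \<Rightarrow> 'n \<Rightarrow> 'n \<Rightarrow> real) \<Rightarrow> gl \<times> 'n nil \<Rightarrow> 'n iia \<Rightarrow> 'n iia" where
  "actA k g p = to_iia k (actC k g (of_iia k p))"

locale psr_cone = sym_cubic k for k :: "'n::finite \<Rightarrow> 'n \<Rightarrow> 'n \<Rightarrow> real" +
  fixes U :: "(real^'n) set"
  assumes open_U: "open U" and U_nonempty: "U \<noteq> {}"
    and U_scale: "t \<in> U \<Longrightarrow> 0 < s \<Longrightarrow> s *\<^sub>R t \<in> U"
    and U_pos: "t \<in> U \<Longrightarrow> 0 < K3 k t t t"
    and U_nondeg: "t \<in> U \<Longrightarrow> K2 k t v = 0 \<Longrightarrow> v = 0"
begin

lemma of_to: "y \<in> gen_tb U \<Longrightarrow> of_iia k (to_iia k y) = y"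
proof -
  assume "y \<in> gen_tb U"
  then obtain t \<tau> c b l \<psi> \<omega> where y: "y = ((t, \<tau>), (c, b, l, \<psi>, \<omega>))" "t \<in> U" "0 < Im \<tau>"
    by (auto simp: gen_tb_def)
  show ?thesis
    using U_pos[OF y(2)] abs_of_pos[OF y(3)]
    by (simp add: y of_iia_def to_iia_def Let_def K_simps tail_simps K3_commute K2_commute complex_eq_iff
        algebra_simps add_divide_distrib diff_divide_distrib)
qed

lemma to_of: "p \<in> gen_iia U \<Longrightarrow> to_iia k (of_iia k p) = p"
proof -
  assume "p \<in> gen_iia U"
  then obtain z \<rho> \<zeta>t \<zeta> \<sigma> where p: "p = (z, \<rho>, \<zeta>t, \<zeta>, \<sigma>)" "im_vec z \<in> U" "0 < \<rho>"
    by (auto simp: gen_iia_def)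
  have "(sqrt (2 * \<rho> / (K3 k (im_vec z) (im_vec z) (im_vec z) / 6)))\<^sup>2 / 2 *
      (K3 k (im_vec z) (im_vec z) (im_vec z) / 6) = \<rho>"
    using U_pos[OF p(2)] p(3) by simp
  then show ?thesis
    by (simp add: p of_iia_def to_iia_def Let_def K_simps K3_commute K2_commute opt_cong[symmetric] eq_commute[of "opt _ _"] opt_cong
        algebra_simps add_divide_distrib diff_divide_distrib)
qed

lemma to_in: "y \<in> gen_tb U \<Longrightarrow> to_iia k y \<in> gen_iia U"
  using U_pos by (auto simp: gen_tb_def gen_iia_def to_iia_def Let_def)

lemma of_in: "p \<in> gen_iia U \<Longrightarrow> of_iia k p \<in> gen_tb U"
  using U_pos by (auto simp: gen_tb_def gen_iia_def of_iia_def Let_def)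

lemma actC_in: "g \<in> gp_dom \<Longrightarrow> y \<in> gen_tb U \<Longrightarrow> actC k g y \<in> gen_tb U"
proof -
  assume "g \<in> gp_dom" "y \<in> gen_tb U"
  then obtain a b c d n t \<tau> m where g: "g = ((a, b, c, d), n)" "0 < gl_det (a, b, c, d)"
    and y: "y = ((t, \<tau>), m)" "t \<in> U" "0 < Im \<tau>"
    by (auto simp: gp_dom_def gen_tb_def)
  have "0 < Im (snd (mob (a, b, c, d) (t, \<tau>)))" by (rule Im_mob_pos[OF g(2) y(3)])
  then show ?thesis
    using mob_denominator[OF g(2) y(3)] U_scale[OF y(2)]
    by (auto simp: g y actC_def gen_tb_def mob_def)
qed

lemma actA_in: "g \<in> gp_dom \<Longrightarrow> p \<in> gen_iia U \<Longrightarrow> actA k g p \<in> gen_iia U"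
  by (simp add: actA_def to_in of_in actC_in)

lemma actA_mul: "g \<in> gp_dom \<Longrightarrow> h \<in> gp_dom \<Longrightarrow> p \<in> gen_iia U \<Longrightarrow> actA k (gp_mul k g h) p = actA k g (actA k h p)"
proof -
  assume g: "g \<in> gp_dom" "h \<in> gp_dom" and p: "p \<in> gen_iia U"
  obtain t \<tau> m where y: "of_iia k p = ((t, \<tau>), m)" "0 < Im \<tau>"
    using of_in[OF p] by (auto simp: gen_tb_def)
  show ?thesis
    using actC_mul[OF g y(2), of t m] actC_in[OF g(2) of_in[OF p]] y(1) by (simp add: actA_def of_to)
qed

lemma actC_one: "actC k (gl_one, 0) y = y"
  by (auto simp: actC_def split: prod.splits)

lemma actA_one: "p \<in> gen_iia U \<Longrightarrow> actA k (gl_one, 0) p = p"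
  by (simp add: actA_def actC_one to_of)

lemma actA_to: "y \<in> gen_tb U \<Longrightarrow> actA k g (to_iia k y) = to_iia k (actC k g y)"
  by (simp add: actA_def of_to)

lemma actA_faithful:
  assumes g: "g \<in> gp_dom" "h \<in> gp_dom" and eq: "\<And>p. p \<in> gen_iia U \<Longrightarrow> actA k g p = actA k h p"
  shows "g = h"
proof -
  obtain t where t: "t \<in> U" using U_nonempty by blast
  then have t0: "t \<noteq> 0" using U_pos K3_simps(13)[of k t t] by fastforce
  obtain a b c d n a' b' c' d' n' where gh: "g = ((a, b, c, d), n)" "h = ((a', b', c', d'), n')"
    by (metis prod_cases4 surj_pair)
  have *: "actC k g y = actC k h y" if "y \<in> gen_tb U" for y
    using eq[OF to_in[OF that]] that g by (metis actA_to actC_in of_to)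
  have y: "((t, \<i>), m) \<in> gen_tb U" for m :: "'n nil" using t by (simp add: gen_tb_def)
  have **: "nil_mul k n (gl_nil (a, b, c, d) m) = nil_mul k n' (gl_nil (a', b', c', d') m)" for m
    using *[OF y, of m] by (simp add: gh actC_def)
  have n: "n = n'" using **[of 0] by simp
  have "gl_nil (a, b, c, d) m = gl_nil (a', b', c', d') m" for m :: "'n nil"
    using **[of m] unfolding n by (metis nil_inv(1) nil_mul_assoc nil_zero(1))
  from this[of "(t, 0, 0, 0, 0)"] this[of "(0, t, 0, 0, 0)"]
  have "a = a' \<and> b = b' \<and> c = c' \<and> d = d'" using t0 by (simp add: gl_nil_def)
  then show ?thesis by (simp add: gh n)
qed

lemma open_gen_tb: "open (gen_tb U)"
proof -
  have "gen_tb U = (\<lambda>y. fst (fst y)) -` U \<inter> (\<lambda>y. Im (snd (fst y))) -` {0<..}"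
    by (auto simp: gen_tb_def)
  then show ?thesis
    by (auto intro!: open_Int open_vimage open_U continuous_intros)
qed

lemma open_gen_iia: "open (gen_iia U)"
proof -
  have "gen_iia U = (\<lambda>p. im_vec (fst p)) -` U \<inter> (\<lambda>p. fst (snd p)) -` {0<..}"
    by (auto simp: gen_iia_def)
  then show ?thesis
    by (auto intro!: open_Int open_vimage open_U continuous_intros
        bounded_linear.continuous_on[OF linear_coordinates(5)])
qed

lemma open_gp_dom: "open gp_dom"
proof -
  have "{A. 0 < gl_det A} = (\<lambda>A. fst A * snd (snd (snd A)) - fst (snd A) * fst (snd (snd A))) -` {0<..}"
    by (auto simp: gl_det_def)
  then have "open {A. 0 < gl_det A}"
    by (auto intro!: open_vimage continuous_intros)
  then show ?thesis unfolding gp_dom_def by (intro open_Times) auto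
qed

lemma smooth_to_iia: "open S \<Longrightarrow> smooth_on S f \<Longrightarrow> smooth_on S (\<lambda>x. to_iia k (f x))"
  unfolding to_iia_def split_beta Let_def
  by (intro smooth_intros; (assumption | simp)?)

lemma smooth_of_iia: "smooth_on (gen_iia U) (of_iia k)"
proof -
  have "0 < fst (snd p) \<and> 0 < K3 k (im_vec (fst p)) (im_vec (fst p)) (im_vec (fst p))" if "p \<in> gen_iia U" for p
    using that U_pos by (auto simp: gen_iia_def)
  then show ?thesis
    unfolding of_iia_def split_beta Let_def
    by (intro smooth_intros open_gen_iia) auto
qed

lemma smooth_gp_mul: "smooth_on (gp_dom \<times> gp_dom) (\<lambda>(g, h). gp_mul k g h)"
  unfolding gp_mul_def gl_mul_def nil_mul_def gl_nil_def split_beta Let_def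
  by (intro smooth_intros open_Times open_gp_dom) auto

lemma smooth_gp_inv: "smooth_on (gp_dom :: (gl \<times> 'n nil) set) gp_inv"
proof -
  have "0 < fst (fst g) * snd (snd (snd (fst g))) - fst (snd (fst g)) * fst (snd (snd (fst g)))"
    if "g \<in> gp_dom" for g :: "gl \<times> 'n nil"
    using that by (auto simp: gp_dom_def gl_det_def)
  then show ?thesis
    unfolding gp_inv_def gl_inv_def nil_inv_def gl_nil_def split_beta Let_def
    by (intro smooth_intros open_gp_dom) auto
qed

lemma smooth_actC: "smooth_on (gp_dom \<times> gen_tb U) (\<lambda>(g, y). actC k g y)"
proof -
  have *: "of_real (fst (snd (snd (fst (fst q))))) * snd (fst (snd q)) + of_real (snd (snd (snd (fst (fst q))))) \<noteq> 0"
    if "q \<in> gp_dom \<times> gen_tb U" for q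
    using that mob_denominator by (auto simp: gp_dom_def gen_tb_def)
  show ?thesis
    unfolding actC_def mob_def gl_nil_def nil_mul_def split_beta Let_def
    by (intro smooth_intros smooth_on_divide_complex open_Times open_gp_dom open_gen_tb *) auto
qed

lemma smooth_actA: "smooth_on (gp_dom \<times> gen_iia U) (\<lambda>(g, p). actA k g p)"
proof -
  have o: "open (gp_dom \<times> gen_iia U)" by (intro open_Times open_gp_dom open_gen_iia)
  have "smooth_on (gp_dom \<times> gen_iia U) (\<lambda>q. (\<lambda>(g, y). actC k g y) (fst q, of_iia k (snd q)))"
    by (rule smooth_on_compose[OF o _ _ smooth_actC])
      (auto intro!: open_Times open_gp_dom open_gen_tb smooth_intros o of_in
        smooth_on_compose[OF o open_gen_iia _ smooth_of_iia])
  from smooth_to_iia[OF o this] show ?thesis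
    by (simp add: actA_def case_prod_unfold)
qed

sublocale smooth_action gp_dom "gen_iia U" "gp_mul k" gp_inv "(gl_one, 0)" "actA k"
proof
  show "(gl_one, 0) \<in> gp_dom" by (simp add: gp_dom_def gl_det_def)
qed (use open_gp_dom open_gen_iia gp_mul_in gp_inv_in actA_in actA_mul actA_one gp_mul_inv
    smooth_gp_mul smooth_gp_inv smooth_actA actA_faithful in blast)+

end

section \<open>Generators of the group\<close>

lemma inner_option: "(\<Sum>i\<in>UNIV. \<xi> $ i * \<eta> $ i) = \<xi> $ None * \<eta> $ None + tail \<xi> \<bullet> tail \<eta>"
  for \<xi> \<eta> :: "real^('n::finite option)"
  by (simp add: UNIV_option_conv sum.reindex inner_vec_def)

lemma cvec_eq_iff: "z = cvec b t \<longleftrightarrow> re_vec z = b \<and> im_vec z = t"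
  by auto

lemma cvec_algebra: "cvec b t + cvec b' t' = cvec (b + b') (t + t')" "s *\<^sub>R cvec b t = cvec (s *\<^sub>R b) (s *\<^sub>R t)"
  by (auto simp: cvec_def vec_eq_iff complex_eq_iff)

lemma numeral_mult_vec: "numeral w * v = (numeral w :: real) *\<^sub>R v" for v :: "real^'n"
  by (simp add: vec_eq_iff)

lemma powr_half_integers:
  assumes "0 < s"
  shows "s powr (-1/2) = 1 / sqrt s" "s powr (1/2) = sqrt s" "s powr (-3/2) = 1 / sqrt s ^ 3" "s powr (3/2) = sqrt s ^ 3"
  using assms by (simp_all add: powr_minus_divide powr_half_sqrt powr_half_sqrt_powr powr_numeral real_sqrt_power)

lemma L1_dilation_eq:
  assumes "0 < s"
  shows "L1_dilation s = ((\<lambda>(z, \<rho>, \<zeta>t, \<zeta>, \<sigma>). (s *\<^sub>R z, \<rho>,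
    opt (sqrt s ^ 3 * \<zeta>t $ None) (sqrt s *\<^sub>R tail \<zeta>t), opt (1 / sqrt s ^ 3 * \<zeta> $ None) ((1 / sqrt s) *\<^sub>R tail \<zeta>), \<sigma>)) :: 'n::finite iia \<Rightarrow> 'n iia)"
proof -
  have "(\<chi> i. case i of None \<Rightarrow> x * \<zeta> $ None | Some a \<Rightarrow> x' * \<zeta> $ Some a) = opt (x * \<zeta> $ None) (x' *\<^sub>R tail \<zeta>)"
    for x x' and \<zeta> :: "real^('n option)"
    by (auto simp: vec_eq_iff opt_def split: option.splits)
  then show ?thesis unfolding L1_dilation_def powr_half_integers[OF assms] by (simp only:)
qed

context psr_cone
begin

lemma iia_cases:
  assumes "p \<in> gen_iia U"
  obtains t \<tau> c b l \<psi> \<omega> where "p = to_iia k ((t, \<tau>), (c, b, l, \<psi>, \<omega>))" "t \<in> U" "0 < Im \<tau>"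
    "((t, \<tau>), (c, b, l, \<psi>, \<omega>)) \<in> gen_tb U"
proof -
  obtain t \<tau> c b l \<psi> \<omega> where y: "of_iia k p = ((t, \<tau>), (c, b, l, \<psi>, \<omega>))"
    by (metis prod.exhaust)
  show ?thesis
    using that[of t \<tau> c b l \<psi> \<omega>] to_of[OF assms] of_in[OF assms] unfolding y by (auto simp: gen_tb_def)
qed

lemma L2_actA:
  assumes "0 < r" "p \<in> gen_iia U"
  shows "actA k ((sqrt r, \<eta> $ None, 0, 1),
      (- tail \<eta>, 0, tail \<eta>t, - (\<kappa> + \<eta> $ None * \<eta>t $ None + tail \<eta>t \<bullet> tail \<eta>) / 2, - (\<eta>t $ None))) p
    = L2_transf r \<eta>t \<eta> \<kappa> p"
proof -
  obtain t \<tau> c b l \<psi> \<omega> where y: "p = to_iia k ((t, \<tau>), (c, b, l, \<psi>, \<omega>))" "((t, \<tau>), (c, b, l, \<psi>, \<omega>)) \<in> gen_tb U"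
    using iia_cases[OF assms(2)] by metis
  define s where "s = sqrt r"
  have s: "r = s * s" "0 < s" using assms(1) by (auto simp: s_def)
  show ?thesis
    unfolding y(1) actA_to[OF y(2)] s_def[symmetric]
    by (simp add: s(1) abs_of_pos[OF s(2)] actC_def mob_def gl_nil_def nil_mul_def to_iia_def L2_transf_def Let_def inner_option
        sum_subtractf real_sqrt_mult K_simps K3_commute K2_commute opt_cong eq_commute[of "opt _ _"] tail_simps
        numeral_mult_vec power_mult_distrib power2_eq_square algebra_simps add_divide_distrib diff_divide_distrib inner_commute)
qed

lemma L1_dilation_actA:
  assumes "0 < s" "p \<in> gen_iia U"
  shows "actA k ((s powr (-1/2), 0, 0, s), 0) p = L1_dilation s p"
proof -
  obtain t \<tau> c b l \<psi> \<omega> where y: "p = to_iia k ((t, \<tau>), (c, b, l, \<psi>, \<omega>))" "((t, \<tau>), (c, b, l, \<psi>, \<omega>)) \<in> gen_tb U"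
    using iia_cases[OF assms(2)] by metis
  define q where "q = sqrt s"
  have q: "s = q * q" "0 < q" using assms(1) by (auto simp: q_def)
  show ?thesis
    unfolding y(1) actA_to[OF y(2)] L1_dilation_eq[OF assms(1)] powr_half_integers[OF assms(1)] q_def[symmetric]
    using q(2)
    by (simp add: q(1) actC_def mob_def gl_nil_def to_iia_def Let_def cvec_algebra
        K_simps K3_commute K2_commute opt_cong eq_commute[of "opt _ _"] tail_simps norm_mult
        power_mult_distrib power2_eq_square power3_eq_cube algebra_simps add_divide_distrib diff_divide_distrib inner_commute
        Re_divide_of_real)
qed

lemma L1_translation_eq:
  "L1_translation k v = (\<lambda>(z, \<rho>, \<zeta>t, \<zeta>, \<sigma>). (cvec (re_vec z + v) (im_vec z), \<rho>,
    opt (\<zeta>t $ None + 1/6 * K3 k v v v * \<zeta> $ None + 1/2 * K3 k v v (tail \<zeta>) - tail \<zeta>t \<bullet> v)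
        (tail \<zeta>t - (1/2 * \<zeta> $ None) *\<^sub>R K2 k v v - K2 k v (tail \<zeta>)),
    opt (\<zeta> $ None) (tail \<zeta> + \<zeta> $ None *\<^sub>R v), \<sigma>))"
proof -
  have 1: "(\<chi> a. z $ a + of_real (v $ a)) = cvec (re_vec z + v) (im_vec z)" for z
    by (simp add: vec_eq_iff cvec_def re_vec_def im_vec_def complex_eq_iff)
  have 2: "(\<chi> i. case i of None \<Rightarrow> \<zeta>t $ None
            + 1/6 * (\<Sum>a\<in>UNIV. \<Sum>b\<in>UNIV. \<Sum>c\<in>UNIV. k a b c * v $ a * v $ b * v $ c) * \<zeta> $ None
            + 1/2 * (\<Sum>a\<in>UNIV. \<Sum>b\<in>UNIV. \<Sum>c\<in>UNIV. k a b c * v $ a * v $ b * \<zeta> $ Some c)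
            - (\<Sum>a\<in>UNIV. \<zeta>t $ Some a * v $ a)
        | Some a \<Rightarrow> \<zeta>t $ Some a
            - 1/2 * \<zeta> $ None * (\<Sum>b\<in>UNIV. \<Sum>c\<in>UNIV. k a b c * v $ b * v $ c)
            - (\<Sum>b\<in>UNIV. \<Sum>c\<in>UNIV. k a b c * v $ b * \<zeta> $ Some c))
    = opt (\<zeta>t $ None + 1/6 * K3 k v v v * \<zeta> $ None + 1/2 * K3 k v v (tail \<zeta>) - tail \<zeta>t \<bullet> v)
        (tail \<zeta>t - (1/2 * \<zeta> $ None) *\<^sub>R K2 k v v - K2 k v (tail \<zeta>))" for \<zeta> \<zeta>t
    by (auto simp: vec_eq_iff opt_def K3_sum K2_def inner_vec_def split: option.splits)
  have 3: "(\<chi> i. case i of None \<Rightarrow> \<zeta> $ None | Some a \<Rightarrow> \<zeta> $ Some a + \<zeta> $ None * v $ a)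
    = opt (\<zeta> $ None) (tail \<zeta> + \<zeta> $ None *\<^sub>R v)" for \<zeta>
    by (auto simp: vec_eq_iff opt_def split: option.splits)
  show ?thesis
    unfolding L1_translation_def 1 2 3 ..
qed

lemma L1_translation_actA:
  assumes "p \<in> gen_iia U"
  shows "actA k (gl_one, (0, v, 0, 0, 0)) p = L1_translation k v p"
proof -
  obtain t \<tau> c b l \<psi> \<omega> where y: "p = to_iia k ((t, \<tau>), (c, b, l, \<psi>, \<omega>))" "((t, \<tau>), (c, b, l, \<psi>, \<omega>)) \<in> gen_tb U"
    using iia_cases[OF assms(1)] by metis
  show ?thesis
    unfolding y(1) actA_to[OF y(2)] L1_translation_eq
    by (simp add: actC_def nil_mul_def to_iia_def Let_def
        K_simps K3_commute K2_commute opt_cong eq_commute[of "opt _ _"] tail_simps numeral_mult_vec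
        algebra_simps add_divide_distrib diff_divide_distrib inner_commute)
qed

end

lemma has_derivative_K2 [derivative_intros]:
  "(f has_derivative f') (at x within S) \<Longrightarrow> (g has_derivative g') (at x within S) \<Longrightarrow>
    ((\<lambda>x. K2 k (f x) (g x)) has_derivative (\<lambda>v. K2 k (f x) (g' v) + K2 k (f' v) (g x))) (at x within S)"
  by (rule bounded_bilinear.FDERIV[OF bounded_bilinear_K2])

lemma has_derivative_K3 [derivative_intros]:
  assumes "(f has_derivative f') (at x within S)" "(g has_derivative g') (at x within S)"
    "(h has_derivative h') (at x within S)"
  shows "((\<lambda>x. K3 k (f x) (g x) (h x)) has_derivative
    (\<lambda>v. K3 k (f x) (g x) (h' v) + K3 k (f x) (g' v) (h x) + K3 k (f' v) (g x) (h x))) (at x within S)"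
  unfolding K3_def using assms by (auto intro!: derivative_eq_intros simp: inner_simps)

lemmas has_derivative_coordinates [derivative_intros] =
  bounded_linear.has_derivative[OF linear_coordinates(3)] bounded_linear.has_derivative[OF linear_coordinates(4)]
  bounded_linear.has_derivative[OF linear_coordinates(5)]

lemma has_derivative_cvec [derivative_intros]:
  "(f has_derivative f') (at x within S) \<Longrightarrow> (g has_derivative g') (at x within S) \<Longrightarrow>
    ((\<lambda>x. cvec (f x) (g x)) has_derivative (\<lambda>v. cvec (f' v) (g' v))) (at x within S)"
  using bounded_linear.has_derivative[OF linear_coordinates(1) has_derivative_Pair] by fastforce

lemma has_derivative_opt [derivative_intros]:
  "(f has_derivative f') (at x within S) \<Longrightarrow> (g has_derivative g') (at x within S) \<Longrightarrow>
    ((\<lambda>x. opt (f x) (g x)) has_derivative (\<lambda>v. opt (f' v) (g' v))) (at x within S)"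
  using bounded_linear.has_derivative[OF linear_coordinates(2) has_derivative_Pair] by fastforce

definition d_to_iia :: "('n::finite \<Rightarrow> 'n \<Rightarrow> 'n \<Rightarrow> real) \<Rightarrow> 'n tb \<Rightarrow> 'n tb \<Rightarrow> 'n iia" where
  "d_to_iia k = (\<lambda>((t, \<tau>), (c, b, l, \<psi>, \<omega>)) ((dt, d\<tau>), (dc, db, dl, d\<psi>, d\<omega>)).
     let y = c - Re \<tau> *\<^sub>R b; dy = dc - Re d\<tau> *\<^sub>R b - Re \<tau> *\<^sub>R db in
     (cvec db dt, Im \<tau> * Im d\<tau> * K3 k t t t / 6 + (Im \<tau>)\<^sup>2 * K3 k t t dt / 4,
      opt (- d\<omega> - (2 * K3 k b db y + K3 k b b dy) / 6) (dl + (1/2) *\<^sub>R (K2 k db y + K2 k b dy)),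
      opt (Re d\<tau>) (- dy),
      - 2 * d\<psi> + Re d\<tau> * \<omega> + Re \<tau> * d\<omega> + dl \<bullet> y + l \<bullet> dy
        - (K3 k db c y + K3 k b dc y + K3 k b c dy) / 6))"

context psr_cone
begin

lemma has_derivative_to_iia: "(to_iia k has_derivative d_to_iia k y) (at y)"
proof -
  obtain t \<tau> c b l \<psi> \<omega> where y: "y = ((t, \<tau>), (c, b, l, \<psi>, \<omega>))" by (metis prod.exhaust)
  show ?thesis
    unfolding to_iia_def split_beta Let_def
    by (rule has_derivative_eq_rhs, (rule derivative_intros has_derivative_Pair | (simp; fail))+)
     (auto simp: y d_to_iia_def fun_eq_iff Let_def split_beta K_simps K3_commute K2_commute scaleR_add_right scaleR_diff_right
        numeral_mult_vec power2_eq_square algebra_simps add_divide_distrib diff_divide_distrib inner_commute)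
qed

end

section \<open>The Lie algebra\<close>

lemma axis_simps: "tail (axis None x) = 0" "tail (axis (Some a) x) = axis a x" "axis None x $ None = x"
  "axis (Some a) x $ None = 0"
  by (auto simp: tail_def axis_def vec_eq_iff)

lemma linear_axis_expansion:
  fixes F :: "real^'n::finite \<Rightarrow> 'b::real_vector"
  assumes "linear F"
  shows "F v = (\<Sum>a\<in>UNIV. v $ a *\<^sub>R F (axis a 1))"
proof -
  have "F v = F (\<Sum>a\<in>UNIV. v $ a *\<^sub>R axis a 1)"
    using basis_expansion[of v] by (simp add: scalar_mult_eq_scaleR)
  then show ?thesis
    by (simp add: linear_sum[OF assms] linear_scale[OF assms])
qed

definition Xf_raw :: "('n::finite \<Rightarrow> 'n \<Rightarrow> 'n \<Rightarrow> real) \<Rightarrow> 'n iia \<Rightarrow> 'n iia" where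
  "Xf_raw k = (\<lambda>(z, \<rho>, \<zeta>t, \<zeta>, \<sigma>). let b = re_vec z; t = im_vec z; x = \<zeta> $ None; y = tail \<zeta>; \<xi> = tail \<zeta>t;
      S = 12 * \<rho> / K3 k t t t in
    (cvec (x *\<^sub>R b - y) (x *\<^sub>R t), - x * \<rho>,
     opt ((\<sigma> + x * \<zeta>t $ None + \<xi> \<bullet> y) / 2 + S * K3 k b b b / 6)
       ((1/2) *\<^sub>R K2 k y y - (S / 2) *\<^sub>R K2 k b b),
     opt (S - x\<^sup>2) (S *\<^sub>R b - x *\<^sub>R y),
     x * (x * \<zeta>t $ None + \<xi> \<bullet> y - \<sigma>) / 2 - S * (\<zeta>t $ None + \<xi> \<bullet> b) - S * K3 k b b y / 2
       + x * S * K3 k b b b / 6 + K3 k y y y / 6))"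

definition D1_raw :: "'n::finite iia \<Rightarrow> 'n iia" where
  "D1_raw = (\<lambda>(z, \<rho>, \<zeta>t, \<zeta>, \<sigma>).
     (z, 0, opt (3/2 * \<zeta>t $ None) ((1/2) *\<^sub>R tail \<zeta>t), opt (- 3/2 * \<zeta> $ None) ((-1/2) *\<^sub>R tail \<zeta>), 0))"

definition Xh_raw :: "'n::finite iia \<Rightarrow> 'n iia" where
  "Xh_raw = (\<lambda>(z, \<rho>, \<zeta>t, \<zeta>, \<sigma>). (- z, \<rho>, opt (- \<zeta>t $ None) 0, opt (2 * \<zeta> $ None) (tail \<zeta>), \<sigma>))"

definition V_raw :: "('n::finite \<Rightarrow> 'n \<Rightarrow> 'n \<Rightarrow> real) \<Rightarrow> real^'n \<Rightarrow> 'n iia \<Rightarrow> 'n iia" where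
  "V_raw k v = (\<lambda>(z, \<rho>, \<zeta>t, \<zeta>, \<sigma>).
     (cvec v 0, 0, opt (- (tail \<zeta>t \<bullet> v)) (- K2 k v (tail \<zeta>)), opt 0 (\<zeta> $ None *\<^sub>R v), 0))"

definition L2_raw :: "real \<Rightarrow> real^('n option) \<Rightarrow> real^('n option) \<Rightarrow> real \<Rightarrow> 'n::finite iia \<Rightarrow> 'n iia" where
  "L2_raw r \<eta>t \<eta> \<kappa> = (\<lambda>(z, \<rho>, \<zeta>t, \<zeta>, \<sigma>).
     (0, r * \<rho>, \<eta>t + (r / 2) *\<^sub>R \<zeta>t, \<eta> + (r / 2) *\<^sub>R \<zeta>, \<kappa> + r * \<sigma> + \<eta> \<bullet> \<zeta>t - \<eta>t \<bullet> \<zeta>))"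

lemma fields_raw:
  "D_field N = vf_on N (L2_raw 1 0 0 0)"
  "P_field N i = vf_on N (L2_raw 0 0 (axis i 1) 0)"
  "X_field N i = vf_on N (L2_raw 0 (axis i 1) 0 0)"
  "Z_field N = vf_on N (L2_raw 0 0 0 1)"
  by (auto simp: D_field_def P_field_def X_field_def Z_field_def L2_raw_def vf_on_def fun_eq_iff inner_axis')

lemma (in sym_cubic) V_field_raw: "V_field k N a = vf_on N (V_raw k (axis a 1))"
proof -
  have "K2 k (axis a 1) v $ b = (\<Sum>c\<in>UNIV. k a b c * v $ c)" for v b
    by (simp add: K2_def axis_def if_distrib[of "\<lambda>x. _ * x"] if_distribR sum.swap[of _ UNIV UNIV]
        if_distrib[of "\<lambda>x. x * _"] sym1[of b a] cong: if_cong)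
  moreover have "axis (Some a) x = opt 0 (x *\<^sub>R axis a 1)" for x
    by (auto simp: vec_eq_iff axis_def opt_def split: option.splits)
  moreover have "cvec (axis a 1) 0 = axis a 1"
    by (auto simp: vec_eq_iff axis_def cvec_def complex_eq_iff)
  ultimately show ?thesis
    by (auto simp: V_field_def V_raw_def vf_on_def fun_eq_iff vec_eq_iff opt_def inner_axis split: option.splits)
qed

lemma has_derivative_exp_linear:
  "((\<lambda>s. exp (s * r)) has_derivative (\<lambda>s. s * r)) (at (0::real))"
  "((\<lambda>s. exp s) has_derivative (\<lambda>s. s)) (at (0::real))"
  by (auto intro!: derivative_eq_intros)

context psr_cone
begin

lemma fund_eqI:
  assumes "(c has_vector_derivative \<xi>) (at 0)" "c 0 = (gl_one, 0)"
    "\<And>p. p \<in> gen_iia U \<Longrightarrow> ((\<lambda>s. actA k (c s) p) has_vector_derivative Y p) (at 0)"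
  shows "fund \<xi> = vf_on (gen_iia U) Y"
  unfolding act_curve_eq[OF assms(1,2), symmetric]
  using vector_derivative_at[OF assms(3)] by (auto simp: vf_on_def fun_eq_iff)

lemma fund_L2:
  "fund ((r / 2, \<eta> $ None, 0, 0), (- tail \<eta>, 0, tail \<eta>t, - \<kappa> / 2, - (\<eta>t $ None))) = vf_on (gen_iia U) (L2_raw r \<eta>t \<eta> \<kappa>)"
proof (rule fund_eqI)
  define c :: "real \<Rightarrow> gl \<times> 'n nil" where "c s = ((sqrt (exp (s * r)), (s *\<^sub>R \<eta>) $ None, 0, 1),
      (- tail (s *\<^sub>R \<eta>), 0, tail (s *\<^sub>R \<eta>t),
        - (s * \<kappa> + (s *\<^sub>R \<eta>) $ None * (s *\<^sub>R \<eta>t) $ None + tail (s *\<^sub>R \<eta>t) \<bullet> tail (s *\<^sub>R \<eta>)) / 2, - ((s *\<^sub>R \<eta>t) $ None)))" for s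
  have sq: "sqrt (exp (s * r)) = exp (s * (r / 2))" for s
    by (rule real_sqrt_unique) (simp_all add: power2_eq_square exp_add[symmetric])
  show "(c has_vector_derivative ((r / 2, \<eta> $ None, 0, 0), (- tail \<eta>, 0, tail \<eta>t, - \<kappa> / 2, - (\<eta>t $ None)))) (at 0)"
    unfolding c_def sq tail_simps vector_scaleR_component real_scaleR_def has_vector_derivative_def
    apply (rule has_derivative_eq_rhs, (rule has_derivative_exp_linear derivative_intros has_derivative_Pair numeral_neq_zero)+)
    apply (auto simp: zero_prod_def fun_eq_iff)
    done
  show "c 0 = (gl_one, 0)" by (simp add: c_def tail_simps zero_prod_def)
  fix p assume p: "p \<in> gen_iia U"
  obtain z \<rho> \<zeta>t \<zeta> \<sigma> where q: "p = (z, \<rho>, \<zeta>t, \<zeta>, \<sigma>)" by (metis prod.exhaust)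
  have sum: "(\<Sum>i\<in>UNIV. (s *\<^sub>R \<eta>) $ i * \<zeta>t $ i - (s *\<^sub>R \<eta>t) $ i * \<zeta> $ i) = s * (\<eta> \<bullet> \<zeta>t - \<eta>t \<bullet> \<zeta>)" for s
    by (simp add: inner_vec_def sum_subtractf sum_distrib_left algebra_simps)
  have "((\<lambda>s. L2_transf (exp (s * r)) (s *\<^sub>R \<eta>t) (s *\<^sub>R \<eta>) (s * \<kappa>) p) has_vector_derivative L2_raw r \<eta>t \<eta> \<kappa> p) (at 0)"
    unfolding L2_transf_def q prod.case sq sum has_vector_derivative_def
    apply (rule has_derivative_eq_rhs, (rule has_derivative_exp_linear derivative_intros has_derivative_Pair numeral_neq_zero)+)
    apply (auto simp: zero_prod_def fun_eq_iff L2_raw_def algebra_simps)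
    done
  then show "((\<lambda>s. actA k (c s) p) has_vector_derivative L2_raw r \<eta>t \<eta> \<kappa> p) (at 0)"
    unfolding c_def L2_actA[OF exp_gt_zero p] .
qed

lemma fund_V: "fund (0, (0, v, 0, 0, 0)) = vf_on (gen_iia U) (V_raw k v)"
proof (rule fund_eqI)
  define c :: "real \<Rightarrow> gl \<times> 'n nil" where "c s = (gl_one, (0, s *\<^sub>R v, 0, 0, 0))" for s
  show "(c has_vector_derivative (0, (0, v, 0, 0, 0))) (at 0)"
    unfolding c_def has_vector_derivative_def
    apply (rule has_derivative_eq_rhs, (rule has_derivative_exp_linear derivative_intros has_derivative_Pair numeral_neq_zero)+)
    apply (auto simp: zero_prod_def fun_eq_iff)
    done
  show "c 0 = (gl_one, 0)" by (simp add: c_def zero_prod_def)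
  fix p assume p: "p \<in> gen_iia U"
  obtain z \<rho> \<zeta>t \<zeta> \<sigma> where q: "p = (z, \<rho>, \<zeta>t, \<zeta>, \<sigma>)" by (metis prod.exhaust)
  have "((\<lambda>s. L1_translation k (s *\<^sub>R v) p) has_vector_derivative V_raw k v p) (at 0)"
    unfolding L1_translation_eq q prod.case K_simps has_vector_derivative_def
    apply (rule has_derivative_eq_rhs, (rule has_derivative_exp_linear derivative_intros has_derivative_Pair numeral_neq_zero)+)
    apply (auto simp: zero_prod_def fun_eq_iff V_raw_def cvec_algebra opt_cong eq_commute[of "opt _ _"] tail_simps algebra_simps)
    done
  then show "((\<lambda>s. actA k (c s) p) has_vector_derivative V_raw k v p) (at 0)"
    unfolding c_def using L1_translation_actA[OF p] by simp
qed

lemma fund_D1: "fund ((-1/2, 0, 0, 1), 0) = vf_on (gen_iia U) D1_raw"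
proof (rule fund_eqI)
  define c :: "real \<Rightarrow> gl \<times> 'n nil" where "c s = ((exp s powr (-1/2), 0, 0, exp s), 0)" for s
  have pw: "exp s powr x = exp (s * x)" for s x :: real by (simp add: powr_def)
  show "(c has_vector_derivative ((-1/2, 0, 0, 1), 0)) (at 0)"
    unfolding c_def has_vector_derivative_def pw
    apply (rule has_derivative_eq_rhs, (rule has_derivative_exp_linear derivative_intros has_derivative_Pair numeral_neq_zero)+)
    apply (auto simp: zero_prod_def fun_eq_iff)
    done
  show "c 0 = (gl_one, 0)" by (simp add: c_def)
  fix p assume p: "p \<in> gen_iia U"
  obtain z \<rho> \<zeta>t \<zeta> \<sigma> where q: "p = (z, \<rho>, \<zeta>t, \<zeta>, \<sigma>)" by (metis prod.exhaust)
  have opt: "(\<chi> i. case i of None \<Rightarrow> x * \<zeta> $ None | Some a \<Rightarrow> x' * \<zeta> $ Some a) = opt (x * \<zeta> $ None) (x' *\<^sub>R tail \<zeta>)"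
    for x x' and \<zeta> :: "real^('n option)"
    by (auto simp: vec_eq_iff opt_def split: option.splits)
  have "((\<lambda>s. L1_dilation (exp s) p) has_vector_derivative D1_raw p) (at 0)"
    unfolding L1_dilation_def q prod.case pw opt has_vector_derivative_def
    apply (rule has_derivative_eq_rhs, (rule has_derivative_exp_linear derivative_intros has_derivative_Pair numeral_neq_zero)+)
    apply (auto simp: zero_prod_def fun_eq_iff D1_raw_def opt_cong eq_commute[of "opt _ _"] tail_simps)
    done
  then show "((\<lambda>s. actA k (c s) p) has_vector_derivative D1_raw p) (at 0)"
    unfolding c_def using L1_dilation_actA[OF exp_gt_zero p] by simp
qed

lemma fund_Xh: "fund ((1, 0, 0, -1), 0) = vf_on (gen_iia U) Xh_raw"
proof -
  have "fund ((1/2, 0, 0, 0), 0) = vf_on (gen_iia U) (L2_raw 1 0 0 0)"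
    using fund_L2[of 1 0 0 0] by (simp add: zero_prod_def tail_simps)
  moreover have "((1, 0, 0, -1), 0) = ((1/2, 0, 0, 0), 0) - ((-1/2, 0, 0, 1) :: gl, 0 :: 'n nil)"
    by simp
  ultimately have "fund ((1, 0, 0, -1), 0) = vf_on (gen_iia U) (L2_raw 1 0 0 0) - vf_on (gen_iia U) D1_raw"
    using linear_diff[OF linear_fund] fund_D1 by metis
  then show ?thesis
    by (auto simp: vf_on_def fun_eq_iff Xh_raw_def L2_raw_def D1_raw_def opt_cong eq_commute[of "opt _ _"] tail_simps
        scaleR_left_distrib[symmetric])
qed

lemma fund_Xf: "fund ((0, 0, 1, 0), 0) = vf_on (gen_iia U) (Xf_raw k)"
proof (rule fund_eqI)
  define f :: "real \<Rightarrow> gl \<times> 'n nil" where "f s = ((1, 0, s, 1), 0)" for s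
  show "(f has_vector_derivative ((0, 0, 1, 0), 0)) (at 0)"
    unfolding f_def has_vector_derivative_def
    apply (rule has_derivative_eq_rhs, (rule has_derivative_exp_linear derivative_intros has_derivative_Pair numeral_neq_zero)+)
    apply (auto simp: zero_prod_def fun_eq_iff)
    done
  show "f 0 = (gl_one, 0)" by (simp add: f_def)
  fix p assume p: "p \<in> gen_iia U"
  obtain t \<tau> c b l \<psi> \<omega> where y: "p = to_iia k ((t, \<tau>), (c, b, l, \<psi>, \<omega>))" "t \<in> U" "0 < Im \<tau>"
    "((t, \<tau>), (c, b, l, \<psi>, \<omega>)) \<in> gen_tb U"
    using iia_cases[OF p] by metis
  let ?y = "((t, \<tau>), (c, b, l, \<psi>, \<omega>))"
  let ?v = "((Re \<tau> *\<^sub>R t, - \<tau>\<^sup>2), (0, c, 0, 0, \<psi>))"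
  have a: "actC k (f s) ?y = ((sqrt ((s * Re \<tau> + 1)\<^sup>2 + (s * Im \<tau>)\<^sup>2) *\<^sub>R t, \<tau> / (of_real s * \<tau> + 1)), (c, s *\<^sub>R c + b, l, \<psi>, s * \<psi> + \<omega>))" for s
    by (simp add: f_def actC_def mob_def gl_nil_def cmod_def)
  have "((\<lambda>s. \<tau> / (of_real s * \<tau> + 1)) has_vector_derivative - \<tau>\<^sup>2) (at 0)"
  proof -
    have "((\<lambda>s. \<tau> / (s * \<tau> + 1)) has_field_derivative - \<tau>\<^sup>2) (at (of_real 0))"
      by (auto intro!: derivative_eq_intros simp: power2_eq_square)
    then show ?thesis
      using has_vector_derivative_real_field by fastforce
  qed
  then have m: "((\<lambda>s. \<tau> / (of_real s * \<tau> + 1)) has_derivative (\<lambda>s. s *\<^sub>R (- \<tau>\<^sup>2))) (at 0)"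
    by (simp add: has_vector_derivative_def)
  have n: "((\<lambda>s. sqrt ((s * Re \<tau> + 1)\<^sup>2 + (s * Im \<tau>)\<^sup>2)) has_derivative (\<lambda>s. s * Re \<tau>)) (at 0)"
    by (auto intro!: derivative_eq_intros simp: fun_eq_iff)
  have "((\<lambda>s. actC k (f s) ?y) has_derivative (\<lambda>s. s *\<^sub>R ?v)) (at 0)"
    unfolding a
    apply (rule has_derivative_eq_rhs, (rule m n derivative_intros has_derivative_Pair numeral_neq_zero)+)
    apply (auto simp: zero_prod_def fun_eq_iff)
    done
  moreover have "(to_iia k has_derivative d_to_iia k ?y) (at (actC k (f 0) ?y))"
    using has_derivative_to_iia[of ?y] by (simp add: a)
  ultimately have "((\<lambda>s. actA k (f s) p) has_derivative (\<lambda>s. d_to_iia k ?y (s *\<^sub>R ?v))) (at 0)"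
    using has_derivative_compose unfolding y(1) actA_to[OF y(4)] by blast
  then have "((\<lambda>s. actA k (f s) p) has_vector_derivative d_to_iia k ?y ?v) (at 0)"
    using linear_scale[OF has_derivative_linear[OF has_derivative_to_iia[of ?y]], of _ ?v]
    by (simp add: has_vector_derivative_def)
  moreover have "d_to_iia k ?y ?v = Xf_raw k p"
    using U_pos[OF y(2)] y(3)
    by (simp add: y(1) d_to_iia_def Xf_raw_def to_iia_def Let_def K_simps K3_commute K2_commute opt_cong eq_commute[of "opt _ _"] tail_simps
        numeral_mult_vec power2_eq_square algebra_simps add_divide_distrib diff_divide_distrib inner_commute)
  ultimately show "((\<lambda>s. actA k (f s) p) has_vector_derivative Xf_raw k p) (at 0)"
    by simp
qed

lemma range_fund:
  "range fund = span ({D_field (gen_iia U), P_field (gen_iia U) None, vf_on (gen_iia U) (Xf_raw k), vf_on (gen_iia U) Xh_raw} \<union>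
     range (V_field k (gen_iia U)) \<union> range (\<lambda>a. P_field (gen_iia U) (Some a)) \<union> range (X_field (gen_iia U)) \<union> {Z_field (gen_iia U)})"
  (is "_ = span ?B")
proof -
  let ?N = "gen_iia U"
  have D: "D_field ?N = fund ((1/2, 0, 0, 0), 0)"
    unfolding fields_raw fund_L2[symmetric] by (simp add: zero_prod_def tail_simps)
  have P: "P_field ?N i = fund ((0, axis i 1 $ None, 0, 0), (- tail (axis i 1), 0, 0, 0, 0))" for i
    unfolding fields_raw fund_L2[symmetric] by (simp add: tail_simps)
  have P0: "P_field ?N None = fund ((0, 1, 0, 0), 0)"
    unfolding P by (simp add: axis_simps zero_prod_def)
  have Pa: "P_field ?N (Some a) = fund (0, (- axis a 1, 0, 0, 0, 0))" for a
    unfolding P by (simp add: axis_simps zero_prod_def)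
  have X: "X_field ?N i = fund (0, (0, 0, tail (axis i 1), 0, - axis i 1 $ None))" for i
    unfolding fields_raw fund_L2[symmetric] by (simp add: tail_simps zero_prod_def)
  have Z: "Z_field ?N = fund (0, (0, 0, 0, - 1 / 2, 0))"
    unfolding fields_raw fund_L2[symmetric] by (simp add: tail_simps zero_prod_def)
  have V: "V_field k ?N a = fund (0, (0, axis a 1, 0, 0, 0))" for a
    unfolding V_field_raw fund_V ..
  show ?thesis
  proof
    have "?B \<subseteq> range fund"
      unfolding fund_Xf[symmetric] fund_Xh[symmetric] D P0 Pa X Z V by auto
    then show "span ?B \<subseteq> range fund"
      by (intro span_minimal linear_subspace_image[OF linear_fund] subspace_UNIV) auto
    show "range fund \<subseteq> span ?B"
    proof clarify
      fix a b c d and \<gamma> \<beta> \<alpha> :: "real^'n" and \<theta> \<theta>' :: real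
      have lin: "linear (\<lambda>v. fund (0, (- v, 0, 0, 0, 0)))" "linear (\<lambda>v. fund (0, (0, v, 0, 0, 0)))"
        "linear (\<lambda>v. fund (0, (0, 0, v, 0, 0)))"
        using linear_compose[OF _ linear_fund, unfolded o_def]
        by (auto intro!: linearI simp: linear_add[OF linear_fund, symmetric] linear_scale[OF linear_fund, symmetric])
      have B: "D_field ?N \<in> span ?B" "P_field ?N None \<in> span ?B" "vf_on ?N (Xf_raw k) \<in> span ?B" "vf_on ?N Xh_raw \<in> span ?B"
        "V_field k ?N i \<in> span ?B" "P_field ?N (Some i) \<in> span ?B" "X_field ?N j \<in> span ?B" "Z_field ?N \<in> span ?B" for i j
        by (auto intro!: span_base)
      have B_P: "fund (0, (- axis i 1, 0, 0, 0, 0)) \<in> span ?B" and B_V: "fund (0, (0, axis i 1, 0, 0, 0)) \<in> span ?B" for i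
        using B(6)[of i] B(5)[of i] by (simp_all only: Pa V)
      have "((a, b, c, d), (\<gamma>, \<beta>, \<alpha>, \<theta>, \<theta>')) =
          (2 * (a + d)) *\<^sub>R ((1/2, 0, 0, 0), 0) + b *\<^sub>R ((0, 1, 0, 0), 0) + c *\<^sub>R ((0, 0, 1, 0), 0)
          + (- d) *\<^sub>R ((1, 0, 0, -1), 0) + (0, (- (- \<gamma>), 0, 0, 0, 0)) + (0, (0, \<beta>, 0, 0, 0)) + (0, (0, 0, \<alpha>, 0, 0))
          + (- 2 * \<theta>) *\<^sub>R (0, (0, 0, 0, - 1 / 2, 0)) + (- \<theta>') *\<^sub>R (0, (0, 0, tail (axis None 1), 0, - axis None 1 $ None))"
        by (simp add: zero_prod_def axis_simps add_divide_distrib)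
      note eq = arg_cong[OF this, of fund]
      have e1: "fund ((a, b, c, d), (\<gamma>, \<beta>, \<alpha>, \<theta>, \<theta>')) =
          (2 * (a + d)) *\<^sub>R D_field ?N + b *\<^sub>R P_field ?N None + c *\<^sub>R vf_on ?N (Xf_raw k) + (- d) *\<^sub>R vf_on ?N Xh_raw
          + fund (0, (- (- \<gamma>), 0, 0, 0, 0)) + fund (0, (0, \<beta>, 0, 0, 0)) + fund (0, (0, 0, \<alpha>, 0, 0))
          + (- 2 * \<theta>) *\<^sub>R Z_field ?N + (- \<theta>') *\<^sub>R X_field ?N None"
        unfolding D P0 X[of None] Z fund_Xf[symmetric] fund_Xh[symmetric]
        by (rule eq[unfolded linear_add[OF linear_fund] linear_scale[OF linear_fund]])
      have e2: "fund (0, (- (- \<gamma>), 0, 0, 0, 0)) \<in> span ?B"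
        by (subst linear_axis_expansion[OF lin(1)]) (intro span_sum span_scale B_P)
      have e3: "fund (0, (0, \<beta>, 0, 0, 0)) \<in> span ?B"
        by (subst linear_axis_expansion[OF lin(2)]) (intro span_sum span_scale B_V)
      have e4: "fund (0, (0, 0, \<alpha>, 0, 0)) \<in> span ?B"
      proof -
        have "fund (0, (0, 0, axis i 1, 0, 0)) \<in> span ?B" for i
          using B(7)[of "Some i"] unfolding X by (simp add: axis_simps)
        then show ?thesis
          by (subst linear_axis_expansion[OF lin(3)]) (intro span_sum span_scale)
      qed
      show "fund ((a, b, c, d), (\<gamma>, \<beta>, \<alpha>, \<theta>, \<theta>')) \<in> span ?B"
        unfolding e1 by (intro span_add span_scale B e2 e3 e4)
    qed
  qed
qed

end

section \<open>Brackets\<close>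

lemma vf_on_arith:
  "vf_on N X + vf_on N Y = vf_on N (\<lambda>p. X p + Y p)" "vf_on N X - vf_on N Y = vf_on N (\<lambda>p. X p - Y p)"
  "- vf_on N X = vf_on N (\<lambda>p. - X p)" "s *\<^sub>R vf_on N X = vf_on N (\<lambda>p. s *\<^sub>R X p)"
  "vf_on N (\<lambda>p. 0) = 0"
  for X Y :: "'a \<Rightarrow> 'b::real_vector"
  by (auto simp: vf_on_def fun_eq_iff scaleR_fun_def)

lemma vf_on_cong: "(\<And>p. p \<in> N \<Longrightarrow> X p = Y p) \<Longrightarrow> vf_on N X = vf_on N Y"
  by (auto simp: vf_on_def fun_eq_iff)

lemma vf_on_has_derivative:
  assumes "open N" "p \<in> N" "(X has_derivative X') (at p)"
  shows "(vf_on N X has_derivative X') (at p)"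
  by (rule has_derivative_transform_within_open[OF assms(3,1,2)]) (simp add: vf_on_def)

lemma lie_bracket_raw:
  assumes "open N" "\<And>p. p \<in> N \<Longrightarrow> (X has_derivative X' p) (at p)"
    "\<And>p. p \<in> N \<Longrightarrow> (Y has_derivative Y' p) (at p)"
  shows "lie_bracket N (vf_on N X) (vf_on N Y) = vf_on N (\<lambda>p. Y' p (X p) - X' p (Y p))"
proof -
  have "frechet_derivative (vf_on N X) (at p) = X' p" "frechet_derivative (vf_on N Y) (at p) = Y' p"
    if "p \<in> N" for p
    using frechet_derivative_at[OF vf_on_has_derivative[OF assms(1) that]] assms(2,3)[OF that] by metis+
  then show ?thesis
    unfolding lie_bracket_def by (intro vf_on_cong) (simp add: vf_on_def)
qed

lemma lie_bracket_antisym: "lie_bracket N X Y = - lie_bracket N Y X"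
  by (auto simp: lie_bracket_def vf_on_def fun_eq_iff)

lemma br_self: "lie_bracket N X X = 0"
  by (auto simp: lie_bracket_def vf_on_def fun_eq_iff)

definition vfield :: "'p::real_normed_vector set \<Rightarrow> ('p \<Rightarrow> 'p) \<Rightarrow> bool" where
  "vfield N X \<longleftrightarrow> (\<forall>p\<in>N. X differentiable (at p))"

lemma subspace_vfield: "subspace {X. vfield N X}"
  by (auto simp: subspace_def vfield_def zero_fun_def plus_fun_def scaleR_fun_def)

lemma lie_bracket_linear:
  assumes "vfield N X" "vfield N Y" "vfield N Z"
  shows "lie_bracket N (X + Y) Z = lie_bracket N X Z + lie_bracket N Y Z"
    "lie_bracket N Z (X + Y) = lie_bracket N Z X + lie_bracket N Z Y"
    "lie_bracket N (s *\<^sub>R X) Z = s *\<^sub>R lie_bracket N X Z"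
    "lie_bracket N Z (s *\<^sub>R X) = s *\<^sub>R lie_bracket N Z X"
proof -
  have D: "(X has_derivative frechet_derivative X (at p)) (at p)" "(Y has_derivative frechet_derivative Y (at p)) (at p)"
    "(Z has_derivative frechet_derivative Z (at p)) (at p)" if "p \<in> N" for p
    using assms that by (auto simp: vfield_def frechet_derivative_works)
  have plus: "frechet_derivative (X + Y) (at p) = (\<lambda>v. frechet_derivative X (at p) v + frechet_derivative Y (at p) v)"
    if "p \<in> N" for p
    unfolding plus_fun_def using frechet_derivative_at[OF has_derivative_add[OF D(1,2)[OF that]]] by simp
  have scale: "frechet_derivative (s *\<^sub>R X) (at p) = (\<lambda>v. s *\<^sub>R frechet_derivative X (at p) v)" if "p \<in> N" for p
    unfolding scaleR_fun_def using frechet_derivative_at[OF has_derivative_scaleR_right[OF D(1)[OF that]]] by simp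
  have lin: "linear (frechet_derivative Z (at p))" if "p \<in> N" for p
    using has_derivative_linear[OF D(3)[OF that]] .
  show l1: "lie_bracket N (X + Y) Z = lie_bracket N X Z + lie_bracket N Y Z"
    unfolding lie_bracket_def vf_on_arith
    by (rule vf_on_cong) (simp add: plus linear_add[OF lin])
  show l2: "lie_bracket N (s *\<^sub>R X) Z = s *\<^sub>R lie_bracket N X Z"
    unfolding lie_bracket_def vf_on_arith
  proof (rule vf_on_cong)
    show "frechet_derivative Z (at p) ((s *\<^sub>R X) p) - frechet_derivative (s *\<^sub>R X) (at p) (Z p)
        = s *\<^sub>R (frechet_derivative Z (at p) (X p) - frechet_derivative X (at p) (Z p))" if p: "p \<in> N" for p
      unfolding scale[OF p] unfolding scaleR_fun_def linear_scale[OF lin[OF p]] by (rule scaleR_diff_right[symmetric])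
  qed
  show "lie_bracket N Z (X + Y) = lie_bracket N Z X + lie_bracket N Z Y"
    using l1 by (simp add: lie_bracket_antisym[of N Z])
  show "lie_bracket N Z (s *\<^sub>R X) = s *\<^sub>R lie_bracket N Z X"
    using l2 by (simp add: lie_bracket_antisym[of N Z])
qed

lemma lie_bracket_zero: "lie_bracket N 0 Z = 0" "lie_bracket N Z 0 = 0" if "vfield N Z"
proof -
  have v0: "vfield N 0" using subspace_0[OF subspace_vfield[of N]] by simp
  show "lie_bracket N 0 Z = 0" using lie_bracket_linear(3)[OF v0 v0 that, of 0] by simp
  show "lie_bracket N Z 0 = 0" using lie_bracket_linear(4)[OF v0 v0 that, of 0] by simp
qed

lemma lie_bracket_span:
  assumes "\<And>X. X \<in> A \<Longrightarrow> vfield N X" "\<And>Y. Y \<in> B \<Longrightarrow> vfield N Y" "subspace S"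
    and AB: "\<And>X Y. X \<in> A \<Longrightarrow> Y \<in> B \<Longrightarrow> lie_bracket N X Y \<in> S"
    and "X \<in> span A" "Y \<in> span B"
  shows "lie_bracket N X Y \<in> S"
proof -
  have vA: "vfield N X" if "X \<in> span A" for X
    using span_minimal[OF _ subspace_vfield[of N], of A] assms(1) that by blast
  have vB: "vfield N X" if "X \<in> span B" for X
    using span_minimal[OF _ subspace_vfield[of N], of B] assms(2) that by blast
  have 1: "lie_bracket N X Y \<in> S" if X: "X \<in> A" and Y: "Y \<in> span B" for X Y
  proof -
    have "Y \<in> span B \<and> lie_bracket N X Y \<in> S"
      using Y
    proof (induction rule: span_induct_alt)
      case base
      show ?case
        using lie_bracket_zero(2)[OF assms(1)[OF X]] subspace_0[OF assms(3)] span_0[of B] by metis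
    next
      case (step c Y' Y)
      have eq: "lie_bracket N X (c *\<^sub>R Y' + Y) = c *\<^sub>R lie_bracket N X Y' + lie_bracket N X Y"
        using lie_bracket_linear vA[OF span_base[OF X]] vB[OF span_base[OF step(1)]] vB[of Y] step
          vB[OF span_scale[OF span_base[OF step(1)]], of c] by (metis (no_types, lifting))
      have "c *\<^sub>R lie_bracket N X Y' + lie_bracket N X Y \<in> S"
        using step by (intro subspace_add[OF assms(3)] subspace_scale[OF assms(3)] AB[OF X step(1)]) auto
      moreover have "c *\<^sub>R Y' + Y \<in> span B"
        by (rule span_add[OF span_scale[OF span_base[OF step(1)]] step(2)[THEN conjunct1]])
      ultimately show ?case
        unfolding eq by blast
    qed
    then show ?thesis by simp
  qed
  have "X \<in> span A \<and> lie_bracket N X Y \<in> S"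
    using assms(5)
  proof (induction rule: span_induct_alt)
    case base
    show ?case
      using lie_bracket_zero(1)[OF vB[OF assms(6)]] subspace_0[OF assms(3)] span_0[of A] by metis
  next
    case (step c X' X)
    have eq: "lie_bracket N (c *\<^sub>R X' + X) Y = c *\<^sub>R lie_bracket N X' Y + lie_bracket N X Y"
      using lie_bracket_linear vB[OF assms(6)] vA[OF span_base[OF step(1)]] vA[of X] step
        vA[OF span_scale[OF span_base[OF step(1)]], of c] by (metis (no_types, lifting))
    have "c *\<^sub>R lie_bracket N X' Y + lie_bracket N X Y \<in> S"
      using step by (intro subspace_add[OF assms(3)] subspace_scale[OF assms(3)] 1[OF step(1) assms(6)]) auto
    moreover have "c *\<^sub>R X' + X \<in> span A"
      by (rule span_add[OF span_scale[OF span_base[OF step(1)]] step(2)[THEN conjunct1]])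
    ultimately show ?case
      unfolding eq by blast
  qed
  then show ?thesis by simp
qed

lemma inner_opt: "opt x v \<bullet> \<xi> = x * \<xi> $ None + v \<bullet> tail \<xi>" "\<xi> \<bullet> opt x v = x * \<xi> $ None + v \<bullet> tail \<xi>"
  using inner_option[of "opt x v" \<xi>] inner_option[of \<xi> "opt x v"]
  by (simp_all add: inner_vec_def mult.commute)

lemma re_im_vec_minus:
  "re_vec (- z) = - re_vec z" "im_vec (- z) = - im_vec z"
  "re_vec (z - w) = re_vec z - re_vec w" "im_vec (z - w) = im_vec z - im_vec w"
  by (auto simp: re_vec_def im_vec_def vec_eq_iff)

lemma option_vec_expand:
  fixes \<xi> \<eta> :: "real^('n::finite option)"
  shows "\<xi> = \<eta> \<longleftrightarrow> \<xi> $ None = \<eta> $ None \<and> tail \<xi> = tail \<eta>"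
    "\<xi> \<bullet> \<eta> = \<xi> $ None * \<eta> $ None + tail \<xi> \<bullet> tail \<eta>"
proof -
  show "\<xi> = \<eta> \<longleftrightarrow> \<xi> $ None = \<eta> $ None \<and> tail \<xi> = tail \<eta>"
    using opt_cong[of \<xi> "\<eta> $ None" "tail \<eta>"] by simp
  show "\<xi> \<bullet> \<eta> = \<xi> $ None * \<eta> $ None + tail \<xi> \<bullet> tail \<eta>"
    using inner_opt(1)[of "\<xi> $ None" "tail \<xi>" \<eta>] by simp
qed

lemma opt_zero: "opt 0 0 = 0"
  by (simp add: option_vec_expand tail_simps)

lemma complex_vec_expand: "z = w \<longleftrightarrow> re_vec z = re_vec w \<and> im_vec z = im_vec w"
  using cvec_eq_iff[of z "re_vec w" "im_vec w"] by simp

lemma mult_numeral_vec: "v * numeral w = (numeral w :: real) *\<^sub>R v" for v :: "real^'n"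
  by (simp add: vec_eq_iff)

lemmas coordinate_simps = re_im_vec_simps re_im_vec_minus option_vec_expand complex_vec_expand tail_simps

lemma semidirect_spanI:
  assumes A: "\<And>X. X \<in> A \<Longrightarrow> vfield N X" and B: "\<And>X. X \<in> B \<Longrightarrow> vfield N X"
    and AA: "\<And>X Y. X \<in> A \<Longrightarrow> Y \<in> A \<Longrightarrow> lie_bracket N X Y \<in> span A"
    and AB: "\<And>X Y. X \<in> A \<Longrightarrow> Y \<in> B \<Longrightarrow> lie_bracket N X Y \<in> span B"
    and BB: "\<And>X Y. X \<in> B \<Longrightarrow> Y \<in> B \<Longrightarrow> lie_bracket N X Y \<in> span B"
    and disj: "\<And>X. X \<in> span A \<Longrightarrow> X \<in> span B \<Longrightarrow> X = 0"
  shows "semidirect_sum N (span (A \<union> B)) (span A) (span B)"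
  unfolding semidirect_sum_def lie_subalgebra_def
proof (intro conjI ballI)
  fix X Y
  show "lie_bracket N X Y \<in> span A" if "X \<in> span A" "Y \<in> span A"
    using lie_bracket_span[OF A A subspace_span AA that] .
  show "lie_bracket N X Y \<in> span B" if "X \<in> span B" "Y \<in> span B"
    using lie_bracket_span[OF B B subspace_span BB that] .
  show "lie_bracket N X Y \<in> span B" if "X \<in> span (A \<union> B)" "Y \<in> span B"
    by (rule lie_bracket_span[OF _ B subspace_span _ that]) (use A B AB BB in auto)
qed (use disj in \<open>auto simp: span_Un span_0\<close>)

definition d_L2_raw :: "real \<Rightarrow> real^('n option) \<Rightarrow> real^('n option) \<Rightarrow> 'n::finite iia \<Rightarrow> 'n iia" where
  "d_L2_raw r \<eta>t \<eta> = (\<lambda>(z, \<rho>, \<zeta>t, \<zeta>, \<sigma>).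
     (0, r * \<rho>, (r / 2) *\<^sub>R \<zeta>t, (r / 2) *\<^sub>R \<zeta>, r * \<sigma> + \<eta> \<bullet> \<zeta>t - \<eta>t \<bullet> \<zeta>))"

definition d_V_raw :: "('n::finite \<Rightarrow> 'n \<Rightarrow> 'n \<Rightarrow> real) \<Rightarrow> real^'n \<Rightarrow> 'n iia \<Rightarrow> 'n iia" where
  "d_V_raw k v = (\<lambda>(z, \<rho>, \<zeta>t, \<zeta>, \<sigma>).
     (0, 0, opt (- (tail \<zeta>t \<bullet> v)) (- K2 k v (tail \<zeta>)), opt 0 (\<zeta> $ None *\<^sub>R v), 0))"

definition d_Xf_raw :: "('n::finite \<Rightarrow> 'n \<Rightarrow> 'n \<Rightarrow> real) \<Rightarrow> 'n iia \<Rightarrow> 'n iia \<Rightarrow> 'n iia" where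
  "d_Xf_raw k = (\<lambda>(z, \<rho>, \<zeta>t, \<zeta>, \<sigma>) (dz, d\<rho>, d\<zeta>t, d\<zeta>, d\<sigma>).
    let b = re_vec z; t = im_vec z; x = \<zeta> $ None; y = tail \<zeta>; \<xi> = tail \<zeta>t; \<xi>0 = \<zeta>t $ None;
      db = re_vec dz; dt = im_vec dz; dx = d\<zeta> $ None; dy = tail d\<zeta>; d\<xi> = tail d\<zeta>t; d\<xi>0 = d\<zeta>t $ None;
      h = K3 k t t t; S = 12 * \<rho> / h; dS = 12 * d\<rho> / h - 36 * \<rho> * K3 k t t dt / h\<^sup>2 in
    (cvec (dx *\<^sub>R b + x *\<^sub>R db - dy) (dx *\<^sub>R t + x *\<^sub>R dt), - dx * \<rho> - x * d\<rho>,
     opt ((d\<sigma> + dx * \<xi>0 + x * d\<xi>0 + d\<xi> \<bullet> y + \<xi> \<bullet> dy) / 2 + (dS * K3 k b b b + 3 * S * K3 k b b db) / 6)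
       (K2 k y dy - (dS / 2) *\<^sub>R K2 k b b - S *\<^sub>R K2 k b db),
     opt (dS - 2 * x * dx) (dS *\<^sub>R b + S *\<^sub>R db - dx *\<^sub>R y - x *\<^sub>R dy),
     (dx * (x * \<xi>0 + \<xi> \<bullet> y - \<sigma>) + x * (dx * \<xi>0 + x * d\<xi>0 + d\<xi> \<bullet> y + \<xi> \<bullet> dy - d\<sigma>)) / 2
       - dS * (\<xi>0 + \<xi> \<bullet> b) - S * (d\<xi>0 + d\<xi> \<bullet> b + \<xi> \<bullet> db)
       - (dS * K3 k b b y + 2 * S * K3 k b db y + S * K3 k b b dy) / 2
       + (dx * S * K3 k b b b + x * dS * K3 k b b b + 3 * x * S * K3 k b b db) / 6 + K3 k y y dy / 2))"

lemma has_derivative_vec_nth' [derivative_intros]: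
  "(f has_derivative f') F \<Longrightarrow> ((\<lambda>x. f x $ i) has_derivative (\<lambda>v. f' v $ i)) F"
  by (rule bounded_linear.has_derivative[OF bounded_linear_vec_nth])

lemma has_derivative_L2_raw: "(L2_raw r \<eta>t \<eta> \<kappa> has_derivative d_L2_raw r \<eta>t \<eta>) (at p)"
  unfolding L2_raw_def split_beta
  apply (rule has_derivative_eq_rhs, (rule derivative_intros has_derivative_Pair numeral_neq_zero)+)
  apply (auto simp: d_L2_raw_def fun_eq_iff)
  done

lemma has_derivative_Xh_raw: "(Xh_raw has_derivative Xh_raw) (at p)"
  unfolding Xh_raw_def split_beta
  apply (rule has_derivative_eq_rhs, (rule derivative_intros has_derivative_Pair numeral_neq_zero)+)
  apply (auto simp: fun_eq_iff)
  done

lemma has_derivative_V_raw: "(V_raw k v has_derivative d_V_raw k v) (at p)"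
  unfolding V_raw_def split_beta
  apply (rule has_derivative_eq_rhs, (rule derivative_intros has_derivative_Pair numeral_neq_zero)+)
  apply (auto simp: d_V_raw_def fun_eq_iff K2_simps coordinate_simps)
  done

context psr_cone
begin

lemma has_derivative_Xf_raw: "(Xf_raw k has_derivative d_Xf_raw k p) (at p)" if "p \<in> gen_iia U"
proof -
  have n: "K3 k (im_vec (fst p)) (im_vec (fst p)) (im_vec (fst p)) \<noteq> 0"
    using that U_pos by (fastforce simp: gen_iia_def)
  define S :: "'n iia \<Rightarrow> real" where
    "S p = 12 * fst (snd p) / K3 k (im_vec (fst p)) (im_vec (fst p)) (im_vec (fst p))" for p
  define dS :: "'n iia \<Rightarrow> real" where
    "dS v = 12 * fst (snd v) / K3 k (im_vec (fst p)) (im_vec (fst p)) (im_vec (fst p))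
      - 36 * fst (snd p) * K3 k (im_vec (fst p)) (im_vec (fst p)) (im_vec (fst v))
        / (K3 k (im_vec (fst p)) (im_vec (fst p)) (im_vec (fst p)))\<^sup>2" for v
  have S: "(S has_derivative dS) (at p)"
    unfolding S_def
    apply (rule has_derivative_eq_rhs, (rule derivative_intros n)+)
    using n
    apply (simp add: dS_def[abs_def] fun_eq_iff K_simps K3_commute divide_simps power2_eq_square)
    done
  show ?thesis
    unfolding Xf_raw_def split_beta Let_def S_def[symmetric]
    apply (rule has_derivative_eq_rhs, (rule S derivative_intros has_derivative_Pair numeral_neq_zero)+)
    apply (rule ext)
    apply (unfold d_Xf_raw_def split_beta Let_def dS_def[symmetric] S_def[symmetric])
    apply (simp add: K_simps K3_commute K2_commute opt_cong eq_commute[of "opt _ _"] tail_simps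
        numeral_mult_vec mult_numeral_vec power2_eq_square algebra_simps add_divide_distrib diff_divide_distrib inner_commute)
    done
qed

abbreviation "NN \<equiv> gen_iia U"
abbreviation "F r \<eta>t \<eta> \<kappa> \<equiv> vf_on NN (L2_raw r \<eta>t \<eta> \<kappa>)"
abbreviation "FV v \<equiv> vf_on NN (V_raw k v)"
abbreviation "FXf \<equiv> vf_on NN (Xf_raw k)"
abbreviation "FXh \<equiv> vf_on NN Xh_raw"

lemmas bracket_rule = lie_bracket_raw[OF open_gen_iia]

lemma br_L2_L2: "lie_bracket NN (F r \<eta>t \<eta> \<kappa>) (F r' \<eta>t' \<eta>' \<kappa>')
    = F 0 ((r' / 2) *\<^sub>R \<eta>t - (r / 2) *\<^sub>R \<eta>t') ((r' / 2) *\<^sub>R \<eta> - (r / 2) *\<^sub>R \<eta>')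
        (r' * \<kappa> - r * \<kappa>' + 2 * (\<eta>' \<bullet> \<eta>t - \<eta> \<bullet> \<eta>t'))"
  apply (subst bracket_rule[OF has_derivative_L2_raw has_derivative_L2_raw])
  apply (rule vf_on_cong)
  apply (simp add: L2_raw_def d_L2_raw_def split_beta inner_simps inner_commute algebra_simps)
  done

lemma br_V_L2: "lie_bracket NN (FV v) (F r \<eta>t \<eta> \<kappa>)
    = F 0 (opt (tail \<eta>t \<bullet> v) (K2 k v (tail \<eta>))) (opt 0 (- (\<eta> $ None) *\<^sub>R v)) 0"
  apply (subst bracket_rule[OF has_derivative_V_raw has_derivative_L2_raw])
  apply (rule vf_on_cong)
  apply (simp add: L2_raw_def d_L2_raw_def V_raw_def d_V_raw_def split_beta K_simps K3_commute K2_commute coordinate_simps zero_prod_def inner_commute algebra_simps)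
  done

lemma br_V_V: "lie_bracket NN (FV v) (FV w) = 0"
  apply (subst bracket_rule[OF has_derivative_V_raw has_derivative_V_raw])
  apply (subst vf_on_arith(5)[symmetric])
  apply (rule vf_on_cong)
  apply (simp add: V_raw_def d_V_raw_def split_beta K_simps K2_commute K3_commute inner_commute zero_prod_def coordinate_simps)
  done

lemma br_Xh_L2: "lie_bracket NN FXh (F r \<eta>t \<eta> \<kappa>) = F 0 (opt (\<eta>t $ None) 0) (opt (- 2 * \<eta> $ None) (- tail \<eta>)) (- \<kappa>)"
  apply (subst bracket_rule[OF has_derivative_Xh_raw has_derivative_L2_raw])
  apply (rule vf_on_cong)
  apply (simp add: L2_raw_def d_L2_raw_def Xh_raw_def split_beta coordinate_simps zero_prod_def inner_commute algebra_simps)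
  done

lemma br_Xh_V: "lie_bracket NN FXh (FV v) = FV v"
  apply (subst bracket_rule[OF has_derivative_Xh_raw has_derivative_V_raw])
  apply (rule vf_on_cong)
  apply (simp add: V_raw_def d_V_raw_def Xh_raw_def split_beta K_simps coordinate_simps zero_prod_def inner_commute mult_numeral_vec numeral_mult_vec algebra_simps)
  done

lemma br_Xf_L2: "lie_bracket NN FXf (F r \<eta>t \<eta> \<kappa>)
    = vf_on NN (\<lambda>p. (- r / 2) *\<^sub>R Xf_raw k p + (\<eta> $ None) *\<^sub>R Xh_raw p + V_raw k (tail \<eta>) p
        + L2_raw 0 (opt (- \<kappa> / 2) 0) 0 0 p)"
  apply (subst bracket_rule[OF has_derivative_Xf_raw has_derivative_L2_raw], assumption)
  apply (rule vf_on_cong)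
  apply (simp add: L2_raw_def d_L2_raw_def V_raw_def Xf_raw_def d_Xf_raw_def Xh_raw_def split_beta Let_def K_simps K3_commute K2_commute coordinate_simps zero_prod_def inner_commute
     numeral_mult_vec mult_numeral_vec power2_eq_square algebra_simps add_divide_distrib diff_divide_distrib)
  done

lemma br_Xf_V: "lie_bracket NN FXf (FV v) = 0"
  apply (subst bracket_rule[OF has_derivative_Xf_raw has_derivative_V_raw], assumption)
  apply (subst vf_on_arith(5)[symmetric])
  apply (rule vf_on_cong)
  apply (simp add: V_raw_def d_V_raw_def Xf_raw_def d_Xf_raw_def split_beta Let_def K_simps K3_commute K2_commute coordinate_simps zero_prod_def inner_commute
     numeral_mult_vec mult_numeral_vec power2_eq_square algebra_simps add_divide_distrib diff_divide_distrib)
  done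

lemma br_Xh_Xf: "lie_bracket NN FXh FXf = 2 *\<^sub>R FXf"
  apply (subst bracket_rule[OF has_derivative_Xh_raw has_derivative_Xf_raw], assumption)
  apply (subst vf_on_arith)
  apply (rule vf_on_cong)
  subgoal premises p for p
  proof -
    have "0 < K3 k (im_vec (fst p)) (im_vec (fst p)) (im_vec (fst p))"
      using p U_pos by (auto simp: gen_iia_def)
    then show ?thesis
  apply (simp add: Xh_raw_def Xf_raw_def d_Xf_raw_def split_beta Let_def K_simps K3_commute K2_commute coordinate_simps zero_prod_def inner_commute
     numeral_mult_vec mult_numeral_vec power2_eq_square algebra_simps add_divide_distrib diff_divide_distrib)
  apply (simp add: scaleR_left_distrib[symmetric] add_divide_distrib[symmetric] distrib_left[symmetric])
  done
  qed
  done

lemma br_Xf_L2': "lie_bracket NN FXf (F r \<eta>t \<eta> \<kappa>)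
    = (- r / 2) *\<^sub>R FXf + (\<eta> $ None) *\<^sub>R FXh + FV (tail \<eta>) + F 0 (opt (- \<kappa> / 2) 0) 0 0"
  unfolding br_Xf_L2 vf_on_arith ..

lemma F_arith:
  "F r \<eta>t \<eta> \<kappa> + F r' \<eta>t' \<eta>' \<kappa>' = F (r + r') (\<eta>t + \<eta>t') (\<eta> + \<eta>') (\<kappa> + \<kappa>')"
  "s *\<^sub>R F r \<eta>t \<eta> \<kappa> = F (s * r) (s *\<^sub>R \<eta>t) (s *\<^sub>R \<eta>) (s * \<kappa>)"
  "FV v + FV w = FV (v + w)" "s *\<^sub>R FV v = FV (s *\<^sub>R v)" "F 0 0 0 0 = 0" "FV 0 = 0"
proof -
  show "F r \<eta>t \<eta> \<kappa> + F r' \<eta>t' \<eta>' \<kappa>' = F (r + r') (\<eta>t + \<eta>t') (\<eta> + \<eta>') (\<kappa> + \<kappa>')"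
    unfolding vf_on_arith
    by (rule vf_on_cong) (simp add: L2_raw_def split_beta inner_simps algebra_simps add_divide_distrib)
  show "s *\<^sub>R F r \<eta>t \<eta> \<kappa> = F (s * r) (s *\<^sub>R \<eta>t) (s *\<^sub>R \<eta>) (s * \<kappa>)"
    unfolding vf_on_arith
    by (rule vf_on_cong) (simp add: L2_raw_def split_beta inner_simps algebra_simps)
  show "FV v + FV w = FV (v + w)" unfolding vf_on_arith
    by (rule vf_on_cong) (simp add: V_raw_def split_beta coordinate_simps K_simps algebra_simps)
  show "s *\<^sub>R FV v = FV (s *\<^sub>R v)" unfolding vf_on_arith
    by (rule vf_on_cong) (simp add: V_raw_def split_beta coordinate_simps K_simps algebra_simps)
  show "F 0 0 0 0 = 0" "FV 0 = 0"
    by (auto simp: vf_on_def fun_eq_iff L2_raw_def V_raw_def coordinate_simps K_simps zero_prod_def)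
qed

lemma vfield_gens: "vfield NN (F r \<eta>t \<eta> \<kappa>)" "vfield NN (FV v)" "vfield NN FXf" "vfield NN FXh"
  unfolding vfield_def differentiable_def
  using vf_on_has_derivative[OF open_gen_iia] has_derivative_L2_raw has_derivative_V_raw
    has_derivative_Xf_raw has_derivative_Xh_raw by blast+

definition "hs = {F 0 \<eta>t \<eta> \<kappa> | \<eta>t \<eta> \<kappa>. \<eta> $ None = 0}"
definition "vs = range (\<lambda>v. FV v)"
definition "ls = {F 0 \<eta>t \<eta> \<kappa> | \<eta>t \<eta> \<kappa>. True}"

lemma hsI: "\<eta> $ None = 0 \<Longrightarrow> F 0 \<eta>t \<eta> \<kappa> \<in> hs"
  by (auto simp: hs_def)

lemma subspace_hs: "subspace hs"
  unfolding subspace_def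
proof (intro conjI ballI allI)
  show "0 \<in> hs" using hsI[of 0 0 0] F_arith(5) by simp
next
  fix X Y assume "X \<in> hs" "Y \<in> hs"
  then obtain \<eta>t \<eta> \<kappa> \<eta>t' \<eta>' \<kappa>' where *: "X = F 0 \<eta>t \<eta> \<kappa>" "\<eta> $ None = 0" "Y = F 0 \<eta>t' \<eta>' \<kappa>'" "\<eta>' $ None = 0"
    unfolding hs_def by blast
  then have "X + Y = F 0 (\<eta>t + \<eta>t') (\<eta> + \<eta>') (\<kappa> + \<kappa>')" by (simp only: F_arith) simp
  then show "X + Y \<in> hs" using * by (simp only:) (rule hsI, simp)
next
  fix c X assume "X \<in> hs"
  then obtain \<eta>t \<eta> \<kappa> where *: "X = F 0 \<eta>t \<eta> \<kappa>" "\<eta> $ None = 0"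
    unfolding hs_def by blast
  then have "c *\<^sub>R X = F 0 (c *\<^sub>R \<eta>t) (c *\<^sub>R \<eta>) (c * \<kappa>)" by (simp only: F_arith) simp
  then show "c *\<^sub>R X \<in> hs" using * by (simp only:) (rule hsI, simp)
qed

lemma linear_FV: "linear (\<lambda>v. FV v)"
  by (rule linearI) (simp_all only: F_arith)

lemma span_vs: "span (range (V_field k NN)) = vs"
proof
  show "span (range (V_field k NN)) \<subseteq> vs"
    unfolding vs_def using linear_subspace_image[OF linear_FV subspace_UNIV]
    by (intro span_minimal) (auto simp: V_field_raw)
  show "vs \<subseteq> span (range (V_field k NN))"
    unfolding vs_def
  proof clarify
    show "FV v \<in> span (range (V_field k NN))" for v
      by (subst linear_axis_expansion[OF linear_FV], intro span_sum span_scale span_base)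
        (metis V_field_raw rangeI)
  qed
qed

lemma linear_F: "linear (\<lambda>v. F 0 (opt 0 v) 0 0)" "linear (\<lambda>v. F 0 0 (opt 0 v) 0)"
  by (rule linearI; simp add: F_arith; rule vf_on_cong; simp add: L2_raw_def split_beta coordinate_simps)+

lemma opt_axis: "opt 0 (axis a 1) = axis (Some a) 1"
  by (auto simp: option_vec_expand axis_simps)

lemma fields_F: "D_field NN = F 1 0 0 0" "P_field NN i = F 0 0 (axis i 1) 0" "X_field NN i = F 0 (axis i 1) 0 0"
  "Z_field NN = F 0 0 0 1" "V_field k NN a = FV (axis a 1)"
  by (rule fields_raw V_field_raw)+

lemma span_hs: "span ({Z_field NN} \<union> range (\<lambda>a. P_field NN (Some a)) \<union> range (X_field NN)) = hs" (is "span ?B = _")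
proof
  show "span ?B \<subseteq> hs"
    by (rule span_minimal[OF _ subspace_hs]) (auto simp: fields_F axis_simps intro!: hsI)
  have B: "Z_field NN \<in> span ?B" "P_field NN (Some a) \<in> span ?B" "X_field NN i \<in> span ?B" for a i
    by (auto intro!: span_base)
  show "hs \<subseteq> span ?B"
  proof
    fix X assume "X \<in> hs"
    then obtain \<eta>t \<eta> \<kappa> where *: "X = F 0 \<eta>t \<eta> \<kappa>" "\<eta> $ None = 0"
      unfolding hs_def by blast
    have "X = \<eta>t $ None *\<^sub>R X_field NN None + F 0 (opt 0 (tail \<eta>t)) 0 0 + F 0 0 (opt 0 (tail \<eta>)) 0 + \<kappa> *\<^sub>R Z_field NN"
      unfolding *(1) fields_F F_arith
      by (rule vf_on_cong) (simp add: *(2) L2_raw_def split_beta coordinate_simps axis_simps)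
    moreover have "F 0 (opt 0 (tail \<eta>t)) 0 0 \<in> span ?B"
      by (subst linear_axis_expansion[OF linear_F(1)]) (intro span_sum span_scale, simp only: opt_axis fields_F(3)[symmetric] B)
    moreover have "F 0 0 (opt 0 (tail \<eta>)) 0 \<in> span ?B"
      by (subst linear_axis_expansion[OF linear_F(2)]) (intro span_sum span_scale, simp only: opt_axis fields_F(2)[symmetric] B)
    ultimately show "X \<in> span ?B"
      by (simp only:) (intro span_add span_scale B; assumption)
  qed
qed

definition "ns = span (vs \<union> hs)"
definition "ms = span (insert FXf (insert FXh (vs \<union> ls)))"

lemma lsI: "F 0 \<eta>t \<eta> \<kappa> \<in> ls" by (auto simp: ls_def)

lemma hs_ls: "hs \<subseteq> ls" by (auto simp: hs_def ls_def)

lemma vsI: "FV v \<in> vs" by (auto simp: vs_def)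

lemma vfield_sets: "X \<in> vs \<Longrightarrow> vfield NN X" "X \<in> ls \<Longrightarrow> vfield NN X" "X \<in> hs \<Longrightarrow> vfield NN X"
  using vfield_gens by (auto simp: vs_def ls_def hs_def)

lemma ms_base: "FXf \<in> ms" "FXh \<in> ms" "X \<in> vs \<Longrightarrow> X \<in> ms" "X \<in> ls \<Longrightarrow> X \<in> ms"
  by (auto simp: ms_def intro: span_base)

lemma ns_base: "X \<in> vs \<Longrightarrow> X \<in> ns" "X \<in> hs \<Longrightarrow> X \<in> ns"
  by (auto simp: ns_def intro: span_base)

lemma subspaces: "subspace ms" "subspace ns" by (simp_all add: ms_def ns_def)

lemma br_L2_V: "lie_bracket NN (F r \<eta>t \<eta> \<kappa>) (FV v) = - F 0 (opt (tail \<eta>t \<bullet> v) (K2 k v (tail \<eta>))) (opt 0 (- (\<eta> $ None) *\<^sub>R v)) 0"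
  by (subst lie_bracket_antisym) (simp only: br_V_L2)

lemma set_elims:
  "X \<in> vs \<Longrightarrow> (\<And>v. X = FV v \<Longrightarrow> P) \<Longrightarrow> P"
  "X \<in> ls \<Longrightarrow> (\<And>\<eta>t \<eta> \<kappa>. X = F 0 \<eta>t \<eta> \<kappa> \<Longrightarrow> P) \<Longrightarrow> P"
  "X \<in> hs \<Longrightarrow> (\<And>\<eta>t \<eta> \<kappa>. X = F 0 \<eta>t \<eta> \<kappa> \<Longrightarrow> \<eta> $ None = 0 \<Longrightarrow> P) \<Longrightarrow> P"
  unfolding vs_def ls_def hs_def by blast+

lemma br_into_hs:
  "lie_bracket NN (FV v) (F 0 \<eta>t \<eta> \<kappa>) \<in> hs" "lie_bracket NN (F 0 \<eta>t \<eta> \<kappa>) (FV v) \<in> hs"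
  "lie_bracket NN (F 0 \<eta>t \<eta> \<kappa>) (F 0 \<eta>t' \<eta>' \<kappa>') \<in> hs"
proof -
  have h: "F 0 \<eta>t (opt 0 v) \<kappa> \<in> hs" for \<eta>t v \<kappa> by (rule hsI) simp
  show "lie_bracket NN (FV v) (F 0 \<eta>t \<eta> \<kappa>) \<in> hs" by (simp only: br_V_L2 h)
  show "lie_bracket NN (F 0 \<eta>t \<eta> \<kappa>) (FV v) \<in> hs" unfolding br_L2_V by (intro subspace_neg subspace_hs h)
  show "lie_bracket NN (F 0 \<eta>t \<eta> \<kappa>) (F 0 \<eta>t' \<eta>' \<kappa>') \<in> hs"
    unfolding br_L2_L2 by (rule hsI) simp
qed

lemma br_hs: "X \<in> vs \<union> hs \<Longrightarrow> Y \<in> hs \<Longrightarrow> lie_bracket NN X Y \<in> hs"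
  apply (elim UnE set_elims)
  apply (hypsubst, rule br_into_hs)+
  done

lemma br_ns: "X \<in> insert FXf (insert FXh (vs \<union> ls)) \<Longrightarrow> Y \<in> vs \<union> hs \<Longrightarrow> lie_bracket NN X Y \<in> ns"
proof -
  note h = br_into_hs[THEN ns_base(2)]
  have f: "lie_bracket NN FXf (F 0 \<eta>t \<eta> \<kappa>) \<in> ns" if "\<eta> $ None = 0" for \<eta>t \<eta> \<kappa>
  proof -
    have "lie_bracket NN FXf (F 0 \<eta>t \<eta> \<kappa>) = FV (tail \<eta>) + F 0 (opt (- \<kappa> / 2) 0) 0 0"
      by (simp add: that br_Xf_L2')
    also have "\<dots> \<in> ns" by (intro subspace_add subspaces ns_base(1) vsI ns_base(2) hsI) simp
    finally show ?thesis .
  qed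
  have f': "lie_bracket NN FXh (F 0 \<eta>t \<eta> \<kappa>) \<in> ns" if "\<eta> $ None = 0" for \<eta>t \<eta> \<kappa>
    unfolding br_Xh_L2 by (intro ns_base(2) hsI) (simp add: that)
  have v: "lie_bracket NN FXh (FV v) \<in> ns" "lie_bracket NN FXf (FV v) \<in> ns" "lie_bracket NN (FV w) (FV v) \<in> ns" for v w
    using ns_base(1)[OF vsI] subspace_0[OF subspaces(2)] by (simp_all only: br_Xh_V br_Xf_V br_V_V)
  assume "X \<in> insert FXf (insert FXh (vs \<union> ls))" "Y \<in> vs \<union> hs"
  then show ?thesis
    apply (elim UnE set_elims insertE)
    apply (hypsubst, (rule h f' f v; assumption?))+
    done
qed

lemma br_ms: "X \<in> insert (D_field NN) (insert FXf (insert FXh (vs \<union> ls))) \<Longrightarrow>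
    Y \<in> insert FXf (insert FXh (vs \<union> ls)) \<Longrightarrow> lie_bracket NN X Y \<in> ms"
proof -
  have l: "F 0 \<eta>t \<eta> \<kappa> \<in> ms" for \<eta>t \<eta> \<kappa> by (intro ms_base(4) lsI)
  note ms = subspace_neg[OF subspaces(1)] subspace_add[OF subspaces(1)] subspace_scale[OF subspaces(1)]
    ms_base(1,2) ms_base(3)[OF vsI] l subspace_0[OF subspaces(1)]
  have f: "lie_bracket NN FXf (F r \<eta>t \<eta> \<kappa>) \<in> ms" for r \<eta>t \<eta> \<kappa>
    unfolding br_Xf_L2' by (intro ms)
  have f': "lie_bracket NN (F r \<eta>t \<eta> \<kappa>) FXf \<in> ms" for r \<eta>t \<eta> \<kappa>
    using f by (subst lie_bracket_antisym) (intro ms)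
  have h: "lie_bracket NN FXh (F r \<eta>t \<eta> \<kappa>) \<in> ms" "lie_bracket NN (F r \<eta>t \<eta> \<kappa>) FXh \<in> ms" for r \<eta>t \<eta> \<kappa>
    unfolding br_Xh_L2 lie_bracket_antisym[of NN "F r \<eta>t \<eta> \<kappa>"] by (intro ms)+
  have v: "lie_bracket NN (FV v) (F r \<eta>t \<eta> \<kappa>) \<in> ms" "lie_bracket NN (F r \<eta>t \<eta> \<kappa>) (FV v) \<in> ms" for v r \<eta>t \<eta> \<kappa>
    unfolding br_V_L2 br_L2_V by (intro ms)+
  have "lie_bracket NN FXh FXf \<in> ms" "lie_bracket NN FXf FXh \<in> ms" "lie_bracket NN FXf (FV v) \<in> ms"
    "lie_bracket NN (FV v) FXf \<in> ms" "lie_bracket NN FXh (FV v) \<in> ms" "lie_bracket NN (FV v) FXh \<in> ms"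
    "lie_bracket NN (FV v) (FV w) \<in> ms" "lie_bracket NN (F r \<eta>t \<eta> \<kappa>) (F r' \<eta>t' \<eta>' \<kappa>') \<in> ms"
    for v w r \<eta>t \<eta> \<kappa> r' \<eta>t' \<eta>' \<kappa>'
    unfolding br_Xh_Xf lie_bracket_antisym[of NN FXf FXh] br_Xf_V lie_bracket_antisym[of NN "FV v" FXf]
      br_Xh_V lie_bracket_antisym[of NN "FV v" FXh] br_V_V br_L2_L2
    by (simp_all only: minus_zero) (intro ms)+
  note all = this f f' h v br_self ms(7)
  assume "X \<in> insert (D_field NN) (insert FXf (insert FXh (vs \<union> ls)))" "Y \<in> insert FXf (insert FXh (vs \<union> ls))"
  then show ?thesis
    unfolding fields_F
    apply (elim UnE set_elims insertE)
    apply (hypsubst, (rule all | (subst br_self, rule ms(8))))+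
    done
qed

definition "pt t x = (cvec 0 t, 1, 0, opt x 0, 0)" for t :: "real^'n" and x :: real

lemma pt_in: "t \<in> U \<Longrightarrow> pt t x \<in> NN"
  by (simp add: pt_def gen_iia_def)

lemma ls_eq: "F 0 \<eta>t \<eta> \<kappa> = \<eta> $ None *\<^sub>R P_field NN None + F 0 \<eta>t (opt 0 (tail \<eta>)) \<kappa>"
  unfolding fields_F F_arith by (rule vf_on_cong) (simp add: L2_raw_def split_beta coordinate_simps axis_simps algebra_simps)

lemma ms_eq: "ms = span ({P_field NN None, FXf, FXh} \<union> (vs \<union> hs))" (is "_ = span ?B")
proof -
  have "F 0 \<eta>t \<eta> \<kappa> \<in> span ?B" for \<eta>t \<eta> \<kappa>
    by (subst ls_eq) (intro span_add span_scale span_base UnI1[of "P_field NN None"] UnI2 hsI; simp)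
  then have "insert FXf (insert FXh (vs \<union> ls)) \<subseteq> span ?B"
    by (auto simp: ls_def intro: span_base)
  moreover have "?B \<subseteq> ms"
    using hs_ls by (auto simp: fields_F intro: ms_base lsI)
  ultimately show ?thesis
    unfolding ms_def by (intro equalityI span_minimal subspace_span) (auto simp: ms_def)
qed

lemma range_fund_eq: "range fund = span ({D_field NN} \<union> insert FXf (insert FXh (vs \<union> ls)))" (is "_ = span ?B")
proof -
  let ?V = "range (V_field k NN)" and ?H = "{Z_field NN} \<union> range (\<lambda>a. P_field NN (Some a)) \<union> range (X_field NN)"
  let ?C = "{D_field NN, P_field NN None, FXf, FXh} \<union> range (V_field k NN) \<union> range (\<lambda>a. P_field NN (Some a)) \<union> range (X_field NN) \<union> {Z_field NN}"
  have v: "vs \<subseteq> span ?C" unfolding span_vs[symmetric] by (intro span_mono) auto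
  have h: "hs \<subseteq> span ?C" unfolding span_hs[symmetric] by (intro span_mono) auto
  have "F 0 \<eta>t \<eta> \<kappa> \<in> span ?C" for \<eta>t \<eta> \<kappa>
    by (subst ls_eq) (intro span_add span_scale span_base[of "P_field NN None"] subsetD[OF h] hsI; simp)
  then have "?B \<subseteq> span ?C"
    using v by (auto simp: ls_def intro: span_base)
  moreover have "?C \<subseteq> span ?B"
    by (auto simp: fields_F intro!: span_base vsI lsI)
  ultimately show ?thesis
    unfolding range_fund by (intro equalityI span_minimal subspace_span) auto
qed

lemma span_sets: "span vs = vs" "span hs = hs"
proof -
  show "span vs = vs" unfolding span_vs[symmetric] by (rule span_span)
  show "span hs = hs" using subspace_hs by (rule span_eq_iff[THEN iffD2])
qed

lemma base_point: obtains t a where "t \<in> U" "t $ a \<noteq> 0"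
proof -
  obtain t where t: "t \<in> U" using U_nonempty by blast
  then have "t \<noteq> 0" using U_pos K3_simps(13)[of k t t] by fastforce
  then obtain a where "t $ a \<noteq> 0" by (auto simp: vec_eq_iff)
  with t show ?thesis by (rule that)
qed

lemma subspace_eval: "linear \<phi> \<Longrightarrow> subspace {X. (\<phi> (X p) :: real) = 0}"
  by (auto simp: subspace_def plus_fun_def scaleR_fun_def zero_fun_def linear_add linear_scale linear_0)

lemma raw_pt:
  "p \<in> NN \<Longrightarrow> F r \<eta>t \<eta> \<kappa> p = L2_raw r \<eta>t \<eta> \<kappa> p" "p \<in> NN \<Longrightarrow> FV v p = V_raw k v p"
  "p \<in> NN \<Longrightarrow> FXf p = Xf_raw k p" "p \<in> NN \<Longrightarrow> FXh p = Xh_raw p"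
  by (simp_all add: vf_on_def)

text \<open>The functional \<open>dt/t + d\<rho>/\<rho>\<close> separates \<open>D\<close> from the other generators.\<close>

lemma D_disjoint: "X \<in> span {D_field NN} \<Longrightarrow> X \<in> ms \<Longrightarrow> X = 0"
proof -
  assume "X \<in> span {D_field NN}" and X: "X \<in> ms"
  then obtain r where r: "X = r *\<^sub>R D_field NN" by (auto simp: span_singleton)
  obtain t a where t: "t \<in> U" "t $ a \<noteq> 0" by (rule base_point)
  let ?\<phi> = "\<lambda>v :: 'n iia. fst (snd v) * t $ a + im_vec (fst v) $ a"
  have lin: "linear ?\<phi>" by (rule linearI) (simp_all add: coordinate_simps algebra_simps)
  have p: "pt t 0 \<in> NN" using t by (intro pt_in)
  have "ms \<subseteq> {X. ?\<phi> (X (pt t 0)) = 0}"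
    unfolding ms_def
    by (rule span_minimal[OF _ subspace_eval[OF lin]])
      (auto simp: vs_def ls_def raw_pt[OF p]; simp add: pt_def Xf_raw_def Xh_raw_def L2_raw_def V_raw_def Let_def coordinate_simps)
  then have "?\<phi> (X (pt t 0)) = 0" using X by blast
  then have "r * t $ a = 0"
    unfolding r fields_F F_arith raw_pt[OF p] by (simp add: L2_raw_def pt_def coordinate_simps)
  then show "X = 0" using t r by simp
qed

lemma span3: "X \<in> span {A, B, C} \<Longrightarrow> \<exists>a b c. X = a *\<^sub>R A + b *\<^sub>R B + c *\<^sub>R C"
  for A B C :: "'p \<Rightarrow> 'p::real_vector"
  by (auto simp: span_insert span_empty algebra_simps)

lemma sl2_independent:
  assumes "\<And>t x. t \<in> U \<Longrightarrow> im_vec (fst (X (pt t x))) = 0"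
    "\<And>t x. t \<in> U \<Longrightarrow> fst (snd (snd (snd (X (pt t x))))) $ None = 0"
    "X = a *\<^sub>R P_field NN None + b *\<^sub>R FXf + c *\<^sub>R FXh"
  shows "a = 0 \<and> b = 0 \<and> c = 0"
proof -
  obtain t i where t: "t \<in> U" "t $ i \<noteq> 0" by (rule base_point)
  have p: "pt t x \<in> NN" for x using t by (intro pt_in)
  have X: "X (pt t x) = a *\<^sub>R L2_raw 0 0 (axis None 1) 0 (pt t x) + b *\<^sub>R Xf_raw k (pt t x) + c *\<^sub>R Xh_raw (pt t x)" for x
    unfolding assms(3) fields_F using p[of x] by (simp add: plus_fun_def scaleR_fun_def vf_on_def)
  have 1: "(b * x - c) * t $ i = 0" for x
    using arg_cong[OF assms(1)[OF t(1), of x], of "\<lambda>v. v $ i"] unfolding X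
    by (simp add: L2_raw_def Xf_raw_def Xh_raw_def pt_def Let_def coordinate_simps algebra_simps)
  have "c = 0" using 1[of 0] t by simp
  moreover have "b = 0" using 1[of 1] t calculation by simp
  moreover have "a = 0"
    using assms(2)[OF t(1), of 0] unfolding X calculation
    by (simp add: L2_raw_def pt_def axis_simps)
  ultimately show ?thesis by simp
qed

lemma sl2_disjoint: "X \<in> span {P_field NN None, FXf, FXh} \<Longrightarrow> X \<in> ns \<Longrightarrow> X = 0"
proof -
  assume "X \<in> span {P_field NN None, FXf, FXh}" and X: "X \<in> ns"
  then obtain a b c where abc: "X = a *\<^sub>R P_field NN None + b *\<^sub>R FXf + c *\<^sub>R FXh" using span3 by metis
  have lin: "linear (\<lambda>v :: 'n iia. im_vec (fst v) $ i)" "linear (\<lambda>v :: 'n iia. fst (snd (snd (snd v))) $ None)" for i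
    by (rule linearI; simp add: coordinate_simps)+
  have 1: "ns \<subseteq> {X. im_vec (fst (X p)) $ i = 0}" "ns \<subseteq> {X. fst (snd (snd (snd (X p)))) $ None = 0}" if p: "p \<in> NN" for p i
    unfolding ns_def
    by (rule span_minimal[OF _ subspace_eval[OF lin(1)]] span_minimal[OF _ subspace_eval[OF lin(2)]];
      auto simp: vs_def hs_def raw_pt[OF p]; simp add: L2_raw_def V_raw_def split_beta coordinate_simps)+
  have "a = 0 \<and> b = 0 \<and> c = 0"
  proof (rule sl2_independent[OF _ _ abc])
    show "im_vec (fst (X (pt t x))) = 0" if "t \<in> U" for t x
      using 1(1)[OF pt_in[OF that]] X by (auto simp: vec_eq_iff)
    show "fst (snd (snd (snd (X (pt t x))))) $ None = 0" if "t \<in> U" for t x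
      using 1(2)[OF pt_in[OF that]] X by auto
  qed
  then show "X = 0" using abc by simp
qed

lemma vs_disjoint: "X \<in> vs \<Longrightarrow> X \<in> hs \<Longrightarrow> X = 0"
proof (elim set_elims)
  fix v \<eta>t \<eta> \<kappa> assume X: "X = FV v" "X = F 0 \<eta>t \<eta> \<kappa>"
  obtain t i where t: "t \<in> U" "t $ i \<noteq> 0" by (rule base_point)
  have p: "pt t 0 \<in> NN" using t by (intro pt_in)
  have "V_raw k v (pt t 0) = L2_raw 0 \<eta>t \<eta> \<kappa> (pt t 0)"
    using X raw_pt[OF p] by metis
  then have "v = 0" by (simp add: V_raw_def L2_raw_def pt_def coordinate_simps)
  then show "X = 0" using X(1) F_arith(6) by simp
qed

lemma br_sl2:
  "lie_bracket NN (P_field NN None) FXf = - FXh" "lie_bracket NN FXh (P_field NN None) = - 2 *\<^sub>R P_field NN None"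
proof -
  show "lie_bracket NN (P_field NN None) FXf = - FXh"
    by (subst lie_bracket_antisym) (simp add: fields_F br_Xf_L2' axis_simps opt_zero F_arith(5) F_arith(6))
  show "lie_bracket NN FXh (P_field NN None) = - 2 *\<^sub>R P_field NN None"
    unfolding fields_F br_Xh_L2 F_arith by (rule vf_on_cong) (simp add: L2_raw_def split_beta coordinate_simps axis_simps)
qed

lemma semidirect_D: "semidirect_sum NN (range fund) (span {D_field NN}) ms"
  unfolding range_fund_eq ms_def
  by (rule semidirect_spanI)
    (use vfield_gens vfield_sets br_ms D_disjoint[unfolded ms_def] span_0
      in \<open>auto simp: br_self fields_F ms_def\<close>)

lemma semidirect_sl2: "semidirect_sum NN ms (span {P_field NN None, FXf, FXh}) ns"
proof -
  have P: "P_field NN None \<in> insert FXf (insert FXh (vs \<union> ls))" by (auto simp: fields_F intro: lsI)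
  have AA: "lie_bracket NN X Y \<in> span {P_field NN None, FXf, FXh}" (is "_ \<in> ?S")
    if "X \<in> {P_field NN None, FXf, FXh}" "Y \<in> {P_field NN None, FXf, FXh}" for X Y
  proof -
    have b: "P_field NN None \<in> ?S" "FXf \<in> ?S" "FXh \<in> ?S" by (auto intro: span_base)
    have "- FXh \<in> ?S" "- 2 *\<^sub>R P_field NN None \<in> ?S" "2 *\<^sub>R FXf \<in> ?S" "- (- FXh) \<in> ?S" "- (- 2 *\<^sub>R P_field NN None) \<in> ?S" "- (2 *\<^sub>R FXf) \<in> ?S" "0 \<in> ?S"
      by (intro span_neg span_scale b span_0)+
    note all = this[folded br_sl2 br_Xh_Xf, folded lie_bracket_antisym]
    show ?thesis
      using that
      apply (elim insertE emptyE)
      apply (hypsubst, (rule all | (subst br_self, rule all)))+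
      done
  qed
  show ?thesis
    unfolding ms_eq ns_def
  proof (rule semidirect_spanI[OF _ _ AA])
    show "lie_bracket NN X Y \<in> span (vs \<union> hs)" if "X \<in> {P_field NN None, FXf, FXh}" "Y \<in> vs \<union> hs" for X Y
      using br_ns[of X Y] that P by (auto simp: ns_def)
    show "lie_bracket NN X Y \<in> span (vs \<union> hs)" if "X \<in> vs \<union> hs" "Y \<in> vs \<union> hs" for X Y
      using br_ns[of X Y] that hs_ls by (auto simp: ns_def)
  qed (use vfield_gens vfield_sets sl2_disjoint[unfolded ns_def] in \<open>auto simp: fields_F\<close>)
qed

lemma semidirect_vs: "semidirect_sum NN ns vs hs"
proof -
  have "semidirect_sum NN (span (vs \<union> hs)) (span vs) (span hs)"
  proof (rule semidirect_spanI)
    show "lie_bracket NN X Y \<in> span vs" if "X \<in> vs" "Y \<in> vs" for X Y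
      using that by (auto simp: vs_def br_V_V span_0)
  qed (use vfield_sets br_hs vs_disjoint in \<open>auto simp: span_sets\<close>)
  then show ?thesis by (simp add: span_sets ns_def)
qed

end

section \<open>S-duality\<close>

lemma two_matrix_eq: "M = N \<longleftrightarrow> M $ 1 $ 1 = N $ 1 $ 1 \<and> M $ 1 $ 2 = N $ 1 $ 2 \<and> M $ 2 $ 1 = N $ 2 $ 1 \<and> M $ 2 $ 2 = N $ 2 $ 2"
  for M N :: "real^2^2"
  by (auto simp: vec_eq_iff forall_2)

lemma sl2_entries:
  "sl2_e $ 1 $ 1 = 0" "sl2_e $ 1 $ 2 = 1" "sl2_e $ 2 $ 1 = 0" "sl2_e $ 2 $ 2 = 0"
  "sl2_f $ 1 $ 1 = 0" "sl2_f $ 1 $ 2 = 0" "sl2_f $ 2 $ 1 = 1" "sl2_f $ 2 $ 2 = 0"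
  "sl2_h $ 1 $ 1 = 1" "sl2_h $ 1 $ 2 = 0" "sl2_h $ 2 $ 1 = 0" "sl2_h $ 2 $ 2 = - 1"
  by (simp_all add: sl2_e_def sl2_f_def sl2_h_def)

lemma mat_exp_nilpotent:
  fixes x :: "real^'n::finite^'n"
  assumes "x ** x = 0"
  shows "mat_exp x = mat 1 + x"
proof -
  have pow: "((**) x ^^ Suc (Suc m)) (mat 1) = 0" for m
    by (induction m) (simp_all add: assms)
  have "(1 / fact m) *\<^sub>R ((**) x ^^ m) (mat 1) = 0" if m: "m \<notin> {0, 1}" for m
  proof -
    obtain j where "m = Suc (Suc j)" using m by (cases m; cases "m - 1") auto
    then show ?thesis by (simp only: pow scaleR_zero_right)
  qed
  then have "mat_exp x = (\<Sum>m\<in>{0, 1::nat}. (1 / fact m) *\<^sub>R ((**) x ^^ m) (mat 1))"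
    unfolding mat_exp_def by (intro suminf_finite) auto
  then show ?thesis by simp
qed

lemma matrix_sums:
  fixes f :: "nat \<Rightarrow> real^'n^'m"
  assumes "\<And>i j. (\<lambda>m. f m $ i $ j) sums (x $ i $ j)"
  shows "f sums x"
  using assms unfolding sums_def by (intro vec_tendstoI) simp

lemma mat_exp_h: "mat_exp (s *\<^sub>R sl2_h) = vector [vector [exp s, 0], vector [0, exp (- s)]]"
proof -
  have p: "((**) (s *\<^sub>R sl2_h) ^^ m) (mat 1) = vector [vector [s ^ m, 0], vector [0, (- s) ^ m]]" for m
    by (induction m) (simp_all add: two_matrix_eq mat_def matrix_matrix_mult_def sum_2 sl2_entries)
  have e: "(\<lambda>m. 1 / fact m * s ^ m) sums exp s" for s :: real
    using exp_converges[of s] by (simp add: scaleR_conv_of_real divide_inverse)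
  have "(\<lambda>m. (1 / fact m) *\<^sub>R ((**) (s *\<^sub>R sl2_h) ^^ m) (mat 1)) sums vector [vector [exp s, 0], vector [0, exp (- s)]]"
    unfolding p
  proof (rule matrix_sums)
    fix i j :: 2
    show "(\<lambda>m. ((1 / fact m) *\<^sub>R (vector [vector [s ^ m, 0], vector [0, (- s) ^ m]] :: real^2^2)) $ i $ j)
      sums ((vector [vector [exp s, 0], vector [0, exp (- s)]] :: real^2^2) $ i $ j)"
      using exhaust_2[of i] exhaust_2[of j] e[of s] e[of "- s"] by auto
  qed
  then show ?thesis unfolding mat_exp_def by (rule sums_unique[symmetric])
qed

lemma mat_exp_e: "mat_exp (s *\<^sub>R sl2_e) = vector [vector [1, s], vector [0, 1]]"
  by (subst mat_exp_nilpotent) (simp_all add: two_matrix_eq matrix_matrix_mult_def sum_2 sl2_entries mat_def)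

lemma mat_exp_f: "mat_exp (s *\<^sub>R sl2_f) = vector [vector [1, 0], vector [s, 1]]"
  by (subst mat_exp_nilpotent) (simp_all add: two_matrix_eq matrix_matrix_mult_def sum_2 sl2_entries mat_def)

definition iib_tb :: "'n::finite iib \<Rightarrow> 'n tb" where
  "iib_tb = (\<lambda>(z, \<tau>, cu, cl, c0, \<psi>). ((im_vec z, \<tau>), (cu, re_vec z, cl, \<psi>, - c0)))"

lemma bij_iib_tb: "bij_betw iib_tb (iib_domain H) (gen_tb (cone_over H))"
  by (rule bij_betw_byWitness[where f' = "\<lambda>((t, \<tau>), (c, b, l, \<psi>, \<omega>)). (cvec b t, \<tau>, c, l, - \<omega>, \<psi>)"])
    (auto simp: iib_tb_def iib_domain_def gen_tb_def)

lemma iia_of_iib_eq: "iia_of_iib k y = to_iia k (iib_tb y)"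
proof -
  obtain z \<tau> cu cl c0 \<psi> where y: "y = (z, \<tau>, cu, cl, c0, \<psi>)" by (metis prod.exhaust)
  show ?thesis
    unfolding y iia_of_iib_def iib_tb_def to_iia_def prod.case Let_def
    by (auto simp: cubic_real K3_sum option_vec_expand tail_def vec_eq_iff K2_def inner_vec_def)
qed

lemma S_duality_iib_eq:
  assumes "det M = 1"
  shows "iib_tb (S_duality_iib M y) = actC k ((M $ 1 $ 1, M $ 1 $ 2, M $ 2 $ 1, M $ 2 $ 2), 0) (iib_tb y)"
proof -
  have d: "M $ 1 $ 1 * M $ 2 $ 2 - M $ 1 $ 2 * M $ 2 $ 1 = 1" using assms by (simp add: det_2)
  show ?thesis
    by (cases y) (simp add: S_duality_iib_def iib_tb_def actC_def mob_def gl_nil_def Let_def d re_vec_def im_vec_def vec_eq_iff)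
qed

lemma qmap_space_gen: "qmap_space H = gen_iia (cone_over H)"
  by (simp add: qmap_space_def gen_iia_def)

locale psr_cone_over = psr_cone k "cone_over H" for k :: "'n::finite \<Rightarrow> 'n \<Rightarrow> 'n \<Rightarrow> real" and H
begin

lemma inv_iia_of_iib:
  assumes "p \<in> NN"
  shows "inv_into (iib_domain H) (iia_of_iib k) p \<in> iib_domain H"
    "iib_tb (inv_into (iib_domain H) (iia_of_iib k) p) = of_iia k p"
proof -
  let ?y = "inv_into (iib_domain H) (iia_of_iib k) p"
  have im: "iib_tb ` iib_domain H = gen_tb (cone_over H)" by (rule bij_betw_imp_surj_on[OF bij_iib_tb])
  have "p \<in> iia_of_iib k ` iib_domain H"
  proof -
    obtain y where "y \<in> iib_domain H" "of_iia k p = iib_tb y" using of_in[OF assms] im by blast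
    then show ?thesis using to_of[OF assms] by (auto simp: iia_of_iib_eq image_iff intro!: bexI[of _ y])
  qed
  then have y: "?y \<in> iib_domain H" and y2: "iia_of_iib k ?y = p"
    by (rule inv_into_into, rule f_inv_into_f)
  show "?y \<in> iib_domain H" by (rule y)
  have "iib_tb ?y \<in> gen_tb (cone_over H)" using y im by blast
  then show "iib_tb ?y = of_iia k p"
    using of_to[of "iib_tb ?y"] y2 unfolding iia_of_iib_eq by simp
qed

lemma S_duality_eq:
  assumes "det M = 1"
  shows "S_duality k H M = tr ((M $ 1 $ 1, M $ 1 $ 2, M $ 2 $ 1, M $ 2 $ 2), 0)"
  unfolding S_duality_def tr_def qmap_space_gen
  by (rule restrict_ext) (simp only: iia_of_iib_eq S_duality_iib_eq[OF assms, of _ k] inv_iia_of_iib(2) actA_def)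

lemma fundamental_eq:
  fixes x :: "real^2^2"
  assumes "\<And>s. det (mat_exp (s *\<^sub>R x)) = 1"
    "((\<lambda>s. ((mat_exp (s *\<^sub>R x) $ 1 $ 1, mat_exp (s *\<^sub>R x) $ 1 $ 2, mat_exp (s *\<^sub>R x) $ 2 $ 1, mat_exp (s *\<^sub>R x) $ 2 $ 2), 0 :: 'n nil))
      has_vector_derivative \<xi>) (at 0)"
    "mat_exp (0 :: real^2^2) = mat 1"
  shows "fundamental_field k H x = fund \<xi>"
proof -
  have 0: "((mat_exp (0 *\<^sub>R x) $ 1 $ 1, mat_exp (0 *\<^sub>R x) $ 1 $ 2, mat_exp (0 *\<^sub>R x) $ 2 $ 1, mat_exp (0 *\<^sub>R x) $ 2 $ 2), 0 :: 'n nil) = (gl_one, 0)"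
    using assms(3) by (simp add: mat_def zero_prod_def)
  show ?thesis
    unfolding act_curve_eq[OF assms(2) 0, symmetric] fundamental_field_def qmap_space_gen S_duality_eq[OF assms(1)]
    by (rule vf_on_cong) (simp add: tr_def)
qed

lemma mat_exp_0: "mat_exp (0 :: real^2^2) = mat 1"
  using mat_exp_nilpotent[of "0 :: real^2^2"] by simp

lemma has_vector_derivative_entries:
  assumes "(a has_real_derivative a') (at 0)" "(b has_real_derivative b') (at 0)"
    "(c has_real_derivative c') (at 0)" "(d has_real_derivative d') (at 0)"
  shows "((\<lambda>s. ((a s, b s, c s, d s), 0 :: 'n nil)) has_vector_derivative ((a', b', c', d'), 0)) (at 0)"
  using assms unfolding has_real_derivative_iff_has_vector_derivative
  by (intro has_vector_derivative_Pair has_vector_derivative_const)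

lemma fundamental_fields:
  "fundamental_field k H sl2_e = P_field NN None"
  "fundamental_field k H sl2_f = FXf"
  "fundamental_field k H sl2_h = FXh"
proof -
  have "fundamental_field k H sl2_e = fund ((0, 1, 0, 0), 0)"
    by (rule fundamental_eq[OF _ _ mat_exp_0]; simp only: mat_exp_e)
      (auto simp: det_2 zero_prod_def intro!: has_vector_derivative_entries derivative_eq_intros)
  also have "\<dots> = P_field NN None"
    using fund_L2[of 0 "axis None 1" 0 0] by (simp add: fields_F axis_simps tail_simps zero_prod_def)
  finally show "fundamental_field k H sl2_e = P_field NN None" .
  have "fundamental_field k H sl2_f = fund ((0, 0, 1, 0), 0)"
    by (rule fundamental_eq[OF _ _ mat_exp_0]; simp only: mat_exp_f)
      (auto simp: det_2 zero_prod_def intro!: has_vector_derivative_entries derivative_eq_intros)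
  then show "fundamental_field k H sl2_f = FXf" by (simp only: fund_Xf)
  have "fundamental_field k H sl2_h = fund ((1, 0, 0, -1), 0)"
  proof (rule fundamental_eq[OF _ _ mat_exp_0])
    show "det (mat_exp (s *\<^sub>R sl2_h)) = 1" for s
      by (simp add: mat_exp_h det_2 exp_minus)
    have "(exp has_real_derivative 1) (at 0)" "((\<lambda>s. exp (- s)) has_real_derivative - 1) (at (0::real))"
      by (auto intro!: derivative_eq_intros)
    then have "((\<lambda>s. ((exp s, 0, 0, exp (- s)) :: gl, 0 :: 'n nil)) has_vector_derivative ((1, 0, 0, - 1), 0)) (at 0)"
      by (intro has_vector_derivative_entries DERIV_const)
    then show "((\<lambda>s. ((mat_exp (s *\<^sub>R sl2_h) $ 1 $ 1, mat_exp (s *\<^sub>R sl2_h) $ 1 $ 2, mat_exp (s *\<^sub>R sl2_h) $ 2 $ 1,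
        mat_exp (s *\<^sub>R sl2_h) $ 2 $ 2), 0 :: 'n nil)) has_vector_derivative ((1, 0, 0, - 1), 0)) (at 0)"
      unfolding mat_exp_h vector_2 .
  qed
  then show "fundamental_field k H sl2_h = FXh" by (simp only: fund_Xh)
qed

lemma S_duality_in_G: "S_duality k H ` SL2 \<subseteq> G"
proof clarify
  fix M :: "real^2^2" assume "M \<in> SL2"
  then have d: "det M = 1" by (simp add: SL2_def)
  show "S_duality k H M \<in> G"
    unfolding S_duality_eq[OF d] by (rule tr_in) (use d in \<open>simp add: gp_dom_def gl_det_def det_2\<close>)
qed

lemma L_action_in_G: "L_action k H \<subseteq> G"
proof -
  interpret B: group "BijGroup NN" by (rule group_BijGroup)
  have "restrict (L2_transf r \<eta>t \<eta> \<kappa>) NN \<in> G" if "0 < r" for r \<eta>t \<eta> \<kappa>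
  proof -
    have "restrict (L2_transf r \<eta>t \<eta> \<kappa>) NN = tr ((sqrt r, \<eta> $ None, 0, 1),
      (- tail \<eta>, 0, tail \<eta>t, - (\<kappa> + \<eta> $ None * \<eta>t $ None + tail \<eta>t \<bullet> tail \<eta>) / 2, - (\<eta>t $ None)))"
      unfolding tr_def by (rule restrict_ext) (rule L2_actA[OF that, symmetric])
    then show ?thesis using that by (simp only:) (rule tr_in, simp add: gp_dom_def gl_det_def)
  qed
  moreover have "restrict (L1_dilation l) NN \<in> G" if "0 < l" for l
  proof -
    have "restrict (L1_dilation l) NN = tr ((l powr (-1/2), 0, 0, l), 0)"
      unfolding tr_def by (rule restrict_ext) (rule L1_dilation_actA[OF that, symmetric])
    then show ?thesis using that by (simp only:) (rule tr_in, simp add: gp_dom_def gl_det_def)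
  qed
  moreover have "restrict (L1_translation k v) NN \<in> G" for v
  proof -
    have "restrict (L1_translation k v) NN = tr (gl_one, (0, v, 0, 0, 0))"
      unfolding tr_def by (rule restrict_ext) (rule L1_translation_actA[symmetric])
    then show ?thesis by (simp only:) (rule tr_in, simp add: gp_dom_def gl_det_def)
  qed
  ultimately show ?thesis
    unfolding L_action_def qmap_space_gen Let_def
    by (intro B.generate_subgroup_incl[OF _ subgroup_G]) auto
qed

end

section \<open>The bracket table\<close>

lemma lie_bracket_combination:
  assumes "vfield N e" "vfield N f" "vfield N h"
  shows "lie_bracket N (a *\<^sub>R e + b *\<^sub>R f + c *\<^sub>R h) (a' *\<^sub>R e + b' *\<^sub>R f + c' *\<^sub>R h)
    = (a * b' - b * a') *\<^sub>R lie_bracket N e f + (c * a' - a * c') *\<^sub>R lie_bracket N h e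
      + (c * b' - b * c') *\<^sub>R lie_bracket N h f"
proof -
  have s: "vfield N (s *\<^sub>R X)" if "vfield N X" for s X
    using subspace_scale[OF subspace_vfield[of N]] that by auto
  have p: "vfield N (X + Y)" if "vfield N X" "vfield N Y" for X Y
    using subspace_add[OF subspace_vfield[of N]] that by auto
  note v = assms s p
  have "lie_bracket N f e = - lie_bracket N e f" "lie_bracket N e h = - lie_bracket N h e" "lie_bracket N f h = - lie_bracket N h f"
    "lie_bracket N X X = 0" for X
    by (rule lie_bracket_antisym br_self)+
  note b = this
  have 1: "lie_bracket N (a *\<^sub>R e + b *\<^sub>R f + c *\<^sub>R h) Z = a *\<^sub>R lie_bracket N e Z + b *\<^sub>R lie_bracket N f Z + c *\<^sub>R lie_bracket N h Z"
    if "vfield N Z" for Z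
    using that v by (simp only: lie_bracket_linear)
  have 2: "lie_bracket N Z (a' *\<^sub>R e + b' *\<^sub>R f + c' *\<^sub>R h) = a' *\<^sub>R lie_bracket N Z e + b' *\<^sub>R lie_bracket N Z f + c' *\<^sub>R lie_bracket N Z h"
    if "vfield N Z" for Z
    using that v by (simp only: lie_bracket_linear)
  show ?thesis
    unfolding 1[OF p[OF p[OF s[OF assms(1)] s[OF assms(2)]] s[OF assms(3)]]] 2[OF assms(1)] 2[OF assms(2)] 2[OF assms(3)] b
    by (simp add: algebra_simps)
qed

context psr_cone
begin

lemma sl2_iso: "isomorphic_sl2_op NN (span {P_field NN None, FXf, FXh})"
proof -
  let ?e = "P_field NN None"
  define F where "F x = (x $ 1 $ 2) *\<^sub>R ?e + (x $ 2 $ 1) *\<^sub>R FXf + (x $ 1 $ 1) *\<^sub>R FXh" for x :: "real^2^2"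
  have lin: "linear F"
    by (rule linearI) (simp_all add: F_def algebra_simps)
  have tr: "x $ 2 $ 2 = - x $ 1 $ 1" if "x \<in> sl2" for x
    using that by (simp add: sl2_def trace_def sum_2)
  have inj: "inj_on F sl2"
  proof (rule inj_onI)
    fix x y assume xy: "x \<in> sl2" "y \<in> sl2" "F x = F y"
    have "0 = F (x - y)" using xy(3) linear_diff[OF lin] by simp
    then have e: "0 = ((x - y) $ 1 $ 2) *\<^sub>R ?e + ((x - y) $ 2 $ 1) *\<^sub>R FXf + ((x - y) $ 1 $ 1) *\<^sub>R FXh"
      by (simp only: F_def)
    have "(x - y) $ 1 $ 2 = 0 \<and> (x - y) $ 2 $ 1 = 0 \<and> (x - y) $ 1 $ 1 = 0"
      by (rule sl2_independent[OF _ _ e]) (simp_all add: zero_fun_def coordinate_simps)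
    then show "x = y" using tr xy by (simp add: two_matrix_eq)
  qed
  have im: "F ` sl2 = span {?e, FXf, FXh}"
  proof
    show "F ` sl2 \<subseteq> span {?e, FXf, FXh}"
      unfolding F_def by (auto intro!: span_add span_scale intro: span_base)
    show "span {?e, FXf, FXh} \<subseteq> F ` sl2"
    proof
      fix X assume "X \<in> span {?e, FXf, FXh}"
      then obtain a b c where "X = a *\<^sub>R ?e + b *\<^sub>R FXf + c *\<^sub>R FXh" using span3 by metis
      then have "X = F (vector [vector [c, a], vector [b, - c]])" by (simp add: F_def)
      moreover have "vector [vector [c, a], vector [b, - c]] \<in> sl2" by (simp add: sl2_def trace_def sum_2)
      ultimately show "X \<in> F ` sl2" by blast
    qed
  qed
  have br: "lie_bracket NN (F x) (F y) = F (y ** x - x ** y)" if "x \<in> sl2" "y \<in> sl2" for x y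
  proof -
    have v: "vfield NN ?e" unfolding fields_F by (rule vfield_gens)
    have "lie_bracket NN (F x) (F y) = (x $ 1 $ 2 * y $ 2 $ 1 - x $ 2 $ 1 * y $ 1 $ 2) *\<^sub>R (- FXh)
      + (x $ 1 $ 1 * y $ 1 $ 2 - x $ 1 $ 2 * y $ 1 $ 1) *\<^sub>R (- 2 *\<^sub>R ?e) + (x $ 1 $ 1 * y $ 2 $ 1 - x $ 2 $ 1 * y $ 1 $ 1) *\<^sub>R (2 *\<^sub>R FXf)"
      unfolding F_def lie_bracket_combination[OF v vfield_gens(3,4)] br_sl2 br_Xh_Xf ..
    also have "\<dots> = F (y ** x - x ** y)"
      by (simp add: F_def matrix_matrix_mult_def sum_2 tr that algebra_simps)
    finally show ?thesis .
  qed
  show ?thesis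
    unfolding isomorphic_sl2_op_def bij_betw_def using lin inj im br by blast
qed

lemma K2_axis: "K2 k (axis a 1) (axis b 1) $ c = k a b c"
proof -
  have "K2 k (axis a 1) (axis b 1) $ c = k c a b"
    by (simp add: K2_def axis_def if_distrib[of "\<lambda>x. _ * x"] if_distribR
        if_distrib[of "\<lambda>x. x * _"] cong: if_cong)
  then show ?thesis by (metis sym1 sym2)
qed

lemma F_eqI: "r = r' \<Longrightarrow> \<eta>t = \<eta>t' \<Longrightarrow> \<eta> = \<eta>' \<Longrightarrow> \<kappa> = \<kappa>' \<Longrightarrow> F r \<eta>t \<eta> \<kappa> = F r' \<eta>t' \<eta>' \<kappa>'"
  by simp

lemma F_neg: "- F r \<eta>t \<eta> \<kappa> = F (- r) (- \<eta>t) (- \<eta>) (- \<kappa>)" "- FV v = FV (- v)"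
  using F_arith(2)[of "- 1" r \<eta>t \<eta> \<kappa>] F_arith(4)[of "- 1" v] by simp_all

lemma bracket_table:
  fixes br D P X Z V
  defines "br \<equiv> lie_bracket NN" and "D \<equiv> D_field NN" and "P \<equiv> P_field NN" and "X \<equiv> X_field NN"
    and "Z \<equiv> Z_field NN" and "V \<equiv> V_field k NN"
  shows "br (P i) (X j) = (if i = j then - 2 *\<^sub>R Z else 0)"
    "br (X i) D = (1/2) *\<^sub>R X i" "br (P i) D = (1/2) *\<^sub>R P i" "br Z D = Z"
    "br (P None) (V a) = P (Some a)"
    "br (V a) (P (Some b)) = (\<Sum>c\<in>UNIV. k a b c *\<^sub>R X (Some c))"
    "br (V a) (X (Some b)) = (if a = b then X None else 0)"
    "br FXh (V a) = V a" "br FXf (P (Some a)) = V a"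
    "br D FXf = (1/2) *\<^sub>R FXf" "br Z FXf = (1/2) *\<^sub>R X None"
    "br (P (Some a)) FXh = P (Some a)"
    "br FXh (X None) = X None" "br Z FXh = Z"
    "br D FXh = 0" "br D (V a) = 0" "br (P None) (P (Some a)) = 0" "br (P None) Z = 0"
    "br FXf (V a) = 0" "br FXf (X i) = 0" "br FXh (X (Some a)) = 0"
    "br (V a) (V b) = 0" "br (V a) (X None) = 0" "br (V a) Z = 0"
    "br (P (Some a)) (P (Some b)) = 0" "br (P (Some a)) Z = 0" "br (X i) (X j) = 0" "br (X i) Z = 0"
proof -
  note defs = br_def D_def P_def X_def Z_def V_def fields_F
  note comp = option_vec_expand axis_simps tail_simps inner_axis axis_eq_axis K2_simps inner_simps opt_zero
  note flip = lie_bracket_antisym[of NN _ FXf] lie_bracket_antisym[of NN _ FXh] lie_bracket_antisym[of NN "F _ _ _ _" "FV _"]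
  have e: "(axis i 1 :: real^'m) \<bullet> axis j 1 = (if i = j then 1 else 0)" for i j :: "'m::finite"
    by (simp add: inner_axis_axis)
  have z: "0 = F 0 0 0 0" by (rule F_arith(5)[symmetric])
  note F2 = br_L2_L2 F_arith(2) F_neg
  show "br (P i) (X j) = (if i = j then - 2 *\<^sub>R Z else 0)"
    unfolding defs F2 by (auto simp: inner_axis_axis z F_arith(2) intro!: F_eqI)
  show "br (X i) D = (1/2) *\<^sub>R X i" "br (P i) D = (1/2) *\<^sub>R P i" "br Z D = Z"
    unfolding defs F2 by (intro F_eqI; simp)+
  show "br (P None) (P (Some a)) = 0" "br (P None) Z = 0" "br (P (Some a)) (P (Some b)) = 0" "br (P (Some a)) Z = 0"
    "br (X i) (X j) = 0" "br (X i) Z = 0"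
    unfolding defs F2 z by (intro F_eqI; simp)+
  show "br (P None) (V a) = P (Some a)"
    unfolding defs br_L2_V F_neg by (intro F_eqI) (simp_all add: option_vec_expand axis_simps tail_simps K2_simps)
  have "br (V a) (P (Some b)) = F 0 (opt 0 (K2 k (axis a 1) (axis b 1))) 0 0"
    unfolding defs br_V_L2 by (intro F_eqI) (simp_all add: option_vec_expand axis_simps tail_simps)
  also have "\<dots> = (\<Sum>c\<in>UNIV. k a b c *\<^sub>R X (Some c))"
    by (subst linear_axis_expansion[OF linear_F(1)]) (simp only: K2_axis opt_axis defs)
  finally show "br (V a) (P (Some b)) = (\<Sum>c\<in>UNIV. k a b c *\<^sub>R X (Some c))" .
  show "br (V a) (X (Some b)) = (if a = b then X None else 0)"
    unfolding defs br_V_L2 by (auto simp: z inner_axis_axis intro!: F_eqI) (simp_all add: option_vec_expand axis_simps tail_simps K2_simps inner_axis_axis)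
  show "br (V a) (X None) = 0" "br (V a) Z = 0" 
    unfolding defs br_V_L2 z by (intro F_eqI; simp add: option_vec_expand axis_simps tail_simps K2_simps)+
  show "br D (V a) = 0"
    unfolding defs br_L2_V F_neg z by (intro F_eqI; simp add: option_vec_expand axis_simps tail_simps K2_simps)
  show "br FXh (V a) = V a" "br FXf (V a) = 0" "br (V a) (V b) = 0"
    unfolding defs by (rule br_Xh_V br_Xf_V br_V_V)+
  show "br FXf (P (Some a)) = V a" "br FXf (X i) = 0"
    unfolding defs br_Xf_L2' by (simp_all add: axis_simps tail_simps opt_zero F_arith(5,6))
  show "br D FXf = (1/2) *\<^sub>R FXf"
    unfolding defs flip br_Xf_L2' by (simp add: tail_simps opt_zero F_arith(5,6))
  show "br Z FXf = (1/2) *\<^sub>R X None"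
    unfolding defs flip br_Xf_L2' by (simp add: tail_simps F_arith(2,6) F_neg)
      (intro F_eqI; simp add: option_vec_expand axis_simps tail_simps)
  show "br (P (Some a)) FXh = P (Some a)" "br Z FXh = Z"
    unfolding defs flip br_Xh_L2 F_neg by (intro F_eqI; simp add: option_vec_expand axis_simps tail_simps)+
  show "br D FXh = 0"
    unfolding defs flip br_Xh_L2 F_neg z by (intro F_eqI; simp add: option_vec_expand axis_simps tail_simps)
  show "br FXh (X None) = X None" unfolding defs br_Xh_L2 by (intro F_eqI; simp add: option_vec_expand axis_simps tail_simps)
  show "br FXh (X (Some a)) = 0"
    unfolding defs br_Xh_L2 z by (intro F_eqI; simp add: option_vec_expand axis_simps tail_simps)
qed

end

section \<open>The metric\<close>

abbreviation upd :: "('a::real_normed_field)^'i \<Rightarrow> 'i \<Rightarrow> 'a \<Rightarrow> 'a^'i" where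
  "upd x i s \<equiv> (\<chi> j. if j = i then s else x $ j)"

definition C1 :: "('n::finite \<Rightarrow> 'n \<Rightarrow> 'n \<Rightarrow> real) \<Rightarrow> 'n \<Rightarrow> ('a::real_normed_field)^'n \<Rightarrow> 'a" where
  "C1 k i x = (\<Sum>b\<in>UNIV. \<Sum>c\<in>UNIV. of_real (k i b c) * x $ b * x $ c) / 2"

definition C2 :: "('n::finite \<Rightarrow> 'n \<Rightarrow> 'n \<Rightarrow> real) \<Rightarrow> 'n \<Rightarrow> 'n \<Rightarrow> ('a::real_normed_field)^'n \<Rightarrow> 'a" where
  "C2 k i j x = (\<Sum>c\<in>UNIV. of_real (k i j c) * x $ c)"

lemma DERIV_upd: "((\<lambda>s. upd x i s $ j) has_field_derivative (if j = i then 1 else 0)) F"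
  by (cases "j = i") auto

lemma upd_self [simp]: "upd x i (x $ i) = x"
  by (simp add: vec_eq_iff)

lemma partialI: "((\<lambda>s. f (upd x i s)) has_field_derivative D) (at (x $ i)) \<Longrightarrow> partial i f x = D"
  unfolding partial_def by (rule DERIV_imp_deriv)

lemma sum_if_simps:
  "(if P then u else 0) * v = (if P then u * v else 0)" "v * (if P then u else 0) = (if P then v * u else 0)"
  "(\<Sum>c\<in>A. if P then f c else 0) = (if P then \<Sum>c\<in>A. f c else 0)"
  for u v :: "'a::comm_semiring_1" and f :: "'c \<Rightarrow> 'a"
  by auto

context sym_cubic
begin

lemma DERIV_cubic:
  fixes x :: "('a::real_normed_field)^'n"
  shows "((\<lambda>s. cubic k (upd x i s)) has_field_derivative C1 k i x) (at (x $ i))"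
proof -
  have "((\<lambda>s. cubic k (upd x i s)) has_field_derivative
      (\<Sum>a\<in>UNIV. \<Sum>b\<in>UNIV. \<Sum>c\<in>UNIV. of_real (k a b c) * (if a = i then 1 else 0) * x $ b * x $ c
        + of_real (k a b c) * x $ a * (if b = i then 1 else 0) * x $ c
        + of_real (k a b c) * x $ a * x $ b * (if c = i then 1 else 0)) / 6) (at (x $ i))"
    unfolding cubic_def
    by (rule DERIV_cdivide DERIV_sum)+
      (auto intro!: derivative_eq_intros DERIV_upd simp del: vec_lambda_beta simp: algebra_simps)
  also have "(\<Sum>a\<in>UNIV. \<Sum>b\<in>UNIV. \<Sum>c\<in>UNIV. of_real (k a b c) * (if a = i then 1 else 0) * x $ b * x $ c
        + of_real (k a b c) * x $ a * (if b = i then 1 else 0) * x $ c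
        + of_real (k a b c) * x $ a * x $ b * (if c = i then 1 else 0)) / 6 = C1 k i x"
  proof -
    have 1: "(\<Sum>a\<in>UNIV. \<Sum>b\<in>UNIV. \<Sum>c\<in>UNIV. of_real (k a b c) * (if a = i then 1 else 0) * x $ b * x $ c)
        = (\<Sum>b\<in>UNIV. \<Sum>c\<in>UNIV. of_real (k i b c) * x $ b * x $ c)"
      by (simp add: sum_if_simps cong: if_cong)
    have 2: "(\<Sum>a\<in>UNIV. \<Sum>b\<in>UNIV. \<Sum>c\<in>UNIV. of_real (k a b c) * x $ a * (if b = i then 1 else 0) * x $ c)
        = (\<Sum>a\<in>UNIV. \<Sum>c\<in>UNIV. of_real (k a i c) * x $ a * x $ c)"
      by (rule sum.cong[OF refl]) (simp add: sum_if_simps cong: if_cong)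
    have 3: "(\<Sum>a\<in>UNIV. \<Sum>b\<in>UNIV. \<Sum>c\<in>UNIV. of_real (k a b c) * x $ a * x $ b * (if c = i then 1 else 0))
        = (\<Sum>a\<in>UNIV. \<Sum>b\<in>UNIV. of_real (k a b i) * x $ a * x $ b)"
      by (intro sum.cong[OF refl]) (simp add: sum_if_simps cong: if_cong)
    have "k a i c = k i a c" "k a b i = k i a b" for a b c
      using sym1 sym2 by metis+
    then show ?thesis
      by (simp add: sum.distrib 1 2 3 C1_def)
  qed
  finally show ?thesis .
qed

lemma DERIV_C1:
  fixes x :: "('a::real_normed_field)^'n"
  shows "((\<lambda>s. C1 k j (upd x i s)) has_field_derivative C2 k j i x) (at (x $ i))"
proof -
  have "((\<lambda>s. C1 k j (upd x i s)) has_field_derivative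
      (\<Sum>b\<in>UNIV. \<Sum>c\<in>UNIV. of_real (k j b c) * (if b = i then 1 else 0) * x $ c
        + of_real (k j b c) * x $ b * (if c = i then 1 else 0)) / 2) (at (x $ i))"
    unfolding C1_def
    by (rule DERIV_cdivide DERIV_sum)+
      (auto intro!: derivative_eq_intros DERIV_upd simp del: vec_lambda_beta simp: algebra_simps)
  also have "(\<Sum>b\<in>UNIV. \<Sum>c\<in>UNIV. of_real (k j b c) * (if b = i then 1 else 0) * x $ c
        + of_real (k j b c) * x $ b * (if c = i then 1 else 0)) / 2 = C2 k j i x"
  proof -
    have 1: "(\<Sum>b\<in>UNIV. \<Sum>c\<in>UNIV. of_real (k j b c) * (if b = i then 1 else 0) * x $ c) = C2 k j i x"
      by (simp add: sum_if_simps C2_def cong: if_cong)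
    have 2: "(\<Sum>b\<in>UNIV. \<Sum>c\<in>UNIV. of_real (k j b c) * x $ b * (if c = i then 1 else 0)) = C2 k j i x"
      by (simp add: sum_if_simps C2_def sym2[of j _ i] cong: if_cong)
    show ?thesis by (simp add: sum.distrib 1 2)
  qed
  finally show ?thesis .
qed

lemma partial_cubic: "partial i (cubic k) = (\<lambda>x :: ('a::real_normed_field)^'n. C1 k i x)"
  by (rule ext) (rule partialI[OF DERIV_cubic])

lemma partial_partial_cubic: "partial i (partial j (cubic k)) x = C2 k j i (x :: ('a::real_normed_field)^'n)"
  unfolding partial_cubic by (rule partialI[OF DERIV_C1])

lemma C_real: "C1 k i x = K2 k x x $ i / 2" "C2 k j i x = K2 k x (axis i 1) $ j" for x :: "real^'n"
proof -
  show "C1 k i x = K2 k x x $ i / 2" by (simp add: C1_def K2_def)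
  show "C2 k j i x = K2 k x (axis i 1) $ j"
    by (subst K2_commute) (simp add: C2_def K2_def axis_def sum_if_simps cong: if_cong)
qed

lemma partial_ln_cubic:
  fixes t :: "real^'n"
  assumes "0 < K3 k t t t"
  shows "partial i (partial j (\<lambda>t. ln (cubic k t))) t = C2 k j i t / cubic k t - C1 k i t * C1 k j t / (cubic k t)\<^sup>2"
proof (rule partialI)
  have 1: "partial j (\<lambda>t. ln (cubic k t)) x = C1 k j x / cubic k x" if "0 < cubic k x" for x :: "real^'n"
    by (rule partialI) (use that in \<open>auto intro!: derivative_eq_intros DERIV_cubic\<close>)
  have pos: "0 < cubic k t" using assms by (simp add: cubic_real)
  have c: "((\<lambda>s. cubic k (upd t i s)) has_field_derivative C1 k i t) (at (t $ i))" by (rule DERIV_cubic)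
  have "\<forall>\<^sub>F s in at (t $ i). 0 < cubic k (upd t i s)"
    using DERIV_isCont[OF c] pos unfolding isCont_def by (intro order_tendstoD(1)) simp_all
  then have ev: "\<forall>\<^sub>F s in nhds (t $ i). 0 < cubic k (upd t i s)"
    using pos by (simp add: eventually_nhds_conv_at)
  have "((\<lambda>s. C1 k j (upd t i s) / cubic k (upd t i s)) has_field_derivative
      C2 k j i t / cubic k t - C1 k i t * C1 k j t / (cubic k t)\<^sup>2) (at (t $ i))"
    using pos by (auto intro!: derivative_eq_intros DERIV_cubic DERIV_C1 simp: power2_eq_square field_simps)
  then show "((\<lambda>s. partial j (\<lambda>t. ln (cubic k t)) (upd t i s)) has_field_derivative
      C2 k j i t / cubic k t - C1 k i t * C1 k j t / (cubic k t)\<^sup>2) (at (t $ i))"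
    by (rule DERIV_cong_ev[THEN iffD2, rotated -1]) (use ev 1 in \<open>auto elim: eventually_mono\<close>)
qed

definition "bf t x y = - (1/4) * (K3 k t x y / (K3 k t t t / 6) - K3 k t t x * K3 k t t y / (4 * (K3 k t t t / 6)\<^sup>2))"

lemma C_sums:
  fixes t x y :: "real^'n"
  shows "(\<Sum>i\<in>UNIV. \<Sum>j\<in>UNIV. C2 k j i t * (x $ i * y $ j)) = K3 k t x y"
    "(\<Sum>i\<in>UNIV. C1 k i t * x $ i) = K3 k t t x / 2"
    "(\<Sum>i\<in>UNIV. x $ i * C1 k i t) = K3 k t t x / 2"
proof -
  have "(\<Sum>i\<in>UNIV. \<Sum>j\<in>UNIV. C2 k j i t * (x $ i * y $ j)) = (\<Sum>j\<in>UNIV. \<Sum>i\<in>UNIV. \<Sum>c\<in>UNIV. k j i c * y $ j * x $ i * t $ c)"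
    by (subst sum.swap) (simp add: C2_def sum_distrib_left sum_distrib_right mult_ac)
  also have "\<dots> = K3 k y x t" unfolding K3_sum ..
  also have "\<dots> = K3 k t x y" by (simp only: K3_commute)
  finally show "(\<Sum>i\<in>UNIV. \<Sum>j\<in>UNIV. C2 k j i t * (x $ i * y $ j)) = K3 k t x y" .
  have "(\<Sum>i\<in>UNIV. C1 k i t * x $ i) = K2 k t t \<bullet> x / 2" by (simp add: C_real inner_vec_def sum_divide_distrib)
  then show "(\<Sum>i\<in>UNIV. C1 k i t * x $ i) = K3 k t t x / 2" by (simp add: inner_K2 K3_commute)
  then show "(\<Sum>i\<in>UNIV. x $ i * C1 k i t) = K3 k t t x / 2" by (simp add: mult.commute)
qed

lemma base_metric_eq:
  assumes "0 < K3 k (im_vec z) (im_vec z) (im_vec z)"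
  shows "base_metric k z u v = bf (im_vec z) (re_vec u) (re_vec v) + bf (im_vec z) (im_vec u) (im_vec v)"
proof -
  define t where "t = im_vec z"
  have *: "(\<Sum>a\<in>UNIV. \<Sum>b\<in>UNIV. (C2 k b a t / cubic k t - C1 k a t * C1 k b t / (cubic k t)\<^sup>2) * (x $ a * y $ b)) = - 4 * bf t x y"
    for x y :: "real^'n"
  proof -
    have "(\<Sum>a\<in>UNIV. \<Sum>b\<in>UNIV. (C2 k b a t / cubic k t - C1 k a t * C1 k b t / (cubic k t)\<^sup>2) * (x $ a * y $ b))
      = (\<Sum>a\<in>UNIV. \<Sum>b\<in>UNIV. C2 k b a t * (x $ a * y $ b)) / cubic k t
        - (\<Sum>a\<in>UNIV. C1 k a t * x $ a) * (\<Sum>b\<in>UNIV. C1 k b t * y $ b) / (cubic k t)\<^sup>2"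
      by (simp add: sum_product sum_divide_distrib sum_subtractf algebra_simps)
    also have "\<dots> = - 4 * bf t x y"
      unfolding C_sums bf_def cubic_real by (simp add: power2_eq_square field_simps)
    finally show ?thesis .
  qed
  have "base_metric k z u v = - (1/4) * ((\<Sum>a\<in>UNIV. \<Sum>b\<in>UNIV. (C2 k b a t / cubic k t - C1 k a t * C1 k b t / (cubic k t)\<^sup>2) * (re_vec u $ a * re_vec v $ b))
     + (\<Sum>a\<in>UNIV. \<Sum>b\<in>UNIV. (C2 k b a t / cubic k t - C1 k a t * C1 k b t / (cubic k t)\<^sup>2) * (im_vec u $ a * im_vec v $ b)))"
    unfolding base_metric_def using partial_ln_cubic[OF assms]
    by (simp add: t_def re_vec_def im_vec_def sum.distrib distrib_left)
  then show ?thesis unfolding * by (simp add: t_def diff_divide_distrib)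
qed

lemma DERIV_cubic_quotients:
  fixes X :: "complex^('n option)"
  shows "partial (Some b) (prepotential k) X = - C1 k b (\<chi> a. X $ Some a) / X $ None"
    and "X $ None \<noteq> 0 \<Longrightarrow> partial None (prepotential k) X = cubic k (\<chi> a. X $ Some a) / (X $ None)\<^sup>2"
proof -
  have s: "(\<chi> a. upd X (Some b) s $ Some a) = upd (\<chi> a. X $ Some a) b s" for s b
    by (simp add: vec_eq_iff)
  show "partial (Some b) (prepotential k) X = - C1 k b (\<chi> a. X $ Some a) / X $ None"
  proof (rule partialI)
    have "((\<lambda>s. - cubic k (upd (\<chi> a. X $ Some a) b s) / X $ None) has_field_derivative - C1 k b (\<chi> a. X $ Some a) / X $ None) (at ((\<chi> a. X $ Some a) $ b))"
      by (intro DERIV_cdivide DERIV_minus DERIV_cubic)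
    then show "((\<lambda>s. prepotential k (upd X (Some b) s)) has_field_derivative - C1 k b (\<chi> a. X $ Some a) / X $ None) (at (X $ Some b))"
      unfolding prepotential_def s by simp
  qed
  assume "X $ None \<noteq> 0"
  then have "((\<lambda>s. - cubic k (\<chi> a. X $ Some a) / s) has_field_derivative cubic k (\<chi> a. X $ Some a) / (X $ None)\<^sup>2) (at (X $ None))"
    by (auto intro!: derivative_eq_intros simp: power2_eq_square)
  moreover have "(\<chi> a. upd X None s $ Some a) = (\<chi> a. X $ Some a)" for s by (simp add: vec_eq_iff)
  ultimately show "partial None (prepotential k) X = cubic k (\<chi> a. X $ Some a) / (X $ None)\<^sup>2"
    by (intro partialI) (simp add: prepotential_def)
qed

lemma tau_entries:
  "tau k z $ Some a $ Some b = - C2 k b a z" "tau k z $ None $ Some b = C1 k b z"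
  "tau k z $ Some a $ None = C1 k a z" "tau k z $ None $ None = - 2 * cubic k z"
proof -
  have h: "(\<chi> a. homog z $ Some a) = z" "homog z $ None = 1" "homog z $ Some a = z $ a" for a by (simp_all add: homog_def)
  have s: "(\<chi> a. upd (homog z) (Some b) s $ Some a) = upd z b s" "(\<chi> a. upd (homog z) None s $ Some a) = z" for s b
    by (simp_all add: vec_eq_iff h)
  show "tau k z $ Some a $ Some b = - C2 k b a z"
    unfolding tau_def using DERIV_minus[OF DERIV_C1[where j = b and x = z and i = a]]
    by simp (rule partialI, simp only: DERIV_cubic_quotients(1) s h, simp add: h)
  have "((\<lambda>x. - C1 k b z / x) has_field_derivative C1 k b z) (at 1)"
    by (auto intro!: derivative_eq_intros)
  then show "tau k z $ None $ Some b = C1 k b z"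
    unfolding tau_def by simp (rule partialI, simp only: DERIV_cubic_quotients(1) s h, simp add: h)
  show "tau k z $ Some a $ None = C1 k a z"
    unfolding tau_def using DERIV_cubic[where x = z and i = a]
    by simp (rule partialI, subst DERIV_cubic_quotients(2), simp_all only: s, simp_all add: h)
  have "((\<lambda>x. cubic k z / x\<^sup>2) has_field_derivative - 2 * cubic k z) (at 1)"
    by (auto intro!: derivative_eq_intros)
  moreover have "\<forall>\<^sub>F x in nhds 1. partial None (prepotential k) (upd (homog z) None x) = cubic k z / x\<^sup>2"
  proof -
    have "\<forall>\<^sub>F x in nhds (1::complex). x \<noteq> 0" using t1_space_nhds[of "1::complex" 0] by simp
    then show ?thesis
      by (rule eventually_mono) (subst DERIV_cubic_quotients(2), simp_all only: s, simp_all)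
  qed
  ultimately have "((\<lambda>x. partial None (prepotential k) (upd (homog z) None x)) has_field_derivative - 2 * cubic k z) (at 1)"
    using DERIV_cong_ev[of 1 1 "\<lambda>x. partial None (prepotential k) (upd (homog z) None x)" "\<lambda>x. cubic k z / x\<^sup>2"] by blast
  then show "tau k z $ None $ None = - 2 * cubic k z"
    unfolding tau_def by simp (rule partialI, simp add: h)
qed

lemma complex_cubic:
  fixes z :: "complex^'n"
  defines "b \<equiv> re_vec z" and "t \<equiv> im_vec z"
  shows "Re (C1 k a z) = (K2 k b b $ a - K2 k t t $ a) / 2" "Im (C1 k a z) = K2 k b t $ a"
    "Re (C2 k i j z) = C2 k i j b" "Im (C2 k i j z) = C2 k i j t"
    "Re (cubic k z) = (K3 k b b b - 3 * K3 k b t t) / 6" "Im (cubic k z) = (3 * K3 k b b t - K3 k t t t) / 6"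
proof -
  show "Re (C1 k a z) = (K2 k b b $ a - K2 k t t $ a) / 2"
    by (simp add: C1_def K2_def b_def t_def re_vec_def im_vec_def sum_subtractf algebra_simps)
  have "Im (C1 k a z) = (K2 k b t $ a + K2 k t b $ a) / 2"
    by (simp add: C1_def K2_def b_def t_def re_vec_def im_vec_def sum.distrib algebra_simps)
  then show "Im (C1 k a z) = K2 k b t $ a" by (simp add: K2_commute[of t b])
  show "Re (C2 k i j z) = C2 k i j b" "Im (C2 k i j z) = C2 k i j t"
    by (simp_all add: C2_def b_def t_def re_vec_def im_vec_def)
  have "Re (cubic k z) = (K3 k b b b - K3 k b t t - K3 k t b t - K3 k t t b) / 6"
    by (simp add: cubic_def K3_sum b_def t_def re_vec_def im_vec_def sum_subtractf sum.distrib algebra_simps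
        diff_divide_distrib add_divide_distrib)
  then show "Re (cubic k z) = (K3 k b b b - 3 * K3 k b t t) / 6" by (simp add: K3_commute)
  have "Im (cubic k z) = (K3 k t b b + K3 k b t b + K3 k b b t - K3 k t t t) / 6"
    by (simp add: cubic_def K3_sum b_def t_def re_vec_def im_vec_def sum_subtractf sum.distrib algebra_simps)
  then show "Im (cubic k z) = (3 * K3 k b b t - K3 k t t t) / 6" by (simp add: K3_commute)
qed

lemma sum_C2: "(\<Sum>b\<in>UNIV. C2 k b a t * w $ b) = K2 k t w $ a" for t w :: "real^'n"
proof -
  have "(\<Sum>b\<in>UNIV. C2 k b a t * w $ b) = (\<Sum>b\<in>UNIV. \<Sum>c\<in>UNIV. k b a c * w $ b * t $ c)"
    by (simp add: C2_def sum_distrib_left sum_distrib_right mult_ac)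
  also have "\<dots> = K2 k w t $ a" by (simp add: K2_def sym1)
  finally show ?thesis by (simp add: K2_commute)
qed

lemma sum_option: "(\<Sum>i\<in>UNIV. f i) = f None + (\<Sum>a\<in>UNIV. f (Some a))" for f :: "'m::finite option \<Rightarrow> 'a::comm_monoid_add"
  by (simp add: UNIV_option_conv sum.reindex)

lemma W_form_eq:
  fixes z dz :: "complex^'n"
  defines "b \<equiv> re_vec z" and "t \<equiv> im_vec z"
  shows "W_form k z None (dz, d\<rho>, d\<zeta>t, d\<zeta>, d\<sigma>) = Complex
      (d\<zeta>t $ None + d\<zeta> $ None * (K3 k b b b - 3 * K3 k b t t) / 3 - (K3 k b b (tail d\<zeta>) - K3 k t t (tail d\<zeta>)) / 2)
      (d\<zeta> $ None * (3 * K3 k b b t - K3 k t t t) / 3 - K3 k b t (tail d\<zeta>))"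
    "W_form k z (Some a) (dz, d\<rho>, d\<zeta>t, d\<zeta>, d\<sigma>) = Complex
      ((tail d\<zeta>t - (d\<zeta> $ None / 2) *\<^sub>R (K2 k b b - K2 k t t) + K2 k b (tail d\<zeta>)) $ a)
      ((K2 k t (tail d\<zeta>) - d\<zeta> $ None *\<^sub>R K2 k b t) $ a)"
proof -
  have "(\<Sum>a\<in>UNIV. K2 k x y $ a * d\<zeta> $ Some a) = K3 k x y (tail d\<zeta>)" for x y
    using inner_K2(2)[of x y "tail d\<zeta>"] by (simp add: inner_vec_def K3_commute)
  then have "(\<Sum>a\<in>UNIV. d\<zeta> $ Some a * K2 k x y $ a) = K3 k x y (tail d\<zeta>)" for x y
    by (simp only: mult.commute)
  note K = this
  show "W_form k z None (dz, d\<rho>, d\<zeta>t, d\<zeta>, d\<sigma>) = Complex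
      (d\<zeta>t $ None + d\<zeta> $ None * (K3 k b b b - 3 * K3 k b t t) / 3 - (K3 k b b (tail d\<zeta>) - K3 k t t (tail d\<zeta>)) / 2)
      (d\<zeta> $ None * (3 * K3 k b b t - K3 k t t t) / 3 - K3 k b t (tail d\<zeta>))"
    by (simp add: W_form_def sum_option tau_entries complex_eq_iff complex_cubic b_def[symmetric] t_def[symmetric]
        sum_subtractf diff_divide_distrib left_diff_distrib K sum_divide_distrib[symmetric] algebra_simps)
  show "W_form k z (Some a) (dz, d\<rho>, d\<zeta>t, d\<zeta>, d\<sigma>) = Complex
      ((tail d\<zeta>t - (d\<zeta> $ None / 2) *\<^sub>R (K2 k b b - K2 k t t) + K2 k b (tail d\<zeta>)) $ a)
      ((K2 k t (tail d\<zeta>) - d\<zeta> $ None *\<^sub>R K2 k b t) $ a)"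
    using sum_C2[of a _ "tail d\<zeta>"]
    by (simp add: W_form_def sum_option tau_entries complex_eq_iff complex_cubic b_def[symmetric] t_def[symmetric]
        sum_negf algebra_simps diff_divide_distrib)
qed

lemma N_mat_mult:
  fixes z :: "complex^'n"
  defines "b \<equiv> re_vec z" and "t \<equiv> im_vec z"
  shows "N_mat k z *v \<xi> = opt (2 / 3 * (3 * K3 k b b t - K3 k t t t) * \<xi> $ None - 2 * K3 k b t (tail \<xi>))
    (2 *\<^sub>R K2 k t (tail \<xi>) - (2 * \<xi> $ None) *\<^sub>R K2 k b t)"
proof -
  have K: "(\<Sum>a\<in>UNIV. K2 k x y $ a * \<xi> $ Some a) = K3 k x y (tail \<xi>)" for x y
    using inner_K2(2)[of x y "tail \<xi>"] by (simp add: inner_vec_def K3_commute)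
  have "(N_mat k z *v \<xi>) $ None = 2 / 3 * (3 * K3 k b b t - K3 k t t t) * \<xi> $ None - 2 * K3 k b t (tail \<xi>)"
    using K[of b t]
    by (simp add: matrix_vector_mult_def N_mat_def sum_option tau_entries complex_cubic b_def[symmetric] t_def[symmetric]
        sum_negf mult.assoc sum_distrib_left[symmetric] algebra_simps diff_divide_distrib)
  moreover have "(N_mat k z *v \<xi>) $ Some a = (2 *\<^sub>R K2 k t (tail \<xi>) - (2 * \<xi> $ None) *\<^sub>R K2 k b t) $ a" for a
    using sum_C2[of a t "tail \<xi>"]
    by (simp add: matrix_vector_mult_def N_mat_def sum_option tau_entries complex_cubic b_def[symmetric] t_def[symmetric]
        sum_negf mult.assoc sum_distrib_left[symmetric] algebra_simps)
  ultimately show ?thesis by (auto simp: vec_eq_iff opt_def split: option.splits)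
qed

definition "iK t = inv_into UNIV (K2 k t)"

end

context psr_cone
begin

lemma iK: "t \<in> U \<Longrightarrow> K2 k t (iK t w) = w" "t \<in> U \<Longrightarrow> iK t (K2 k t v) = v"
proof -
  assume t: "t \<in> U"
  have lin: "linear (K2 k t)"
    using bounded_bilinear.bounded_linear_right[OF bounded_bilinear_K2] linear_conv_bounded_linear by blast
  have inj: "inj (K2 k t)"
    unfolding linear_injective_0[OF lin] using U_nondeg[OF t] by blast
  then have "surj (K2 k t)" using linear_injective_imp_surjective[OF lin] by simp
  then show "K2 k t (iK t w) = w" by (simp add: iK_def surj_f_inv_f)
  show "iK t (K2 k t v) = v" using inj by (simp add: iK_def)
qed

lemma iK_linear: "t \<in> U \<Longrightarrow> iK t (x + y) = iK t x + iK t y" "t \<in> U \<Longrightarrow> iK t (s *\<^sub>R x) = s *\<^sub>R iK t x"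
proof -
  assume t: "t \<in> U"
  have "iK t (x + y) = iK t (K2 k t (iK t x + iK t y))" "iK t (s *\<^sub>R x) = iK t (K2 k t (s *\<^sub>R iK t x))"
    by (simp_all only: K2_simps iK(1)[OF t])
  then show "iK t (x + y) = iK t x + iK t y" "iK t (s *\<^sub>R x) = s *\<^sub>R iK t x"
    by (simp_all only: iK(2)[OF t])
qed

lemma iK_scale: "t \<in> U \<Longrightarrow> 0 < s \<Longrightarrow> iK (s *\<^sub>R t) w = (1 / s) *\<^sub>R iK t w"
proof -
  assume t: "t \<in> U" and s: "0 < s"
  have "iK (s *\<^sub>R t) (K2 k (s *\<^sub>R t) ((1 / s) *\<^sub>R iK t w)) = (1 / s) *\<^sub>R iK t w"
    by (rule iK(2)[OF U_scale[OF t s]])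
  then show ?thesis using s by (simp add: K2_simps iK[OF t])
qed

lemma N_inverse:
  assumes t: "im_vec z \<in> U"
  shows "matrix_inv (N_mat k z) *v \<omega> =
    (let h = K3 k (im_vec z) (im_vec z) (im_vec z) / 6; x = - (\<omega> $ None + re_vec z \<bullet> tail \<omega>) / (4 * h)
     in opt x ((1/2) *\<^sub>R iK (im_vec z) (tail \<omega>) + x *\<^sub>R re_vec z))"
proof -
  let ?b = "re_vec z" and ?t = "im_vec z"
  define h where "h = K3 k ?t ?t ?t / 6"
  have h: "h > 0" using U_pos[OF t] by (simp add: h_def)
  define \<xi> where "\<xi> \<omega> = (let x = - (\<omega> $ None + ?b \<bullet> tail \<omega>) / (4 * h) in opt x ((1/2) *\<^sub>R iK ?t (tail \<omega>) + x *\<^sub>R ?b))" for \<omega>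
  have N: "N_mat k z *v \<xi> \<omega> = \<omega>" for \<omega>
  proof -
    define x where "x = - (\<omega> $ None + ?b \<bullet> tail \<omega>) / (4 * h)"
    have x: "- 4 * h * x = \<omega> $ None + ?b \<bullet> tail \<omega>" using h by (simp add: x_def)
    have K: "K3 k ?b ?t (iK ?t w) = ?b \<bullet> w" for w
      using iK(1)[OF t, of w] by (simp add: K3_def)
    have "K3 k ?t ?t ?t = 6 * h" by (simp add: h_def)
    then have "N_mat k z *v \<xi> \<omega> = opt (- 4 * h * x - ?b \<bullet> tail \<omega>) (tail \<omega>)"
      unfolding N_mat_mult \<xi>_def Let_def x_def[symmetric]
      by (simp add: K_simps K iK(1)[OF t] K2_commute[of ?t ?b] K3_commute(2)[of ?b ?t ?b] option_vec_expand algebra_simps)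
    then show ?thesis unfolding x by (simp add: option_vec_expand)
  qed
  then have "surj (\<lambda>x. N_mat k z *v x)" by (metis surjI)
  then have "invertible (N_mat k z)"
    unfolding invertible_right_inverse matrix_right_invertible_surjective .
  then have inv: "matrix_inv (N_mat k z) ** N_mat k z = mat 1"
    unfolding invertible_def matrix_inv_def by (rule someI2_ex) blast
  have "matrix_inv (N_mat k z) *v \<omega> = matrix_inv (N_mat k z) *v (N_mat k z *v \<xi> \<omega>)" by (simp only: N)
  also have "\<dots> = \<xi> \<omega>" by (simp add: matrix_vector_mul_assoc inv)
  finally show ?thesis unfolding \<xi>_def h_def Let_def .
qed

text \<open>The forms \<open>d\<zeta>\<^sup>a\<close>, \<open>d\<zeta>t\<^sub>a\<close> and \<open>d\<zeta>t\<^sub>0\<close>, pulled back under the translation of the \<open>L\<close>-action that moves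
  the point to \<open>b = 0\<close>.\<close>

definition fy :: "'n iia \<Rightarrow> 'n iia \<Rightarrow> real^'n" where
  "fy = (\<lambda>(z, \<rho>, \<zeta>t, \<zeta>, \<sigma>) (dz, d\<rho>, d\<zeta>t, d\<zeta>, d\<sigma>). tail d\<zeta> - d\<zeta> $ None *\<^sub>R re_vec z)"

definition fA :: "'n iia \<Rightarrow> 'n iia \<Rightarrow> real^'n" where
  "fA = (\<lambda>(z, \<rho>, \<zeta>t, \<zeta>, \<sigma>) (dz, d\<rho>, d\<zeta>t, d\<zeta>, d\<sigma>). tail d\<zeta>t + (d\<zeta> $ None / 2) *\<^sub>R K2 k (re_vec z) (re_vec z)
     + K2 k (re_vec z) (tail d\<zeta> - d\<zeta> $ None *\<^sub>R re_vec z))"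

definition fa :: "'n iia \<Rightarrow> 'n iia \<Rightarrow> real" where
  "fa = (\<lambda>(z, \<rho>, \<zeta>t, \<zeta>, \<sigma>) (dz, d\<rho>, d\<zeta>t, d\<zeta>, d\<sigma>). d\<zeta>t $ None + re_vec z \<bullet> tail d\<zeta>t
     + K3 k (re_vec z) (re_vec z) (re_vec z) * d\<zeta> $ None / 3
     + K3 k (re_vec z) (re_vec z) (tail d\<zeta> - d\<zeta> $ None *\<^sub>R re_vec z) / 2)"

definition metric_form :: "'n iia \<Rightarrow> 'n iia \<Rightarrow> 'n iia \<Rightarrow> real" where
  "metric_form p u v = (let t = im_vec (fst p); \<rho> = fst (snd p); h = K3 k t t t / 6;
      xu = fst (snd (snd (snd u))) $ None; xv = fst (snd (snd (snd v))) $ None in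
    bf t (re_vec (fst u)) (re_vec (fst v)) + bf t (im_vec (fst u)) (im_vec (fst v))
    + fst (snd u) * fst (snd v) / (4 * \<rho>\<^sup>2)
    + 1 / (4 * \<rho>) * (fa p u * fa p v / (2 * h) + K3 k t t (fy p u) * K3 k t t (fy p v) / (8 * h) + h * xu * xv / 2
        + (t \<bullet> fA p u) * (t \<bullet> fA p v) / (4 * h) - fA p u \<bullet> iK t (fA p v) / 2 - K3 k t (fy p u) (fy p v) / 2)
    + 1 / (64 * \<rho>\<^sup>2) * contact_form p u * contact_form p v)"

lemma Re_mult_cnj: "Re (z * cnj w) = Re z * Re w + Im z * Im w"
  by simp

lemma hermitian_sum:
  fixes M :: "real^'m::finite^'m" and c :: real and z W W' :: "'m \<Rightarrow> complex"
  shows "Re (\<Sum>i\<in>UNIV. \<Sum>j\<in>UNIV. (of_real (M $ i $ j) - of_real c * z i * cnj (z j)) * W i * cnj (W' j))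
    = (\<chi> i. Re (W i)) \<bullet> (M *v (\<chi> i. Re (W' i))) + (\<chi> i. Im (W i)) \<bullet> (M *v (\<chi> i. Im (W' i)))
      - c * Re ((\<Sum>i\<in>UNIV. z i * W i) * cnj (\<Sum>i\<in>UNIV. z i * W' i))"
proof -
  have "(\<Sum>i\<in>UNIV. \<Sum>j\<in>UNIV. (of_real (M $ i $ j) - of_real c * z i * cnj (z j)) * W i * cnj (W' j))
    = (\<Sum>i\<in>UNIV. \<Sum>j\<in>UNIV. of_real (M $ i $ j) * (W i * cnj (W' j)))
      - of_real c * ((\<Sum>i\<in>UNIV. z i * W i) * cnj (\<Sum>i\<in>UNIV. z i * W' i))"
  proof -
    have 1: "(\<Sum>i\<in>UNIV. z i * W i) * cnj (\<Sum>i\<in>UNIV. z i * W' i) = (\<Sum>i\<in>UNIV. \<Sum>j\<in>UNIV. z i * W i * cnj (z j * W' j))"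
      by (simp only: cnj_sum sum_product)
    show ?thesis
      unfolding 1 sum_distrib_left sum_subtractf[symmetric]
      by (intro sum.cong refl) (simp add: algebra_simps)
  qed
  moreover have "Re (\<Sum>i\<in>UNIV. \<Sum>j\<in>UNIV. of_real (M $ i $ j) * (W i * cnj (W' j)))
    = (\<chi> i. Re (W i)) \<bullet> (M *v (\<chi> i. Re (W' i))) + (\<chi> i. Im (W i)) \<bullet> (M *v (\<chi> i. Im (W' i)))"
    by (simp add: inner_vec_def matrix_vector_mult_def sum_distrib_left sum.distrib[symmetric] algebra_simps)
  ultimately show ?thesis by simp
qed

lemma metric_formula:
  assumes "p \<in> gen_iia U"
  shows "qmap_metric k p u v = metric_form p u v"
proof -
  obtain z \<rho> \<zeta>t \<zeta> \<sigma> where p: "p = (z, \<rho>, \<zeta>t, \<zeta>, \<sigma>)" by (metis prod.exhaust)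
  obtain du d\<rho>u d\<zeta>tu d\<zeta>u d\<sigma>u where u: "u = (du, d\<rho>u, d\<zeta>tu, d\<zeta>u, d\<sigma>u)" by (metis prod.exhaust)
  obtain dv d\<rho>v d\<zeta>tv d\<zeta>v d\<sigma>v where v: "v = (dv, d\<rho>v, d\<zeta>tv, d\<zeta>v, d\<sigma>v)" by (metis prod.exhaust)
  define b where "b = re_vec z"
  define t where "t = im_vec z"
  define h where "h = K3 k t t t / 6"
  have t: "t \<in> U" and r: "\<rho> > 0" using assms by (auto simp: p gen_iia_def t_def)
  have h: "h > 0" using U_pos[OF t] by (simp add: h_def)
  have h6: "K3 k t t t = 6 * h" by (simp add: h_def)
  define xu where "xu = d\<zeta>u $ None"
  define xv where "xv = d\<zeta>v $ None"
  define yu where "yu = fy p u"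
  define yv where "yv = fy p v"
  define Au where "Au = fA p u"
  define Av where "Av = fA p v"
  define au where "au = fa p u"
  define av where "av = fa p v"
  have tu: "tail d\<zeta>u = yu + xu *\<^sub>R b" "tail d\<zeta>v = yv + xv *\<^sub>R b"
    by (simp_all add: yu_def yv_def xu_def xv_def fy_def p u v b_def)
  have Wu: "(\<chi> i. Re (W_form k z i w)) = opt (a + K3 k t t y / 2 - b \<bullet> (A + (x / 2) *\<^sub>R K2 k t t)) (A + (x / 2) *\<^sub>R K2 k t t)"
    "(\<chi> i. Im (W_form k z i w)) = opt (- 2 * h * x - b \<bullet> K2 k t y) (K2 k t y)"
    if "a = fa p w" "A = fA p w" "y = fy p w" "x = fst (snd (snd (snd w))) $ None" for w a A y x
  proof -
    obtain dz d\<rho> d\<zeta>t d\<zeta> d\<sigma> where w: "w = (dz, d\<rho>, d\<zeta>t, d\<zeta>, d\<sigma>)" by (metis prod.exhaust)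
    have x: "d\<zeta> $ None = x" using that(4) by (simp add: w)
    have y: "tail d\<zeta> = y + x *\<^sub>R b" using that(3,4) by (simp add: w p fy_def b_def)
    have A: "tail d\<zeta>t = A - (x / 2) *\<^sub>R K2 k b b - K2 k b y"
      by (simp add: that(2,3) w p fA_def fy_def b_def x[symmetric])
    have a: "d\<zeta>t $ None = a - b \<bullet> tail d\<zeta>t - K3 k b b b * x / 3 - K3 k b b y / 2"
      by (simp add: that(1,3) w p fa_def fy_def b_def x[symmetric])
    have "(\<chi> i. Re (W_form k z i w)) $ None = a + K3 k t t y / 2 - b \<bullet> (A + (x / 2) *\<^sub>R K2 k t t)"
      unfolding w by (simp add: W_form_eq b_def[symmetric] t_def[symmetric] x a)
        (simp add: y A K_simps K3_commute algebra_simps add_divide_distrib diff_divide_distrib)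
    moreover have "(\<chi> i. Im (W_form k z i w)) $ None = - 2 * h * x - b \<bullet> K2 k t y"
      unfolding w by (simp add: W_form_eq b_def[symmetric] t_def[symmetric] x)
        (simp add: y K_simps K3_commute h_def algebra_simps add_divide_distrib diff_divide_distrib)
    moreover have "tail (\<chi> i. Re (W_form k z i w)) = A + (x / 2) *\<^sub>R K2 k t t"
    proof -
      have "tail (\<chi> i. Re (W_form k z i w)) = tail d\<zeta>t - (x / 2) *\<^sub>R (K2 k b b - K2 k t t) + K2 k b (tail d\<zeta>)"
        unfolding w by (simp add: vec_eq_iff W_form_eq b_def[symmetric] t_def[symmetric] x)
      then show ?thesis by (simp add: y A K_simps algebra_simps scaleR_left_distrib[symmetric])
    qed
    moreover have "tail (\<chi> i. Im (W_form k z i w)) = K2 k t y"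
    proof -
      have "tail (\<chi> i. Im (W_form k z i w)) = K2 k t (tail d\<zeta>) - x *\<^sub>R K2 k b t"
        unfolding w by (simp add: vec_eq_iff W_form_eq b_def[symmetric] t_def[symmetric] x)
      then show ?thesis by (simp add: y K_simps K2_commute[of t b])
    qed
    ultimately show "(\<chi> i. Re (W_form k z i w)) = opt (a + K3 k t t y / 2 - b \<bullet> (A + (x / 2) *\<^sub>R K2 k t t)) (A + (x / 2) *\<^sub>R K2 k t t)"
      "(\<chi> i. Im (W_form k z i w)) = opt (- 2 * h * x - b \<bullet> K2 k t y) (K2 k t y)"
      by (simp_all only: opt_cong)
  qed
  have zW: "Re (\<Sum>i\<in>UNIV. homog z $ i * W i) = R $ None + b \<bullet> tail R - t \<bullet> tail I"
    "Im (\<Sum>i\<in>UNIV. homog z $ i * W i) = I $ None + b \<bullet> tail I + t \<bullet> tail R"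
    if "R = (\<chi> i. Re (W i))" "I = (\<chi> i. Im (W i))" for W :: "'n option \<Rightarrow> complex" and R I
    by (simp_all add: that sum_option homog_def inner_vec_def b_def t_def re_vec_def im_vec_def sum_subtractf sum.distrib)
  have xuv: "xu = fst (snd (snd (snd u))) $ None" "xv = fst (snd (snd (snd v))) $ None" by (simp_all add: u v xu_def xv_def)
  note Ru = Wu[OF au_def Au_def yu_def xuv(1)] and Rv = Wu[OF av_def Av_def yv_def xuv(2)]
  have iK2: "iK t (K2 k t w) = w" "K2 k t (iK t w) = w" for w using iK[OF t] by auto
  have tA: "K3 k t t (iK t w) = t \<bullet> w" for w using iK2(2)[of w] by (simp add: K3_def)
  have N: "opt (\<alpha> - b \<bullet> w) w \<bullet> (matrix_inv (N_mat k z) *v opt (\<alpha>' - b \<bullet> w') w') = - \<alpha> * \<alpha>' / (4 * h) + w \<bullet> iK t w' / 2"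
    for \<alpha> \<alpha>' w w'
    unfolding N_inverse[OF t[unfolded t_def]] b_def[symmetric] t_def[symmetric] h_def[symmetric]
    by (simp add: option_vec_expand(2) Let_def inner_simps inner_commute algebra_simps add_divide_distrib diff_divide_distrib)
  have RA: "(Au + (xu / 2) *\<^sub>R K2 k t t) \<bullet> iK t (Av + (xv / 2) *\<^sub>R K2 k t t)
      = Au \<bullet> iK t Av + xv / 2 * (t \<bullet> Au) + xu / 2 * (t \<bullet> Av) + xu * xv / 4 * (6 * h)"
    by (simp add: iK_linear[OF t] iK2 inner_simps inner_K2 tA K3_commute h6 inner_commute algebra_simps)
  have E: "Re (\<Sum>i\<in>UNIV. \<Sum>j\<in>UNIV. (of_real (matrix_inv (N_mat k z) $ i $ j) - of_real (2 / (8 * h)) * homog z $ i * cnj (homog z $ j)) *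
         W_form k z i u * cnj (W_form k z j v))
    = - (au * av / (2 * h) + K3 k t t yu * K3 k t t yv / (8 * h) + h * xu * xv / 2
        + (t \<bullet> Au) * (t \<bullet> Av) / (4 * h) - Au \<bullet> iK t Av / 2 - K3 k t yu yv / 2)"
  proof -
    have 1: "Re (\<Sum>i\<in>UNIV. homog z $ i * W_form k z i u) = au - K3 k t t yu / 2"
      "Re (\<Sum>i\<in>UNIV. homog z $ i * W_form k z i v) = av - K3 k t t yv / 2"
      "Im (\<Sum>i\<in>UNIV. homog z $ i * W_form k z i u) = - 2 * h * xu + t \<bullet> Au + 3 * h * xu"
      "Im (\<Sum>i\<in>UNIV. homog z $ i * W_form k z i v) = - 2 * h * xv + t \<bullet> Av + 3 * h * xv"
      by (simp_all only: zW[OF refl refl] Ru Rv) (simp_all add: inner_simps inner_K2 h6)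
    have 2: "K2 k t yu \<bullet> iK t (K2 k t yv) = K3 k t yu yv"
      by (simp only: iK2 inner_K2 K3_commute)
    show ?thesis
      unfolding hermitian_sum Ru Rv N RA 2 Re_mult_cnj 1
      using h by (simp add: field_simps power2_eq_square)
  qed
  have cu: "cubic k (im_vec z) = h" by (simp add: cubic_real h_def t_def)
  have fp: "fst p = z" "fst (snd p) = \<rho>" by (simp_all add: p)
  have q: "qmap_metric k p u v = base_metric k z (fst u) (fst v) + fst (snd u) * fst (snd v) / (4 * \<rho>\<^sup>2)
     - 1 / (4 * \<rho>) * Re (\<Sum>i\<in>UNIV. \<Sum>j\<in>UNIV. (of_real (matrix_inv (N_mat k z) $ i $ j) - of_real (2 / (8 * h)) * homog z $ i * cnj (homog z $ j)) *
         W_form k z i u * cnj (W_form k z j v))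
     + 1 / (64 * \<rho>\<^sup>2) * contact_form p u * contact_form p v"
    unfolding qmap_metric_def Let_def p prod.case cu by (rule refl)
  have pos: "0 < K3 k (im_vec z) (im_vec z) (im_vec z)" using U_pos[OF t] by (simp add: t_def)
  show ?thesis
    unfolding q E base_metric_eq[OF pos] metric_form_def Let_def fp t_def[symmetric] h_def[symmetric]
      xuv[symmetric] au_def[symmetric] av_def[symmetric] Au_def[symmetric] Av_def[symmetric] yu_def[symmetric] yv_def[symmetric]
    by (simp add: algebra_simps)
qed

end

section \<open>Isometries\<close>

lemma contact_form_eq: "contact_form (z, \<rho>, \<zeta>t, \<zeta>, \<sigma>) (dz, d\<rho>, d\<zeta>t, d\<zeta>, d\<sigma>) = d\<sigma> + \<zeta>t \<bullet> d\<zeta> - \<zeta> \<bullet> d\<zeta>t"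
  by (simp add: contact_form_def inner_vec_def sum_subtractf)

context psr_cone
begin

definition "isom g p \<longleftrightarrow> (\<forall>u v. qmap_metric k (actA k g p) (frechet_derivative (actA k g) (at p) u)
    (frechet_derivative (actA k g) (at p) v) = qmap_metric k p u v)"

lemma smooth_act_fixed: "g \<in> gp_dom \<Longrightarrow> smooth_on NN (actA k g)"
  using smooth_on_compose[OF open_gen_iia open_Times[OF open_gp_dom open_gen_iia] _ smooth_actA, of "\<lambda>p. (g, p)"]
  by (simp add: smooth_intros open_gen_iia image_subset_iff)

lemma act_has_derivative:
  "g \<in> gp_dom \<Longrightarrow> p \<in> NN \<Longrightarrow> (actA k g has_derivative frechet_derivative (actA k g) (at p)) (at p)"
  by (rule smooth_on_imp_has_derivative[OF smooth_act_fixed])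

lemma act_derivativeI:
  assumes "p \<in> NN" "(f has_derivative f') (at p)" "\<And>q. q \<in> NN \<Longrightarrow> f q = actA k g q"
  shows "frechet_derivative (actA k g) (at p) = f'"
  using frechet_derivative_at[OF has_derivative_transform_within_open[OF assms(2) open_gen_iia assms(1,3)]] by simp

lemma isomI:
  assumes "p \<in> NN" "(f has_derivative f') (at p)" "\<And>q. q \<in> NN \<Longrightarrow> f q = actA k g q"
    "\<And>u v. metric_form (f p) (f' u) (f' v) = metric_form p u v" "g \<in> gp_dom"
  shows "isom g p"
proof -
  have D: "frechet_derivative (actA k g) (at p) = f'"
    by (rule act_derivativeI[OF assms(1-3)])
  show ?thesis
    unfolding isom_def D
  proof (intro allI)
    show "qmap_metric k (actA k g p) (f' u) (f' v) = qmap_metric k p u v" for u v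
      using assms(4)[of u v] unfolding metric_formula[OF assms(1)] metric_formula[OF actA_in[OF assms(5,1)]]
        assms(3)[OF assms(1)] .
  qed
qed

lemma isom_mul:
  assumes g: "g \<in> gp_dom" "h \<in> gp_dom" and p: "p \<in> NN" and isom: "isom h p" "isom g (actA k h p)"
  shows "isom (gp_mul k g h) p"
proof -
  have "((\<lambda>q. actA k g (actA k h q)) has_derivative
      (\<lambda>u. frechet_derivative (actA k g) (at (actA k h p)) (frechet_derivative (actA k h) (at p) u))) (at p)"
    by (rule has_derivative_compose[OF act_has_derivative[OF g(2) p] act_has_derivative[OF g(1) actA_in[OF g(2) p]]])
  from act_derivativeI[OF p this, of "gp_mul k g h"]
  have D: "frechet_derivative (actA k (gp_mul k g h)) (at p) =
      (\<lambda>u. frechet_derivative (actA k g) (at (actA k h p)) (frechet_derivative (actA k h) (at p) u))"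
    by (simp add: actA_mul[OF g])
  show ?thesis
    unfolding isom_def D actA_mul[OF g p]
    using isom unfolding isom_def by metis
qed

lemma isom_inv:
  assumes g: "g \<in> gp_dom" and p: "p \<in> NN" and isom: "isom g p"
  shows "isom (gp_inv g) (actA k g p)"
proof -
  let ?q = "actA k g p" and ?i = "gp_inv g"
  have i: "?i \<in> gp_dom" and q: "?q \<in> NN" using gp_inv_in[OF g] actA_in[OF g p] by simp_all
  have iq: "actA k ?i ?q = p" by (rule act_iv(1)[OF g p])
  let ?D = "frechet_derivative (actA k g) (at p)" and ?E = "frechet_derivative (actA k ?i) (at ?q)"
  have "((\<lambda>r. actA k g (actA k ?i r)) has_derivative (\<lambda>u. ?D (?E u))) (at ?q)"
    by (rule has_derivative_compose[OF act_has_derivative[OF i q]]) (simp add: iq act_has_derivative[OF g p])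
  then have "((\<lambda>r. r) has_derivative (\<lambda>u. ?D (?E u))) (at ?q)"
    by (rule has_derivative_transform_within_open[OF _ open_gen_iia q]) (rule act_iv(2)[OF g])
  then have DE: "?D (?E u) = u" for u
    using has_derivative_unique[OF has_derivative_ident] by metis
  show ?thesis
    unfolding isom_def iq
  proof (intro allI)
    show "qmap_metric k p (?E u) (?E v) = qmap_metric k ?q u v" for u v
      using isom[unfolded isom_def, rule_format, of "?E u" "?E v"] by (simp only: DE)
  qed
qed

lemma isom_L2:
  assumes r: "0 < r" and p: "p \<in> NN"
  shows "isom ((sqrt r, \<eta> $ None, 0, 1),
      (- tail \<eta>, 0, tail \<eta>t, - (\<kappa> + \<eta> $ None * \<eta>t $ None + tail \<eta>t \<bullet> tail \<eta>) / 2, - (\<eta>t $ None))) p"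
proof (rule isomI[OF p])
  define s where "s = sqrt r"
  have s: "s > 0" "r = s * s" using r by (auto simp: s_def)
  let ?F' = "\<lambda>(dz, d\<rho>, d\<zeta>t, d\<zeta>, d\<sigma>). (dz, r * d\<rho>, s *\<^sub>R d\<zeta>t, s *\<^sub>R d\<zeta>, r * d\<sigma> + s * (\<eta> \<bullet> d\<zeta>t - \<eta>t \<bullet> d\<zeta>)) :: 'n iia"
  have sum: "(\<Sum>i\<in>UNIV. \<eta> $ i * \<zeta>t $ i - \<eta>t $ i * \<zeta> $ i) = \<eta> \<bullet> \<zeta>t - \<eta>t \<bullet> \<zeta>" for \<zeta>t \<zeta>
    by (simp add: inner_vec_def sum_subtractf)
  show "(L2_transf r \<eta>t \<eta> \<kappa> has_derivative ?F') (at p)"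
    unfolding L2_transf_def sum split_beta s_def[symmetric]
    apply (rule has_derivative_eq_rhs, (rule derivative_intros has_derivative_Pair)+)
    apply (auto simp: fun_eq_iff)
    done
  show "L2_transf r \<eta>t \<eta> \<kappa> q = actA k ((sqrt r, \<eta> $ None, 0, 1),
      (- tail \<eta>, 0, tail \<eta>t, - (\<kappa> + \<eta> $ None * \<eta>t $ None + tail \<eta>t \<bullet> tail \<eta>) / 2, - (\<eta>t $ None))) q" if "q \<in> NN" for q
    by (rule L2_actA[OF r that, symmetric])
  have t: "im_vec (fst p) \<in> U" "0 < fst (snd p)" using p by (auto simp: gen_iia_def)
  have f: "fy (L2_transf r \<eta>t \<eta> \<kappa> p) (?F' u) = s *\<^sub>R fy p u" "fA (L2_transf r \<eta>t \<eta> \<kappa> p) (?F' u) = s *\<^sub>R fA p u"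
    "fa (L2_transf r \<eta>t \<eta> \<kappa> p) (?F' u) = s * fa p u" "contact_form (L2_transf r \<eta>t \<eta> \<kappa> p) (?F' u) = r * contact_form p u" for u
  proof -
    obtain dz d\<rho> d\<zeta>t d\<zeta> d\<sigma> where u: "u = (dz, d\<rho>, d\<zeta>t, d\<zeta>, d\<sigma>)" by (metis prod.exhaust)
    obtain z \<rho> \<zeta>t \<zeta> \<sigma> where p: "p = (z, \<rho>, \<zeta>t, \<zeta>, \<sigma>)" by (metis prod.exhaust)
    show "fy (L2_transf r \<eta>t \<eta> \<kappa> p) (?F' u) = s *\<^sub>R fy p u" "fA (L2_transf r \<eta>t \<eta> \<kappa> p) (?F' u) = s *\<^sub>R fA p u"
      "fa (L2_transf r \<eta>t \<eta> \<kappa> p) (?F' u) = s * fa p u"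
      by (simp_all add: u p fy_def fA_def fa_def L2_transf_def tail_simps K_simps algebra_simps)
    show "contact_form (L2_transf r \<eta>t \<eta> \<kappa> p) (?F' u) = r * contact_form p u"
      unfolding u p contact_form_eq L2_transf_def prod.case s_def[symmetric]
      by (simp add: s(2) inner_simps inner_commute algebra_simps)
  qed
  show "metric_form (L2_transf r \<eta>t \<eta> \<kappa> p) (?F' u) (?F' v) = metric_form p u v" for u v
  proof -
    have 1: "fst (L2_transf r \<eta>t \<eta> \<kappa> p) = fst p" "fst (snd (L2_transf r \<eta>t \<eta> \<kappa> p)) = r * fst (snd p)"
      by (simp_all add: L2_transf_def split_beta)
    have 2: "fst (?F' w) = fst w" "fst (snd (?F' w)) = r * fst (snd w)" "fst (snd (snd (snd (?F' w)))) $ None = s * fst (snd (snd (snd w))) $ None" for w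
      by (simp_all add: split_beta)
    show ?thesis
      unfolding metric_form_def f Let_def 1 2 iK_linear[OF t(1)] K3_simps inner_simps
      unfolding s(2) using s(1) t(2) U_pos[OF t(1)] by (simp add: field_simps power2_eq_square)
  qed
qed (use r in \<open>simp add: gp_dom_def gl_det_def\<close>)

lemma bf_scale: "0 < s \<Longrightarrow> bf (s *\<^sub>R t) (s *\<^sub>R x) (s *\<^sub>R y) = bf t x y"
  by (cases "K3 k t t t = 0") (simp_all add: bf_def K3_simps field_simps power2_eq_square)

lemma isom_dilation:
  assumes s: "0 < s" and p: "p \<in> NN"
  shows "isom ((s powr (-1/2), 0, 0, s), 0) p"
proof (rule isomI[OF p])
  define q where "q = sqrt s"
  have q: "q > 0" "s = q * q" using s by (auto simp: q_def)
  let ?F = "\<lambda>(z, \<rho>, \<zeta>t, \<zeta>, \<sigma>). (s *\<^sub>R z, \<rho>, opt (q^3 * \<zeta>t $ None) (q *\<^sub>R tail \<zeta>t), opt (1 / q^3 * \<zeta> $ None) ((1 / q) *\<^sub>R tail \<zeta>), \<sigma>) :: 'n iia"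
  have F: "L1_dilation s = ?F"
    unfolding L1_dilation_eq[OF s] q_def ..
  show "(?F has_derivative ?F) (at p)"
    unfolding split_beta
    apply (rule has_derivative_eq_rhs, (rule derivative_intros has_derivative_Pair)+)
    apply (auto simp: fun_eq_iff)
    done
  show "?F r = actA k ((s powr (-1/2), 0, 0, s), 0) r" if "r \<in> NN" for r
    using L1_dilation_actA[OF s that] unfolding F by simp
  have t: "im_vec (fst p) \<in> U" "0 < fst (snd p)" using p by (auto simp: gen_iia_def)
  have f: "fy (?F p) (?F u) = (1 / q) *\<^sub>R fy p u" "fA (?F p) (?F u) = q *\<^sub>R fA p u"
    "fa (?F p) (?F u) = q^3 * fa p u" "contact_form (?F p) (?F u) = contact_form p u" for u
  proof -
    obtain dz d\<rho> d\<zeta>t d\<zeta> d\<sigma> where u: "u = (dz, d\<rho>, d\<zeta>t, d\<zeta>, d\<sigma>)" by (metis prod.exhaust)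
    obtain z \<rho> \<zeta>t \<zeta> \<sigma> where p: "p = (z, \<rho>, \<zeta>t, \<zeta>, \<sigma>)" by (metis prod.exhaust)
    show "fy (?F p) (?F u) = (1 / q) *\<^sub>R fy p u" "fA (?F p) (?F u) = q *\<^sub>R fA p u"
      "fa (?F p) (?F u) = q^3 * fa p u"
      using q(1) by (simp_all add: u p fy_def fA_def fa_def q(2) tail_simps re_im_vec_simps K_simps power3_eq_cube algebra_simps divide_simps)
    show "contact_form (?F p) (?F u) = contact_form p u"
      using q(1) unfolding u p contact_form_eq prod.case option_vec_expand(2)
      by (simp add: inner_simps power3_eq_cube)
  qed
  show "metric_form (?F p) (?F u) (?F v) = metric_form p u v" for u v
  proof -
    obtain du d\<rho>u d\<zeta>tu d\<zeta>u d\<sigma>u where u: "u = (du, d\<rho>u, d\<zeta>tu, d\<zeta>u, d\<sigma>u)" by (metis prod.exhaust)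
    obtain dv d\<rho>v d\<zeta>tv d\<zeta>v d\<sigma>v where v: "v = (dv, d\<rho>v, d\<zeta>tv, d\<zeta>v, d\<sigma>v)" by (metis prod.exhaust)
    have 1: "fst (?F w) = s *\<^sub>R fst w" "fst (snd (?F w)) = fst (snd w)" "fst (snd (snd (snd (?F w)))) $ None = fst (snd (snd (snd w))) $ None / q^3" for w
      by (simp_all add: split_beta)
    show ?thesis
      unfolding metric_form_def f Let_def 1 re_im_vec_simps bf_scale[OF s] iK_scale[OF t(1) s] iK_linear[OF t(1)]
      using q(1) t(2) U_pos[OF t(1)] by (simp add: q(2) K_simps field_simps power2_eq_square power3_eq_cube)
  qed
qed (use s in \<open>simp add: gp_dom_def gl_det_def\<close>)

lemma isom_translation:
  assumes p: "p \<in> NN"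
  shows "isom (gl_one, (0, w, 0, 0, 0)) p"
proof (rule isomI[OF p])
  let ?F = "L1_translation k w"
  let ?F' = "\<lambda>(dz, d\<rho>, d\<zeta>t, d\<zeta>, d\<sigma>). (dz, d\<rho>,
    opt (d\<zeta>t $ None + 1/6 * K3 k w w w * d\<zeta> $ None + 1/2 * K3 k w w (tail d\<zeta>) - tail d\<zeta>t \<bullet> w)
        (tail d\<zeta>t - (1/2 * d\<zeta> $ None) *\<^sub>R K2 k w w - K2 k w (tail d\<zeta>)),
    opt (d\<zeta> $ None) (tail d\<zeta> + d\<zeta> $ None *\<^sub>R w), d\<sigma>) :: 'n iia"
  show "(?F has_derivative ?F') (at p)"
    unfolding L1_translation_eq split_beta
    apply (rule has_derivative_eq_rhs, (rule derivative_intros has_derivative_Pair)+)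
    apply (simp add: fun_eq_iff K_simps complex_vec_expand re_im_vec_simps)
    done
  show "?F r = actA k (gl_one, (0, w, 0, 0, 0)) r" if "r \<in> NN" for r
    by (rule L1_translation_actA[OF that, symmetric])
  have f: "fy (?F p) (?F' u) = fy p u" "fA (?F p) (?F' u) = fA p u"
    "fa (?F p) (?F' u) = fa p u" "contact_form (?F p) (?F' u) = contact_form p u" for u
  proof -
    obtain dz d\<rho> d\<zeta>t d\<zeta> d\<sigma> where u: "u = (dz, d\<rho>, d\<zeta>t, d\<zeta>, d\<sigma>)" by (metis prod.exhaust)
    obtain z \<rho> \<zeta>t \<zeta> \<sigma> where p: "p = (z, \<rho>, \<zeta>t, \<zeta>, \<sigma>)" by (metis prod.exhaust)
    show "fy (?F p) (?F' u) = fy p u" "fA (?F p) (?F' u) = fA p u" "fa (?F p) (?F' u) = fa p u"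
      by (simp_all add: u p fy_def fA_def fa_def L1_translation_eq tail_simps K_simps K3_commute K2_commute numeral_mult_vec mult_numeral_vec
        inner_commute algebra_simps add_divide_distrib diff_divide_distrib)
    show "contact_form (?F p) (?F' u) = contact_form p u"
      unfolding u p L1_translation_eq prod.case contact_form_eq option_vec_expand(2)
      by (simp add: K_simps K3_commute inner_commute algebra_simps)
  qed
  show "metric_form (?F p) (?F' u) (?F' v) = metric_form p u v" for u v
    unfolding metric_form_def f Let_def by (simp add: L1_translation_eq split_beta)
qed (simp add: gp_dom_def gl_det_def)

lemma isom_upper:
  assumes "0 < a" "0 < d" "p \<in> NN"
  shows "isom ((a, b, 0, d), n) p"
proof -
  obtain \<gamma> \<beta> \<alpha> \<theta> \<theta>' where n: "n = (\<gamma>, \<beta>, \<alpha>, \<theta>, \<theta>')" by (metis prod.exhaust)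
  define m where "m = nil_mul k (nil_inv (0, \<beta>, 0, 0, 0)) n"
  obtain \<gamma>' \<alpha>' \<mu> \<mu>' where m: "m = (\<gamma>', 0, \<alpha>', \<mu>, \<mu>')"
    by (simp add: m_def n nil_mul_def nil_inv_def)
  have nm: "nil_mul k (0, \<beta>, 0, 0, 0) m = n"
    unfolding m_def nil_mul_assoc[symmetric] nil_inv by simp
  define r where "r = a\<^sup>2 * d"
  have r: "r > 0" and sr: "sqrt r = a * sqrt d" using assms by (simp_all add: r_def real_sqrt_mult)
  define \<eta> where "\<eta> = opt (b / d) (- \<gamma>')"
  define \<eta>t where "\<eta>t = opt (- \<mu>') \<alpha>'"
  define \<kappa> where "\<kappa> = - 2 * \<mu> - (b / d * (- \<mu>') + \<alpha>' \<bullet> (- \<gamma>'))"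
  have L2: "isom ((a * sqrt d, b / d, 0, 1), m) q" if "q \<in> NN" for q
    using isom_L2[OF r that, of \<eta> \<eta>t \<kappa>] by (simp add: m sr \<eta>_def \<eta>t_def \<kappa>_def)
  have pd: "d powr (-1/2) = 1 / sqrt d" using assms by (simp add: powr_minus_divide powr_half_sqrt)
  have g1: "((a * sqrt d, b / d, 0, 1), m) \<in> gp_dom" using assms by (simp add: gp_dom_def gl_det_def)
  have g2: "((d powr (-1/2), 0, 0, d), 0) \<in> gp_dom" using assms by (simp add: gp_dom_def gl_det_def pd)
  have g3: "(gl_one, (0, \<beta>, 0, 0, 0)) \<in> gp_dom" by (simp add: gp_dom_def gl_det_def)
  have "isom (gp_mul k ((a * sqrt d, b / d, 0, 1), m) ((d powr (-1/2), 0, 0, d), 0)) p"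
    by (intro isom_mul[OF g1 g2 assms(3)] isom_dilation L2 actA_in g2 assms)
  moreover have "gp_mul k ((a * sqrt d, b / d, 0, 1), m) ((d powr (-1/2), 0, 0, d), 0) = ((a, b, 0, d), m)"
    using assms by (simp add: gp_mul_def gl_mul_def pd[simplified])
  ultimately have 1: "isom ((a, b, 0, d), m) p" by simp
  have g4: "((a, b, 0, d), m) \<in> gp_dom" using assms by (simp add: gp_dom_def gl_det_def)
  have "isom (gp_mul k (gl_one, (0, \<beta>, 0, 0, 0)) ((a, b, 0, d), m)) p"
    by (intro isom_mul[OF g3 g4 assms(3) 1] isom_translation actA_in g4 assms(3))
  then show ?thesis by (simp add: gp_mul_def gl_mul_def nm)
qed

definition base_pt :: "real^'n \<Rightarrow> 'n tb" where
  "base_pt t = ((t, \<i>), (0, 0, 0, 0, 0))"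

lemma base_pt_in: "t \<in> U \<Longrightarrow> base_pt t \<in> gen_tb U"
  by (simp add: base_pt_def gen_tb_def)

text \<open>The metric at \<open>(t, \<i>, 0)\<close> in type IIB coordinates.\<close>

definition metric_base :: "real^'n \<Rightarrow> 'n tb \<Rightarrow> 'n tb \<Rightarrow> real" where
  "metric_base t = (\<lambda>((dt, d\<tau>), (dc, db, dl, d\<psi>, d\<omega>)) ((dt', d\<tau>'), (dc', db', dl', d\<psi>', d\<omega>')). let h = K3 k t t t / 6 in
    bf t db db' + bf t dc dc' + (d\<psi> * d\<psi>' + d\<omega> * d\<omega>') / (4 * h\<^sup>2)
    + bf t dt dt' + (Im d\<tau> + K3 k t t dt / (4 * h)) * (Im d\<tau>' + K3 k t t dt' / (4 * h)) + Re d\<tau> * Re d\<tau>' / 4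
    + ((t \<bullet> dl) * (t \<bullet> dl') / (4 * h) - dl \<bullet> iK t dl' / 2) / (2 * h))"

lemma metric_form_base:
  assumes t: "t \<in> U"
  shows "metric_form (to_iia k (base_pt t)) (d_to_iia k (base_pt t) u) (d_to_iia k (base_pt t) v) = metric_base t u v"
proof -
  obtain dt d\<tau> dc db dl d\<psi> d\<omega> where u: "u = ((dt, d\<tau>), (dc, db, dl, d\<psi>, d\<omega>))" by (metis prod.exhaust)
  obtain dt' d\<tau>' dc' db' dl' d\<psi>' d\<omega>' where v: "v = ((dt', d\<tau>'), (dc', db', dl', d\<psi>', d\<omega>'))" by (metis prod.exhaust)
  define h where "h = K3 k t t t / 6"
  have h: "h > 0" "K3 k t t t = 6 * h" using U_pos[OF t] by (simp_all add: h_def)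
  have "0 = opt 0 (0 :: real^'n)" by (rule opt_zero[symmetric])
  have p: "to_iia k (base_pt t) = (cvec 0 t, h / 2, 0, 0, 0)"
    by (simp add: to_iia_def base_pt_def Let_def K_simps h opt_zero)
  have d: "d_to_iia k (base_pt t) ((dt, d\<tau>), (dc, db, dl, d\<psi>, d\<omega>)) =
      (cvec db dt, Im d\<tau> * h + K3 k t t dt / 4, opt (- d\<omega>) dl, opt (Re d\<tau>) (- dc), - 2 * d\<psi>)" for dt d\<tau> dc db dl d\<psi> d\<omega>
    by (simp add: d_to_iia_def base_pt_def Let_def K_simps h)
  show ?thesis
    unfolding p u v d metric_form_def metric_base_def prod.case Let_def fst_conv snd_conv cvec_simps h_def[symmetric]
    using h
    by (simp add: fy_def fA_def fa_def contact_form_eq K_simps bf_def h_def[symmetric] field_simps power2_eq_square)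
qed

lemma bf_bilinear: "bf t (x + x') y = bf t x y + bf t x' y" "bf t x (y + y') = bf t x y + bf t x y'"
  "bf t (s *\<^sub>R x) y = s * bf t x y" "bf t x (s *\<^sub>R y) = s * bf t x y"
  "bf t (x - x') y = bf t x y - bf t x' y" "bf t x (y - y') = bf t x y - bf t x y'"
  by (simp_all add: bf_def K3_simps algebra_simps add_divide_distrib diff_divide_distrib)

lemma bf_radial:
  assumes "0 < K3 k t t t"
  shows "bf t t x = K3 k t t x / (8 * (K3 k t t t / 6))" "bf t x t = K3 k t t x / (8 * (K3 k t t t / 6))"
  using assms by (simp_all add: bf_def K3_commute field_simps power2_eq_square)

text \<open>The differential at \<open>(t, \<i>, 0)\<close> of the action of the rotation with cosine \<open>C\<close> and sine \<open>S\<close>.\<close>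

definition d_rot :: "real \<Rightarrow> real \<Rightarrow> real^'n \<Rightarrow> 'n tb \<Rightarrow> 'n tb" where
  "d_rot C S t = (\<lambda>((dt, d\<tau>), (dc, db, dl, d\<psi>, d\<omega>)).
    ((dt + (S * (C * Re d\<tau> + S * Im d\<tau>)) *\<^sub>R t, d\<tau> * (Complex C (- S))\<^sup>2),
     (C *\<^sub>R dc - S *\<^sub>R db, S *\<^sub>R dc + C *\<^sub>R db, dl, C * d\<psi> - S * d\<omega>, S * d\<psi> + C * d\<omega>)))"

lemma metric_base_rot:
  assumes t: "t \<in> U" and CS: "C\<^sup>2 + S\<^sup>2 = 1"
  shows "metric_base t (d_rot C S t u) (d_rot C S t v) = metric_base t u v"
proof -
  obtain dt d\<tau> dc db dl d\<psi> d\<omega> where u: "u = ((dt, d\<tau>), (dc, db, dl, d\<psi>, d\<omega>))" by (metis prod.exhaust)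
  obtain dt' d\<tau>' dc' db' dl' d\<psi>' d\<omega>' where v: "v = ((dt', d\<tau>'), (dc', db', dl', d\<psi>', d\<omega>'))" by (metis prod.exhaust)
  define h where "h = K3 k t t t / 6"
  have h: "h > 0" "K3 k t t t = 6 * h" using U_pos[OF t] by (simp_all add: h_def)
  have 1: "bf t (S *\<^sub>R dc + C *\<^sub>R db) (S *\<^sub>R dc' + C *\<^sub>R db') + bf t (C *\<^sub>R dc - S *\<^sub>R db) (C *\<^sub>R dc' - S *\<^sub>R db')
      = bf t db db' + bf t dc dc'"
  proof -
    have "bf t (S *\<^sub>R dc + C *\<^sub>R db) (S *\<^sub>R dc' + C *\<^sub>R db') + bf t (C *\<^sub>R dc - S *\<^sub>R db) (C *\<^sub>R dc' - S *\<^sub>R db')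
      = (C\<^sup>2 + S\<^sup>2) * (bf t db db' + bf t dc dc')"
      by (simp add: bf_bilinear power2_eq_square algebra_simps)
    then show ?thesis by (simp add: CS)
  qed
  have 2: "(C * d\<psi> - S * d\<omega>) * (C * d\<psi>' - S * d\<omega>') + (S * d\<psi> + C * d\<omega>) * (S * d\<psi>' + C * d\<omega>') = d\<psi> * d\<psi>' + d\<omega> * d\<omega>'"
  proof -
    have "(C * d\<psi> - S * d\<omega>) * (C * d\<psi>' - S * d\<omega>') + (S * d\<psi> + C * d\<omega>) * (S * d\<psi>' + C * d\<omega>') = (C\<^sup>2 + S\<^sup>2) * (d\<psi> * d\<psi>' + d\<omega> * d\<omega>')"
      by (simp add: power2_eq_square algebra_simps)
    then show ?thesis by (simp add: CS)
  qed
  define \<mu> where "\<mu> d = S * (C * Re d + S * Im d)" for d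
  have CC: "C\<^sup>2 = 1 - S\<^sup>2" using CS by simp
  have im: "Im (d * (Complex C (- S))\<^sup>2) = Im d - 2 * \<mu> d" for d
  proof -
    have "Im (d * (Complex C (- S))\<^sup>2) = C\<^sup>2 * Im d - S\<^sup>2 * Im d - 2 * S * C * Re d"
      by (simp add: power2_eq_square algebra_simps)
    then show ?thesis unfolding CC by (simp add: \<mu>_def power2_eq_square algebra_simps)
  qed
  have re: "Re (d * (Complex C (- S))\<^sup>2) * Re (d' * (Complex C (- S))\<^sup>2)
      = Re d * Re d' + Im d * Im d' - (Im d - 2 * \<mu> d) * (Im d' - 2 * \<mu> d')" for d d'
  proof -
    have "Re (d * (Complex C (- S))\<^sup>2) * Re (d' * (Complex C (- S))\<^sup>2) + Im (d * (Complex C (- S))\<^sup>2) * Im (d' * (Complex C (- S))\<^sup>2)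
      = (C\<^sup>2 + S\<^sup>2)\<^sup>2 * (Re d * Re d' + Im d * Im d')"
      by (simp add: power2_eq_square algebra_simps)
    then show ?thesis unfolding im CS by simp
  qed
  have 3: "bf t (dt + m *\<^sub>R t) (dt' + m' *\<^sub>R t) = bf t dt dt' + m * (K3 k t t dt' / (8 * h)) + m' * (K3 k t t dt / (8 * h)) + 3 / 4 * m * m'" for m m'
  proof -
    have r: "bf t t x = K3 k t t x / (8 * h)" "bf t x t = K3 k t t x / (8 * h)" for x
      using bf_radial[OF U_pos[OF t]] by (simp_all add: h_def)
    show ?thesis unfolding bf_bilinear r h(2) using h(1) by (simp add: field_simps)
  qed
  have 4: "K3 k t t (x + m *\<^sub>R t) / (4 * h) = K3 k t t x / (4 * h) + 3 / 2 * m" for x m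
    using h by (simp add: K3_simps field_simps)
  show ?thesis
    unfolding u v metric_base_def d_rot_def prod.case Let_def h_def[symmetric] 1 2 \<mu>_def[symmetric] im re 3 4
    by (simp add: algebra_simps add_divide_distrib diff_divide_distrib)
qed

lemma isom_rot:
  assumes t: "t \<in> U" and CS: "C\<^sup>2 + S\<^sup>2 = 1"
  shows "isom ((C, - S, S, C), 0) (to_iia k (base_pt t))"
proof -
  let ?R = "((C, - S, S, C), 0) :: gl \<times> 'n nil" and ?y = "base_pt t" and ?p = "to_iia k (base_pt t)"
  have R: "?R \<in> gp_dom" using CS by (simp add: gp_dom_def gl_det_def power2_eq_square)
  have y: "?y \<in> gen_tb U" and p: "?p \<in> NN" using base_pt_in[OF t] to_in by auto
  have D: "C * C + S * S = 1" using CS by (simp add: power2_eq_square)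
  have cm: "cmod (of_real S * \<i> + of_real C) = 1" using D by (simp add: cmod_def power2_eq_square)
  have fixed: "actC k ?R ?y = ?y"
  proof -
    have "of_real S * \<i> + of_real C \<noteq> 0" using cm by fastforce
    moreover have "of_real C * \<i> + of_real (- S) = \<i> * (of_real S * \<i> + of_real C)"
      by (simp add: complex_eq_iff)
    ultimately have "(of_real C * \<i> + of_real (- S)) / (of_real S * \<i> + of_real C) = \<i>"
      by simp
    then show ?thesis
      by (simp add: actC_def base_pt_def mob_def gl_nil_def cm)
  qed
  have act: "actC k ?R = (\<lambda>y. ((cmod (of_real S * snd (fst y) + of_real C) *\<^sub>R fst (fst y),
      (of_real C * snd (fst y) - of_real S) / (of_real S * snd (fst y) + of_real C)),
      (C *\<^sub>R fst (snd y) - S *\<^sub>R fst (snd (snd y)), S *\<^sub>R fst (snd y) + C *\<^sub>R fst (snd (snd y)),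
       fst (snd (snd (snd y))), C * fst (snd (snd (snd (snd y)))) - S * snd (snd (snd (snd (snd y)))),
       S * fst (snd (snd (snd (snd y)))) + C * snd (snd (snd (snd (snd y)))))))"
    by (rule ext) (simp add: actC_def mob_def gl_nil_def split_beta D)
  have M: "((\<lambda>y :: 'n tb. (of_real C * snd (fst y) - of_real S) / (of_real S * snd (fst y) + of_real C)) has_derivative
      (\<lambda>v. snd (fst v) * (Complex C (- S))\<^sup>2)) (at ?y)"
  proof -
    have n: "of_real S * \<i> + of_real C \<noteq> 0" using cm by fastforce
    have "((\<lambda>\<tau>. (of_real C * \<tau> - of_real S) / (of_real S * \<tau> + of_real C)) has_field_derivative
        (of_real C * (of_real S * \<i> + of_real C) - (of_real C * \<i> - of_real S) * of_real S) / ((of_real S * \<i> + of_real C) * (of_real S * \<i> + of_real C))) (at \<i>)"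
      using n by (auto intro!: derivative_eq_intros)
    also have "(of_real C * (of_real S * \<i> + of_real C) - (of_real C * \<i> - of_real S) * of_real S) / ((of_real S * \<i> + of_real C) * (of_real S * \<i> + of_real C))
        = (Complex C (- S))\<^sup>2"
    proof -
      have 1: "Complex C (- S) * (of_real S * \<i> + of_real C) = 1" using D by (simp add: complex_eq_iff algebra_simps)
      have 2: "of_real C * (of_real S * \<i> + of_real C) - (of_real C * \<i> - of_real S) * of_real S = 1"
        using D by (simp add: complex_eq_iff algebra_simps)
      have "Complex C (- S) = 1 / (of_real S * \<i> + of_real C)" using 1 n by (simp add: eq_divide_eq)
      then show ?thesis unfolding 2 by (simp add: power2_eq_square)
    qed
    finally have d: "((\<lambda>\<tau>. (of_real C * \<tau> - of_real S) / (of_real S * \<tau> + of_real C)) has_derivative (\<lambda>v. (Complex C (- S))\<^sup>2 * v)) (at (snd (fst ?y)))"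
      by (simp add: has_field_derivative_def base_pt_def)
    have "((\<lambda>y :: 'n tb. snd (fst y)) has_derivative (\<lambda>v. snd (fst v))) (at ?y)"
      by (rule derivative_intros)+
    from has_derivative_compose[OF this d] show ?thesis by (simp add: mult.commute)
  qed
  have N: "((\<lambda>y :: 'n tb. cmod (of_real S * snd (fst y) + of_real C)) has_derivative
      (\<lambda>v. S * (C * Re (snd (fst v)) + S * Im (snd (fst v))))) (at ?y)"
  proof -
    have "(\<lambda>y :: 'n tb. cmod (of_real S * snd (fst y) + of_real C)) = (\<lambda>y. sqrt ((S * Re (snd (fst y)) + C)\<^sup>2 + (S * Im (snd (fst y)))\<^sup>2))"
      by (simp add: cmod_def)
    moreover have "((\<lambda>y :: 'n tb. sqrt ((S * Re (snd (fst y)) + C)\<^sup>2 + (S * Im (snd (fst y)))\<^sup>2)) has_derivative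
      (\<lambda>v. S * (C * Re (snd (fst v)) + S * Im (snd (fst v))))) (at ?y)"
      using CS by (auto intro!: derivative_eq_intros simp: base_pt_def fun_eq_iff algebra_simps add.commute power2_eq_square)
    ultimately show ?thesis by simp
  qed
  have dact: "(actC k ?R has_derivative d_rot C S t) (at ?y)"
    unfolding act
    apply (rule has_derivative_eq_rhs, (rule M N derivative_intros has_derivative_Pair)+)
    using cm
    apply (auto simp: d_rot_def base_pt_def fun_eq_iff algebra_simps)
    done
  have chain: "frechet_derivative (actA k ?R) (at ?p) (d_to_iia k ?y v) = d_to_iia k ?y (d_rot C S t v)" for v
  proof -
    have "((\<lambda>y. actA k ?R (to_iia k y)) has_derivative (\<lambda>v. frechet_derivative (actA k ?R) (at ?p) (d_to_iia k ?y v))) (at ?y)"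
      by (rule has_derivative_compose[OF has_derivative_to_iia act_has_derivative[OF R p]])
    then have 1: "((\<lambda>y. to_iia k (actC k ?R y)) has_derivative (\<lambda>v. frechet_derivative (actA k ?R) (at ?p) (d_to_iia k ?y v))) (at ?y)"
      by (rule has_derivative_transform_within_open[OF _ open_gen_tb y]) (rule actA_to)
    have "(to_iia k has_derivative d_to_iia k ?y) (at (actC k ?R ?y))"
      unfolding fixed by (rule has_derivative_to_iia)
    from has_derivative_unique[OF 1 has_derivative_compose[OF dact this]] show ?thesis
      by (rule fun_cong)
  qed
  have surj: "\<exists>w. u = d_to_iia k ?y w" for u
  proof -
    have "((\<lambda>q. to_iia k (of_iia k q)) has_derivative (\<lambda>u. d_to_iia k ?y (frechet_derivative (of_iia k) (at ?p) u))) (at ?p)"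
      by (rule has_derivative_compose[OF smooth_on_imp_has_derivative[OF smooth_of_iia p]])
        (simp add: of_to[OF y] has_derivative_to_iia)
    then have "((\<lambda>q. q) has_derivative (\<lambda>u. d_to_iia k ?y (frechet_derivative (of_iia k) (at ?p) u))) (at ?p)"
      by (rule has_derivative_transform_within_open[OF _ open_gen_iia p]) (rule to_of)
    from fun_cong[OF has_derivative_unique[OF has_derivative_ident this], of u] show ?thesis by blast
  qed
  have ap: "actA k ?R ?p = ?p" using actA_to[OF y] fixed by simp
  show ?thesis
    unfolding isom_def ap metric_formula[OF p]
  proof (intro allI)
    fix u v
    obtain w w' where w: "u = d_to_iia k ?y w" "v = d_to_iia k ?y w'" using surj by metis
    show "metric_form ?p (frechet_derivative (actA k ?R) (at ?p) u) (frechet_derivative (actA k ?R) (at ?p) v) = metric_form ?p u v"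
      unfolding w chain metric_form_base[OF t] by (rule metric_base_rot[OF t CS])
  qed
qed

lemma isom_all:
  assumes g: "g \<in> gp_dom" and p: "p \<in> NN"
  shows "isom g p"
proof -
  obtain t \<tau> m where y: "p = to_iia k ((t, \<tau>), m)" "t \<in> U" "0 < Im \<tau>" "((t, \<tau>), m) \<in> gen_tb U"
    using iia_cases[OF p] by metis
  define l :: "gl \<times> 'n nil" where "l = ((Im \<tau>, Re \<tau>, 0, 1), m)"
  have l: "l \<in> gp_dom" using y by (simp add: l_def gp_dom_def gl_det_def)
  let ?p = "to_iia k (base_pt t)"
  have p0: "?p \<in> NN" using base_pt_in[OF y(2)] to_in by auto
  have lp: "actA k l ?p = p"
  proof -
    have "actC k l (base_pt t) = ((t, \<tau>), m)"
      by (simp add: actC_def l_def base_pt_def mob_def complex_eq_iff flip: zero_prod_def)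
    then show ?thesis unfolding y(1) actA_to[OF base_pt_in[OF y(2)]] by simp
  qed
  have isl: "isom l ?p" unfolding l_def by (rule isom_upper) (use y p0 in auto)
  obtain M n where gl: "gp_mul k g l = (M, n)" by (metis prod.exhaust)
  have "0 < gl_det M" using gp_mul_in[OF g l] unfolding gl by (simp add: gp_dom_def)
  then obtain x y w C S where M: "M = gl_mul (x, y, 0, w) (C, - S, S, C)" and pos: "0 < x" "0 < w"
    and CS: "C\<^sup>2 + S\<^sup>2 = 1"
    by (rule gl_iwasawa)
  have R: "((C, - S, S, C), 0 :: 'n nil) \<in> gp_dom" using CS by (simp add: gp_dom_def gl_det_def power2_eq_square)
  have Bd: "((x, y, 0, w), n) \<in> gp_dom" using pos by (simp add: gp_dom_def gl_det_def)
  have dec: "gp_mul k g l = gp_mul k ((x, y, 0, w), n) ((C, - S, S, C), 0)"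
    unfolding gl M by (simp add: gp_mul_def)
  have i1: "isom (gp_mul k g l) ?p"
    unfolding dec
    by (rule isom_mul[OF Bd R p0 isom_rot[OF y(2) CS] isom_upper[OF pos actA_in[OF R p0]]])
  have i2: "isom (gp_inv l) p" using isom_inv[OF l p0 isl] by (simp add: lp)
  have il: "gp_inv l \<in> gp_dom" by (rule gp_inv_in[OF l])
  have q: "actA k (gp_inv l) p = ?p" using act_iv(1)[OF l p0] by (simp add: lp)
  have i3: "isom (gp_mul k (gp_mul k g l) (gp_inv l)) p"
    by (rule isom_mul[OF gp_mul_in[OF g l] il p i2]) (simp add: q i1)
  have eq: "actA k (gp_mul k (gp_mul k g l) (gp_inv l)) r = actA k g r" if "r \<in> NN" for r
    using act_iv(2)[OF l that] by (simp add: actA_mul gp_mul_in g l il that actA_in)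
  have "gp_mul k (gp_mul k g l) (gp_inv l) = g"
    by (rule actA_faithful[OF gp_mul_in[OF gp_mul_in[OF g l] il] g eq])
  then show ?thesis using i3 by simp
qed

lemma G_isometries: "G \<subseteq> isometries NN (qmap_metric k)"
proof
  fix \<phi> assume "\<phi> \<in> G"
  then obtain g where g: "g \<in> gp_dom" "\<phi> = tr g" by (auto simp: G_def)
  have i: "gp_inv g \<in> gp_dom" by (rule gp_inv_in[OF g(1)])
  have e: "\<phi> q = actA k g q" if "q \<in> NN" for q using that by (simp add: g tr_def)
  have inv: "inv_into NN \<phi> q = actA k (gp_inv g) q" if "q \<in> NN" for q
  proof (rule inv_into_f_eq)
    show "inj_on \<phi> NN" using tr_Bij[OF g(1)] by (simp add: g Bij_def bij_betw_def)
    show "actA k (gp_inv g) q \<in> NN" by (rule actA_in[OF i that])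
    then show "\<phi> (actA k (gp_inv g) q) = q" by (simp add: e act_iv(2)[OF g(1) that])
  qed
  have "smooth_on NN \<phi>" using smooth_act_fixed[OF g(1)] smooth_on_cong[OF open_gen_iia, of \<phi> "actA k g"] e by blast
  moreover have "smooth_on NN (inv_into NN \<phi>)"
    using smooth_act_fixed[OF i] smooth_on_cong[OF open_gen_iia, of "inv_into NN \<phi>" "actA k (gp_inv g)"] inv by blast
  moreover have "qmap_metric k (\<phi> p) (frechet_derivative \<phi> (at p) u) (frechet_derivative \<phi> (at p) v) = qmap_metric k p u v"
    if p: "p \<in> NN" for p u v
  proof -
    have "(\<phi> has_derivative frechet_derivative (actA k g) (at p)) (at p)"
      by (rule has_derivative_transform_within_open[OF act_has_derivative[OF g(1) p] open_gen_iia p]) (simp add: e)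
    from frechet_derivative_at[OF this] have "frechet_derivative \<phi> (at p) = frechet_derivative (actA k g) (at p)" by simp
    then show ?thesis using isom_all[OF g(1) p] e[OF p] unfolding isom_def by metis
  qed
  ultimately show "\<phi> \<in> isometries NN (qmap_metric k)"
    using tr_Bij[OF g(1)] by (simp add: isometries_def g)
qed

end

section \<open>The cone over a projective special real manifold\<close>

lemma has_derivative_ray_bound:
  fixes f :: "'a::real_normed_vector \<Rightarrow> real"
  assumes "(f has_derivative D) (at p)" "0 < e"
  obtains d where "0 < d" "\<And>s r. 0 < s \<Longrightarrow> s < d \<Longrightarrow> \<bar>r\<bar> \<le> c \<Longrightarrow>
    \<bar>f (p + s *\<^sub>R (u + r *\<^sub>R v)) - f p - s * (D u + r * D v)\<bar> \<le> s * e"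
proof -
  define M where "M = norm u + \<bar>c\<bar> * norm v + 1"
  have M: "0 < M" by (simp add: M_def add_nonneg_pos)
  interpret D: bounded_linear D by (rule has_derivative_bounded_linear[OF assms(1)])
  obtain d where d: "0 < d" "\<And>y. norm (y - p) < d \<Longrightarrow> norm (f y - f p - D (y - p)) \<le> (e / M) * norm (y - p)"
    using assms M unfolding has_derivative_at_alt by (metis divide_pos_pos)
  show ?thesis
  proof (rule that)
    show "0 < d / M" using d(1) M by simp
    fix s r :: real assume s: "0 < s" "s < d / M" and r: "\<bar>r\<bar> \<le> c"
    have "norm (u + r *\<^sub>R v) \<le> norm u + \<bar>r\<bar> * norm v" by (metis norm_scaleR norm_triangle_ineq)
    also have "\<dots> \<le> M" using mult_right_mono[OF r norm_ge_zero[of v]] r by (simp add: M_def)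
    finally have "norm (s *\<^sub>R (u + r *\<^sub>R v)) \<le> s * M" using s by simp
    moreover have "s * M < d" using s(2) M by (simp add: field_simps)
    ultimately have "norm (f (p + s *\<^sub>R (u + r *\<^sub>R v)) - f p - D (s *\<^sub>R (u + r *\<^sub>R v)))
        \<le> (e / M) * norm (s *\<^sub>R (u + r *\<^sub>R v))"
      using d(2)[of "p + s *\<^sub>R (u + r *\<^sub>R v)"] by simp
    also have "\<dots> \<le> (e / M) * (s * M)"
      using \<open>norm (s *\<^sub>R (u + r *\<^sub>R v)) \<le> s * M\<close> assms(2) M by (intro mult_left_mono) auto
    also have "\<dots> = s * e" using M by simp
    finally show "\<bar>f (p + s *\<^sub>R (u + r *\<^sub>R v)) - f p - s * (D u + r * D v)\<bar> \<le> s * e"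
      by (simp add: D.scaleR D.add)
  qed
qed

lemma open_cone_over:
  assumes "\<And>p. p \<in> H \<Longrightarrow> \<exists>r>0. ball p r \<subseteq> cone_over H"
  shows "open (cone_over (H :: 'a::real_normed_vector set))"
  unfolding open_contains_ball
proof
  fix x assume "x \<in> cone_over H"
  then obtain s p where x: "x = s *\<^sub>R p" "0 < s" "p \<in> H" by (auto simp: cone_over_def)
  obtain r where r: "0 < r" "ball p r \<subseteq> cone_over H" using assms[OF x(3)] by blast
  have "y \<in> cone_over H" if "y \<in> ball x (s * r)" for y
  proof -
    have "p - (1 / s) *\<^sub>R y = (1 / s) *\<^sub>R (x - y)" using x by (simp add: scaleR_diff_right)
    then have "norm (p - (1 / s) *\<^sub>R y) = dist x y / s" using x by (simp add: dist_norm)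
    also have "\<dots> < r" using that x(2) by (simp add: field_simps)
    finally have "norm (p - (1 / s) *\<^sub>R y) < r" .
    then have "(1 / s) *\<^sub>R y \<in> cone_over H" using r(2) by (auto simp: dist_norm)
    then obtain s' q where q: "(1 / s) *\<^sub>R y = s' *\<^sub>R q" "0 < s'" "q \<in> H" by (auto simp: cone_over_def)
    then have "y = (s * s') *\<^sub>R q" using x(2) by (metis divide_self_if less_irrefl mult.commute scaleR_one scaleR_scaleR times_divide_eq_left mult_1)
    then show ?thesis using q x(2) unfolding cone_over_def
      by (intro CollectI exI[of _ "s * s'"] exI[of _ q]) auto
  qed
  then show "\<exists>e>0. ball x e \<subseteq> cone_over H" using r(1) x(2) by (intro exI[of _ "s * r"]) auto
qed

context sym_cubic
begin

lemma has_derivative_cubic: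
  "((\<lambda>x. cubic k x) has_derivative (\<lambda>v. K3 k p p v / 2)) (at (p :: real^'n))"
proof -
  have "((\<lambda>x. (1/6) * (x \<bullet> K2 k x x)) has_derivative
      (\<lambda>v. (1/6) * (p \<bullet> (K2 k p v + K2 k v p) + v \<bullet> K2 k p p))) (at p)"
    by (intro has_derivative_mult_right has_derivative_inner has_derivative_ident
        bounded_bilinear.FDERIV[OF bounded_bilinear_K2])
  moreover have "(1/6) * (p \<bullet> (K2 k p v + K2 k v p) + v \<bullet> K2 k p p) = K3 k p p v / 2" for v
    by (simp add: K_simps K3_commute)
  ultimately have "((\<lambda>x. (1/6) * (x \<bullet> K2 k x x)) has_derivative (\<lambda>v. K3 k p p v / 2)) (at p)"
    by (simp only:)
  then show ?thesis by (simp add: cubic_real K3_def)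
qed

text \<open>If the differential of the local equation \<open>f\<close> of \<open>H\<close> killed \<open>p\<close>, then \<open>f\<close> would vanish, by the
  intermediate value theorem, at some point \<open>p + s (p + r v)\<close> with small \<open>s, r\<close>, where the cubic
  exceeds \<open>1\<close>.\<close>

lemma defining_function_radial:
  fixes f :: "real^'n \<Rightarrow> real"
  assumes f: "(f has_derivative D) (at p)" and D: "D \<noteq> (\<lambda>v. 0)"
    and W: "open W" "p \<in> W" "continuous_on W f"
    and zero: "f p = 0" "\<And>x. x \<in> W \<Longrightarrow> f x = 0 \<Longrightarrow> cubic k x = 1"
  shows "D p \<noteq> 0"
proof
  assume Dp: "D p = 0"
  interpret D: bounded_linear D by (rule has_derivative_bounded_linear[OF f])
  obtain v where v: "0 < D v"
  proof -
    obtain w where "D w \<noteq> 0" using D by (auto simp: fun_eq_iff)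
    then have "0 < D w \<or> 0 < D (- w)" by (auto simp: linear_simps(4)[OF has_derivative_bounded_linear[OF f]])
    then show ?thesis using that by blast
  qed
  have h: "cubic k p = 1" using zero W by blast
  then have p3: "K3 k p p p = 6" by (simp add: cubic_real)
  define c where "c = 1 / (1 + \<bar>K3 k p p v / 2\<bar>)"
  have c: "0 < c" "c * \<bar>K3 k p p v / 2\<bar> \<le> 1" by (auto simp: c_def field_simps)
  obtain d1 where d1: "0 < d1" "\<And>s r. 0 < s \<Longrightarrow> s < d1 \<Longrightarrow> \<bar>r\<bar> \<le> c \<Longrightarrow>
    \<bar>f (p + s *\<^sub>R (p + r *\<^sub>R v)) - f p - s * (D p + r * D v)\<bar> \<le> s * (c * D v / 2)"
    using has_derivative_ray_bound[OF f, of "c * D v / 2" c p v] c v by auto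
  obtain d2 where d2: "0 < d2" "\<And>s r. 0 < s \<Longrightarrow> s < d2 \<Longrightarrow> \<bar>r\<bar> \<le> c \<Longrightarrow>
    \<bar>cubic k (p + s *\<^sub>R (p + r *\<^sub>R v)) - cubic k p - s * (K3 k p p p / 2 + r * (K3 k p p v / 2))\<bar> \<le> s * 1"
    using has_derivative_ray_bound[OF has_derivative_cubic, of 1 c p p v] by auto
  obtain r where r: "0 < r" "ball p r \<subseteq> W" using W by (meson openE)
  define M where "M = norm p + c * norm v + 1"
  have M: "0 < M" using c by (simp add: M_def add_nonneg_pos)
  define m where "m = min (min d1 d2) (r / M)"
  define s where "s = m / 2"
  have s: "0 < s" "s < d1" "s < d2" "s * M < r"
  proof -
    have *: "0 < m" "m \<le> d1" "m \<le> d2" "m \<le> r / M" using d1 d2 r M by (auto simp: m_def)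
    then show "0 < s" "s < d1" "s < d2" by (simp_all add: s_def)
    have "s < r / M" using *(1,4) unfolding s_def by linarith
    then show "s * M < r" using M by (simp add: field_simps)
  qed
  have inW: "p + s *\<^sub>R (p + q *\<^sub>R v) \<in> W" if "\<bar>q\<bar> \<le> c" for q
  proof -
    have "norm (p + q *\<^sub>R v) \<le> norm p + \<bar>q\<bar> * norm v" by (metis norm_scaleR norm_triangle_ineq)
    also have "\<dots> \<le> M" using mult_right_mono[OF that norm_ge_zero[of v]] by (simp add: M_def)
    finally have "s * norm (p + q *\<^sub>R v) < r"
      using s mult_left_mono[of "norm (p + q *\<^sub>R v)" M s] by linarith
    then show ?thesis using s(1) r(2) by (auto simp: dist_norm)
  qed
  have "continuous_on {-c..c} (\<lambda>q. f (p + s *\<^sub>R (p + q *\<^sub>R v)))"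
    by (rule continuous_on_compose2[OF W(3)]) (use inW in \<open>auto intro!: continuous_intros\<close>)
  moreover have "f (p + s *\<^sub>R (p + (-c) *\<^sub>R v)) \<le> 0" "0 \<le> f (p + s *\<^sub>R (p + c *\<^sub>R v))"
  proof -
    have "0 < s * (c * D v)" using s(1) c(1) v by simp
    moreover have "\<bar>f (p + s *\<^sub>R (p + (-c) *\<^sub>R v)) + s * (c * D v)\<bar> \<le> s * (c * D v) / 2"
      "\<bar>f (p + s *\<^sub>R (p + c *\<^sub>R v)) - s * (c * D v)\<bar> \<le> s * (c * D v) / 2"
      using d1(2)[OF s(1,2), of "-c"] d1(2)[OF s(1,2), of c] c(1) by (simp_all add: Dp zero(1))
    ultimately show "f (p + s *\<^sub>R (p + (-c) *\<^sub>R v)) \<le> 0" "0 \<le> f (p + s *\<^sub>R (p + c *\<^sub>R v))"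
      by linarith+
  qed
  ultimately obtain q where q: "-c \<le> q" "q \<le> c" "f (p + s *\<^sub>R (p + q *\<^sub>R v)) = 0"
    using IVT'[of "\<lambda>q. f (p + s *\<^sub>R (p + q *\<^sub>R v))" "-c" 0 c] c by auto
  then have qc: "\<bar>q\<bar> \<le> c" by simp
  have "cubic k (p + s *\<^sub>R (p + q *\<^sub>R v)) = 1" using zero(2)[OF inW[OF qc] q(3)] .
  then have "\<bar>s * (3 + q * (K3 k p p v / 2))\<bar> \<le> s"
    using d2(2)[OF s(1,3) qc] h p3 by simp
  then have "\<bar>3 + q * (K3 k p p v / 2)\<bar> \<le> 1" using s(1) by (simp add: abs_mult)
  moreover have "\<bar>q * (K3 k p p v / 2)\<bar> \<le> 1"
    using mult_right_mono[OF qc, of "\<bar>K3 k p p v / 2\<bar>"] c(2) by (simp add: abs_mult)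
  ultimately show False by linarith
qed

lemma radial_cone_neighbourhood:
  fixes f :: "real^'n \<Rightarrow> real"
  assumes f: "(f has_derivative D) (at p)" and D: "D p \<noteq> 0"
    and W: "open W" "p \<in> W" "continuous_on W f"
    and H: "H \<inter> W = {x\<in>W. f x = 0}" "p \<in> H"
  shows "\<exists>r>0. ball p r \<subseteq> cone_over H"
proof -
  define g where "g = (\<lambda>x. sgn (D p) * f x)"
  have Dp: "0 < sgn (D p) * D p" using D by (simp add: sgn_if)
  have g: "(g has_derivative (\<lambda>v. sgn (D p) * D v)) (at p)"
    unfolding g_def by (rule has_derivative_mult_right[OF f])
  have gc: "continuous_on W g" unfolding g_def by (intro continuous_intros W)
  have g0: "f x = 0" if "g x = 0" for x using that D by (simp add: g_def sgn_if split: if_splits)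
  have gp: "g p = 0" using H W by (auto simp: g_def)
  obtain d where d: "0 < d" "\<And>s r. 0 < s \<Longrightarrow> s < d \<Longrightarrow> \<bar>r\<bar> \<le> 1 \<Longrightarrow>
    \<bar>g (p + s *\<^sub>R (0 + r *\<^sub>R p)) - g p - s * (sgn (D p) * D 0 + r * (sgn (D p) * D p))\<bar> \<le> s * (sgn (D p) * D p / 2)"
    using has_derivative_ray_bound[OF g, of "sgn (D p) * D p / 2" 1 0 p] Dp by auto
  have D0: "D 0 = 0" using has_derivative_bounded_linear[OF f] by (rule linear_simps)
  obtain R where R: "0 < R" "ball p R \<subseteq> W" using W by (meson openE)
  define M where "M = 1 + norm p"
  have M: "0 < M" by (simp add: M_def add_pos_nonneg)
  define m where "m = min (min d 1) (R / (2 * M))"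
  define s where "s = m / 2"
  have s: "0 < s" "s < d" "s < 1" "s * norm p < R / 2"
  proof -
    have *: "0 < m" "m \<le> d" "m \<le> 1" "m \<le> R / (2 * M)" using d R M by (auto simp: m_def)
    then show s0: "0 < s" and "s < d" "s < 1" by (simp_all add: s_def)
    have "s < R / (2 * M)" using *(1,4) unfolding s_def by linarith
    then have "s * M < R / 2" using M by (simp add: field_simps)
    then show "s * norm p < R / 2" using s0 by (simp add: M_def algebra_simps)
  qed
  have inW: "q *\<^sub>R x \<in> W" if "\<bar>q - 1\<bar> \<le> s" "norm (x - p) < R / 4" for q x
  proof -
    have "norm (q *\<^sub>R x - p) = norm (q *\<^sub>R (x - p) + (q - 1) *\<^sub>R p)" by (simp add: algebra_simps)
    also have "\<dots> \<le> \<bar>q\<bar> * norm (x - p) + \<bar>q - 1\<bar> * norm p" by (metis norm_scaleR norm_triangle_ineq)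
    also have "\<dots> < R"
    proof -
      have "\<bar>q\<bar> * norm (x - p) \<le> 2 * norm (x - p)" using that s by (intro mult_right_mono) auto
      moreover have "\<bar>q - 1\<bar> * norm p \<le> s * norm p" using that by (intro mult_right_mono) auto
      ultimately show ?thesis using that s by linarith
    qed
    finally show ?thesis using R by (auto simp: dist_norm norm_minus_commute)
  qed
  have sg: "g ((1 - s) *\<^sub>R p) < 0" "0 < g ((1 + s) *\<^sub>R p)"
    using d(2)[OF s(1,2), of "-1"] d(2)[OF s(1,2), of 1] gp mult_pos_pos[OF s(1) Dp]
    by (simp_all add: D0 algebra_simps abs_if split: if_splits)
  have cont: "isCont (\<lambda>x. g (q *\<^sub>R x)) p" if "\<bar>q - 1\<bar> \<le> s" for q
  proof -
    have "isCont g (q *\<^sub>R p)" using inW[OF that, of p] R gc W(1) by (simp add: continuous_on_eq_continuous_at)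
    then show ?thesis by (rule isCont_o2[rotated]) (auto intro: continuous_intros)
  qed
  have "\<forall>\<^sub>F x in at p. g ((1 - s) *\<^sub>R x) < 0" "\<forall>\<^sub>F x in at p. 0 < g ((1 + s) *\<^sub>R x)"
    using cont[of "1 - s"] cont[of "1 + s"] sg s
    by (auto simp: isCont_def intro: order_tendstoD)
  moreover have "\<forall>\<^sub>F x in at p. x \<in> ball p (R / 4)" using R by (intro eventually_at_in_open') auto
  ultimately have "\<forall>\<^sub>F x in at p. x \<in> cone_over H"
  proof eventually_elim
    case (elim x)
    have x: "norm (x - p) < R / 4" using elim by (simp add: dist_norm norm_minus_commute)
    have "continuous_on {1 - s..1 + s} (\<lambda>q. g (q *\<^sub>R x))"
      by (rule continuous_on_compose2[OF gc]) (use inW[OF _ x] in \<open>auto intro!: continuous_intros\<close>)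
    then obtain q where q: "1 - s \<le> q" "q \<le> 1 + s" "g (q *\<^sub>R x) = 0"
      using IVT'[of "\<lambda>q. g (q *\<^sub>R x)" "1 - s" 0 "1 + s"] elim s(1) by auto
    then have "q *\<^sub>R x \<in> W" by (intro inW[OF _ x]) linarith
    then have "q *\<^sub>R x \<in> H" using q(3) g0 H(1) by auto
    moreover have "0 < q" using q s by simp
    ultimately show ?case unfolding cone_over_def
      by (intro CollectI exI[of _ "1 / q"] exI[of _ "q *\<^sub>R x"]) auto
  qed
  moreover have "p \<in> cone_over H" using H(2) unfolding cone_over_def by (intro CollectI exI[of _ 1] exI[of _ p]) auto
  ultimately obtain r where "0 < r" "\<And>x. dist x p < r \<Longrightarrow> x \<in> cone_over H"
    unfolding eventually_at by (metis UNIV_I)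
  then show ?thesis by (intro exI[of _ r]) (auto simp: dist_commute)
qed

lemma psr_cone_over:
  assumes "psr_manifold k H"
  shows "psr_cone_over k H"
proof -
  have H: "H \<noteq> {}" "smooth_hypersurface H" and h: "\<And>p. p \<in> H \<Longrightarrow> cubic k p = 1"
    and neg: "\<And>p v. p \<in> H \<Longrightarrow> v \<in> tangent_space H p \<Longrightarrow> v \<noteq> 0 \<Longrightarrow> K3 k p v v < 0"
    using assms C_sums(1) unfolding psr_manifold_def by (auto simp: partial_partial_cubic mult.assoc)
  have HC: "p \<in> cone_over H" if "p \<in> H" for p
    using that unfolding cone_over_def by (intro CollectI exI[of _ 1] exI[of _ p]) auto
  have op: "open (cone_over H)"
  proof (rule open_cone_over)
    fix p assume p: "p \<in> H"
    obtain W f where W: "open W" "p \<in> W" "smooth_on W f"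
      and nz: "\<And>x. x \<in> W \<Longrightarrow> frechet_derivative f (at x) \<noteq> (\<lambda>v. 0)"
      and HW: "H \<inter> W = {x \<in> W. f x = (0::real)}"
      using H(2)[unfolded smooth_hypersurface_def, rule_format, OF p] by blast
    note d = smooth_on_imp_has_derivative[OF W(3,2)] and c = smooth_on_imp_continuous_on[OF W(3)]
    have "frechet_derivative f (at p) p \<noteq> 0"
      by (rule defining_function_radial[OF d nz[OF W(2)] W(1,2) c]) (use p W HW h in auto)
    then show "\<exists>r>0. ball p r \<subseteq> cone_over H"
      using radial_cone_neighbourhood[OF d _ W(1,2) c HW p] by blast
  qed
  have hs: "cubic k (s *\<^sub>R p) = s ^ 3 * cubic k p" for s and p :: "real^'n"
    by (simp add: cubic_real K3_simps power3_eq_cube)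
  have CH: "p \<in> H" if p: "p \<in> cone_over H" "cubic k p = 1" for p
  proof -
    obtain s q where q: "p = s *\<^sub>R q" "0 < s" "q \<in> H" using p(1) by (auto simp: cone_over_def)
    then have "s ^ 3 = 1 ^ 3" using p(2) h by (simp add: hs)
    then have "s = 1" using q(2) by (metis power_eq_iff_eq_base less_eq_real_def zero_less_numeral zero_le_one)
    then show ?thesis using q by simp
  qed
  have pos: "0 < cubic k p" if "p \<in> cone_over H" for p
    using that h by (auto simp: cone_over_def hs)
  have tangent: "v \<in> tangent_space H p" if p: "p \<in> H" and v: "K3 k p p v = 0" for p v
  proof -
    obtain r where r: "0 < r" "ball p r \<subseteq> cone_over H" using op HC[OF p] by (meson openE)
    define e where "e = r / (1 + norm v)"
    have n: "0 < 1 + norm v" by (simp add: add_pos_nonneg)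
    have e: "0 < e" using r n by (simp add: e_def)
    have in_cone: "p + s *\<^sub>R v \<in> cone_over H" if "s \<in> {-e<..<e}" for s
    proof -
      have "\<bar>s\<bar> * (1 + norm v) < r" using that n by (auto simp: e_def field_simps abs_if)
      then have "\<bar>s\<bar> + \<bar>s\<bar> * norm v < r" by (simp add: ring_distribs)
      then have "\<bar>s\<bar> * norm v < r" by linarith
      then show ?thesis using r by (auto simp: dist_norm)
    qed
    define \<gamma> where "\<gamma> = (\<lambda>s. (cubic k (p + s *\<^sub>R v)) powr (-1/3) *\<^sub>R (p + s *\<^sub>R v))"
    have o: "open {-e<..<e}" by simp
    have "smooth_on {-e<..<e} (\<lambda>s. cubic k (p + s *\<^sub>R v))"
      unfolding cubic_real K3_def by (intro smooth_intros smooth_on_bilinear[OF bounded_bilinear_K2] o) simp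
    then have "smooth_on {-e<..<e} \<gamma>"
      unfolding \<gamma>_def by (intro smooth_intros o) (use pos in_cone in auto)
    moreover have "\<gamma> ` {-e<..<e} \<subseteq> H"
    proof clarify
      fix s assume s: "s \<in> {-e<..<e}"
      let ?h = "cubic k (p + s *\<^sub>R v)"
      have hp: "0 < ?h" by (rule pos[OF in_cone[OF s]])
      have "(?h powr (-1/3)) ^ 3 = ?h powr (-1)"
        using hp by (simp add: powr_power)
      then have "cubic k (\<gamma> s) = 1" using hp by (simp add: \<gamma>_def hs powr_minus_divide)
      moreover have "\<gamma> s \<in> cone_over H"
      proof -
        obtain s' q where "p + s *\<^sub>R v = s' *\<^sub>R q" "0 < s'" "q \<in> H"
          using in_cone[OF s] by (auto simp: cone_over_def)
        then show ?thesis unfolding cone_over_def \<gamma>_def using hp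
          by (intro CollectI exI[of _ "?h powr (-1/3) * s'"] exI[of _ q]) auto
      qed
      ultimately show "\<gamma> s \<in> H" by (rule CH[rotated])
    qed
    moreover have "\<gamma> 0 = p" using h[OF p] by (simp add: \<gamma>_def)
    moreover have "(\<gamma> has_vector_derivative v) (at 0)"
    proof -
      have l: "((\<lambda>s. p + s *\<^sub>R v) has_derivative (\<lambda>s. s *\<^sub>R v)) (at 0)"
        by (auto intro!: derivative_eq_intros)
      have "((\<lambda>s. cubic k (p + s *\<^sub>R v)) has_derivative (\<lambda>s. K3 k (p + 0 *\<^sub>R v) (p + 0 *\<^sub>R v) (s *\<^sub>R v) / 2)) (at 0)"
        by (rule has_derivative_compose[OF l has_derivative_cubic])
      then have "((\<lambda>s. cubic k (p + s *\<^sub>R v)) has_real_derivative 0) (at 0)"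
        using v by (simp add: has_field_derivative_def K3_simps lambda_zero)
      then have "((\<lambda>s. cubic k (p + s *\<^sub>R v) powr (-1/3)) has_real_derivative 0) (at 0)"
        by (rule has_real_derivative_powr[THEN DERIV_chain2, THEN DERIV_cong, rotated]) (use h[OF p] in auto)
      then have "((\<lambda>s. cubic k (p + s *\<^sub>R v) powr (-1/3)) has_vector_derivative 0) (at 0)"
        by (simp add: has_real_derivative_iff_has_vector_derivative)
      moreover have "((\<lambda>s. p + s *\<^sub>R v) has_vector_derivative v) (at 0)"
        using l by (simp add: has_vector_derivative_def)
      ultimately have "(\<gamma> has_vector_derivative
          cubic k (p + 0 *\<^sub>R v) powr (-1/3) *\<^sub>R v + 0 *\<^sub>R (p + 0 *\<^sub>R v)) (at 0)"
        unfolding \<gamma>_def by (rule bounded_bilinear.has_vector_derivative[OF bounded_bilinear_scaleR])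
      then show ?thesis using h[OF p] by simp
    qed
    ultimately show ?thesis unfolding tangent_space_def using e by blast
  qed
  show ?thesis
  proof unfold_locales
    show "open (cone_over H)" by (rule op)
    show "cone_over H \<noteq> {}" using H(1) HC by blast
    fix t assume t: "t \<in> cone_over H"
    then obtain s p where p: "t = s *\<^sub>R p" "0 < s" "p \<in> H" by (auto simp: cone_over_def)
    show "s' *\<^sub>R t \<in> cone_over H" if "0 < s'" for s'
      using p that unfolding cone_over_def by (intro CollectI exI[of _ "s' * s"] exI[of _ p]) auto
    show "0 < K3 k t t t" using pos[OF t] by (simp add: cubic_real)
    show "v = 0" if v: "K2 k t v = 0" for v
    proof (rule ccontr)
      assume "v \<noteq> 0"
      have z: "K2 k p v = 0" using v p by (simp add: K2_simps)
      have "K3 k p p v = 0" by (simp add: K3_def z)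
      then have "K3 k p v v < 0" by (rule neg[OF p(3) tangent[OF p(3)] \<open>v \<noteq> 0\<close>])
      moreover have "K3 k p v v = v \<bullet> K2 k p v" by (simp add: inner_K2 K3_commute)
      ultimately show False by (simp add: z)
    qed
  qed
qed

end

section \<open>The Lie group\<close>

lemma connected_gl: "connected {A. 0 < gl_det A}"
proof -
  let ?f = "\<lambda>(x, y, w, \<theta>). (x * cos \<theta> + y * sin \<theta>, - x * sin \<theta> + y * cos \<theta>, w * sin \<theta>, w * cos \<theta>) :: gl"
  let ?S = "{0<..} \<times> UNIV \<times> {0<..} \<times> UNIV :: gl set"
  have "connected ({0<..} :: real set)" by (simp add: is_interval_connected_1[symmetric])
  then have "connected ?S" by (intro connected_Times connected_UNIV)
  moreover have "continuous_on ?S ?f" by (simp add: split_beta) (intro continuous_intros)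
  ultimately have "connected (?f ` ?S)" by (rule connected_continuous_image[rotated])
  moreover have "?f ` ?S = {A. 0 < gl_det A}"
  proof (intro equalityI subsetI)
    fix A assume "A \<in> ?f ` ?S"
    then obtain x y w \<theta> where A: "A = ?f (x, y, w, \<theta>)" "0 < x" "0 < w" by auto
    have "gl_det A = x * w * ((cos \<theta>)\<^sup>2 + (sin \<theta>)\<^sup>2)"
      unfolding A(1) by (simp add: gl_det_def power2_eq_square algebra_simps del: sin_cos_squared_add3)
    then show "A \<in> {A. 0 < gl_det A}" using A by simp
  next
    fix A :: gl assume "A \<in> {A. 0 < gl_det A}"
    then obtain x y w C S where A: "A = gl_mul (x, y, 0, w) (C, - S, S, C)" "0 < x" "0 < w" and CS: "C\<^sup>2 + S\<^sup>2 = 1"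
      using gl_iwasawa by blast
    obtain \<theta> where "C = cos \<theta>" "S = sin \<theta>" using sincos_total_2pi[OF CS] by metis
    then have "A = ?f (x, y, w, \<theta>)" by (simp add: A gl_mul_def)
    then show "A \<in> ?f ` ?S" using A(2,3) by blast
  qed
  ultimately show ?thesis by simp
qed

lemma connected_gp_dom: "connected gp_dom"
  unfolding gp_dom_def by (intro connected_Times connected_gl connected_UNIV)

lemma gl_nil_iso:
  obtains L :: "gl \<times> 'n::finite nil \<Rightarrow> real^('n + 'n + 'n + 6)" and L'
  where "linear L" "linear L'" "\<And>x. L' (L x) = x" "\<And>y. L (L' y) = y"
proof -
  have "DIM(gl \<times> 'n nil) = DIM(real^('n + 'n + 'n + 6))" by simp
  then show ?thesis by (rule isomorphisms_UNIV_UNIV) (rule that)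
qed

theorem theorem3p17:
  fixes k :: "'n::finite \<Rightarrow> 'n \<Rightarrow> 'n \<Rightarrow> real"
    and H :: "(real^'n) set"
  assumes "\<And>a b c. k a b c = k b a c"
    and "\<And>a b c. k a b c = k a c b"
    and "psr_manifold k H"
  shows "let N = qmap_space H; br = lie_bracket N;
      D = D_field N; P = P_field N; X = X_field N; Z = Z_field N; V = V_field k N;
      Xe = fundamental_field k H sl2_e; Xf = fundamental_field k H sl2_f;
      Xh = fundamental_field k H sl2_h;
      \<hh> = span ({Z} \<union> range (\<lambda>a. P (Some a)) \<union> range X)
    in
    \<comment> \<open>charts take values in a Euclidean space of dimension \<open>3n + 6\<close>\<close>
    (\<exists>G T (A :: ('n iia \<Rightarrow> 'n iia, real^('n + 'n + 'n + 6)) atlas).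
       lie_transformation_group N G T A \<and> connected_space T \<and>
       G \<subseteq> isometries N (qmap_metric k) \<and>
       L_action k H \<subseteq> G \<and> S_duality k H ` SL2 \<subseteq> G \<and>
       lie_algebra_vf N T A =
         span ({D, Xe, Xf, Xh} \<union> range V \<union> range (\<lambda>a. P (Some a)) \<union> range X \<union> {Z}) \<and>
       (\<exists>\<mm> \<nn>.
          semidirect_sum N (lie_algebra_vf N T A) (span {D}) \<mm> \<and>
          semidirect_sum N \<mm> (span {Xe, Xf, Xh}) \<nn> \<and>
          semidirect_sum N \<nn> (span (range V)) \<hh>)) \<and>
    isomorphic_sl2_op N (span {Xe, Xf, Xh}) \<and>
    Xe = P None \<and>
    \<comment> \<open>the non-trivial brackets\<close>
    (\<forall>i j. br (P i) (X j) = (if i = j then - 2 *\<^sub>R Z else 0)) \<and>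
    (\<forall>i. br (X i) D = (1/2) *\<^sub>R X i) \<and> (\<forall>i. br (P i) D = (1/2) *\<^sub>R P i) \<and> br Z D = Z \<and>
    br Xe Xf = - Xh \<and> br Xh Xe = - 2 *\<^sub>R Xe \<and> br Xh Xf = 2 *\<^sub>R Xf \<and>
    (\<forall>a. br (P None) (V a) = P (Some a)) \<and>
    (\<forall>a b. br (V a) (P (Some b)) = (\<Sum>c\<in>UNIV. k a b c *\<^sub>R X (Some c))) \<and>
    (\<forall>a b. br (V a) (X (Some b)) = (if a = b then X None else 0)) \<and>
    (\<forall>a. br Xh (V a) = V a) \<and> (\<forall>a. br Xf (P (Some a)) = V a) \<and>
    br D Xf = (1/2) *\<^sub>R Xf \<and> br Z Xf = (1/2) *\<^sub>R X None \<and>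
    (\<forall>a. br (P (Some a)) Xh = P (Some a)) \<and>
    br Xh (X None) = X None \<and> br Z Xh = Z \<and>
    \<comment> \<open>all other brackets of generators vanish\<close>
    br D Xh = 0 \<and> (\<forall>a. br D (V a) = 0) \<and>
    (\<forall>a. br Xe (P (Some a)) = 0) \<and> br Xe Z = 0 \<and>
    (\<forall>a. br Xf (V a) = 0) \<and> (\<forall>i. br Xf (X i) = 0) \<and>
    (\<forall>a. br Xh (X (Some a)) = 0) \<and>
    (\<forall>a b. br (V a) (V b) = 0) \<and> (\<forall>a. br (V a) (X None) = 0) \<and> (\<forall>a. br (V a) Z = 0) \<and>
    (\<forall>a b. br (P (Some a)) (P (Some b)) = 0) \<and> (\<forall>a. br (P (Some a)) Z = 0) \<and>
    (\<forall>i j. br (X i) (X j) = 0) \<and> (\<forall>i. br (X i) Z = 0)"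
proof -
  interpret sym_cubic k by unfold_locales (rule assms)+
  interpret psr_cone_over k H by (rule psr_cone_over[OF assms(3)])
  obtain L :: "gl \<times> 'n nil \<Rightarrow> real^('n + 'n + 'n + 6)" and L'
    where L: "linear L" "linear L'" "\<And>x. L' (L x) = x" "\<And>y. L (L' y) = y"
    by (rule gl_nil_iso) blast
  interpret lie_action gp_dom NN "gp_mul k" gp_inv "(gl_one, 0)" "actA k" L L'
    by (intro lie_action.intro lie_action_axioms.intro smooth_action_axioms L)
  have lie: "lie_algebra_vf NN T A = range fund" by (rule lie_algebra_vf_eq)
  have gens: "range fund = span ({D_field NN, P_field NN None, FXf, FXh} \<union> range (V_field k NN) \<union>
      range (\<lambda>a. P_field NN (Some a)) \<union> range (X_field NN) \<union> {Z_field NN})"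
    by (rule range_fund)
  have group: "\<exists>G T (A :: ('n iia \<Rightarrow> 'n iia, real^('n + 'n + 'n + 6)) atlas).
      lie_transformation_group NN G T A \<and> connected_space T \<and>
      G \<subseteq> isometries NN (qmap_metric k) \<and> L_action k H \<subseteq> G \<and> S_duality k H ` SL2 \<subseteq> G \<and>
      lie_algebra_vf NN T A = span ({D_field NN, P_field NN None, FXf, FXh} \<union> range (V_field k NN) \<union>
        range (\<lambda>a. P_field NN (Some a)) \<union> range (X_field NN) \<union> {Z_field NN}) \<and>
      (\<exists>\<mm> \<nn>. semidirect_sum NN (lie_algebra_vf NN T A) (span {D_field NN}) \<mm> \<and>
        semidirect_sum NN \<mm> (span {P_field NN None, FXf, FXh}) \<nn> \<and>
        semidirect_sum NN \<nn> (span (range (V_field k NN)))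
          (span ({Z_field NN} \<union> range (\<lambda>a. P_field NN (Some a)) \<union> range (X_field NN))))"
    using lie_transformation_group_G connected_T[OF connected_gp_dom] G_isometries L_action_in_G
      S_duality_in_G lie gens semidirect_D semidirect_sl2 semidirect_vs unfolding span_vs span_hs
    by metis
  show ?thesis
    unfolding Let_def qmap_space_gen fundamental_fields
    by (intro conjI group sl2_iso refl br_sl2 br_Xh_Xf bracket_table allI)
qed

end
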